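(* For any integers $\ell\ge1$, $k\ge0$ and $n\ge0$, $$\overline{\mathrm{spt}}_\omega\left(5^{2k+\ell-1}(10n+5)\right)\equiv\overline{\mathrm{spt}}_\omega\left(5^{\ell-1}(10n+5)\right)\pmod{5^\ell},$$ $$\overline{\mathrm{spt}}_\omega\left(5^{2\ell}(10n+3)\right)\equiv\overline{\mathrm{spt}}_\omega\left(5^{2\ell}(10n+7)\right)\equiv0\pmod{5^{2\ell}}.$$
   Context: An overpartition of $n$ is a finite weakly decreasing sequence of positive integers with sum $n$ in which the first occurrence of each number may (or may not) be overlined. The function $\overline{\mathrm{spt}}_\omega(n)$ denotes the number of smallest parts (i.e. the total number of appearances of the smallest part, summed over all the overpartitions considered) in the overpartitions of $n$ in which the smallest part is always overlined (i.e. its first occurrence is overlined) and all odd parts are less than twice the smallest part. Its generating function is $$\sum_{n=0}^\infty\overline{\mathrm{spt}}_\omega(n)q^n=\sum_{n=1}^\infty\frac{q^n(-q^{n+1};q)_n(-q^{2n+2};q^2)_\infty}{(1-q^n)^2(q^{n+1};q)_n(q^{2n+2};q^2)_\infty},$$ where $(a;q)_n=\prod_{j=1}^n(1-aq^{j-1})$ for $n\in\mathbb{N}\cup\{\infty\}$. *)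

theory Defs
  imports "HOL-Number_Theory.Cong"
begin

text \<open>
  An overpartition is encoded as the list of its parts in weakly decreasing order,
  each paired with a flag that is \<open>True\<close> iff that occurrence is overlined.
\<close>

definition is_overpartition :: "nat \<Rightarrow> (nat \<times> bool) list \<Rightarrow> bool" where
  "is_overpartition n xs \<longleftrightarrow>
     sorted_wrt (\<ge>) (map fst xs) \<and>
     (\<forall>x \<in> set xs. fst x > 0) \<and>
     sum_list (map fst xs) = n \<and>
     (\<forall>j < length xs. snd (xs ! j) \<longrightarrow> (\<forall>i < j. fst (xs ! i) \<noteq> fst (xs ! j)))"

definition smallest_part :: "(nat \<times> bool) list \<Rightarrow> nat" where
  "smallest_part xs = Min (fst ` set xs)"

definition spt_overpartitions :: "nat \<Rightarrow> (nat \<times> bool) list set" where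
  "spt_overpartitions n = {xs. is_overpartition n xs \<and>
     (smallest_part xs, True) \<in> set xs \<and>
     (\<forall>x \<in> set xs. odd (fst x) \<longrightarrow> fst x < 2 * smallest_part xs)}"

definition spt_omega_bar :: "nat \<Rightarrow> nat" where
  "spt_omega_bar n =
     (\<Sum>xs \<in> spt_overpartitions n. count_list (map fst xs) (smallest_part xs))"

text \<open>
  The index set of the sum is finite, so the sum is the genuine one. The empty
  overpartition of 0 has no smallest part and is excluded by the membership condition.
\<close>

lemma finite_spt_overpartitions: "finite (spt_overpartitions n)"
proof (rule finite_subset)
  show "spt_overpartitions n \<subseteq> {xs. set xs \<subseteq> {..n} \<times> UNIV \<and> length xs \<le> n}"
  proof
    fix xs assume "xs \<in> spt_overpartitions n"
    then have pos: "\<forall>x \<in> set xs. fst x > 0" and s: "sum_list (map fst xs) = n"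
      by (auto simp: spt_overpartitions_def is_overpartition_def)
    have "length ys \<le> sum_list (map fst ys)" if "\<forall>x \<in> set ys. fst x > 0"
      for ys :: "(nat \<times> bool) list"
      using that by (induction ys) auto
    moreover have "fst x \<le> n" if "x \<in> set xs" for x
      using member_le_sum_list[of "fst x" "map fst xs"] that s by simp
    ultimately show "xs \<in> {xs. set xs \<subseteq> {..n} \<times> UNIV \<and> length xs \<le> n}"
      using pos s by (force simp: mem_Times_iff)
  qed
  show "finite {xs :: (nat \<times> bool) list. set xs \<subseteq> {..n} \<times> UNIV \<and> length xs \<le> n}"
    by (rule finite_lists_length_le) simp
qed

end

theory Submission
  imports Defs "HOL-Computational_Algebra.Computational_Algebra"
begin

text \<open>
  Write \<open>q\<close> for the indeterminate, \<open>b n\<close> for \<open>spt_omega_bar n\<close>, \<open>phi\<close> for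
  \<open>\<phi>(-q) = \<Sum>(-1)^n q^(n^2)\<close>, the sum being over all integers, and
  \<open>F = \<Sum>b(2n+1) q^n\<close>. The arguments of \<open>b\<close> in the theorem are all odd, and the operator
  \<open>U: \<Sum>c(n) q^n \<mapsto> \<Sum>c(5n+2) q^n\<close> satisfies
  \<open>U^l F = \<Sum>b(5^l (2n+1)) q^n\<close>, since \<open>2(5n+2)+1 = 5(2n+1)\<close>. Hence the theorem is
  a statement about the iterates of \<open>U\<close> on \<open>F\<close>, and two things have to be understood: what \<open>F\<close>
  is, and how \<open>U\<close> acts \<open>5\<close>-adically.

  As for \<open>F\<close>, the theorem \<open>spt_series_odd_part\<close> shows \<open>F phi = \<Sum>\<sigma>(2n+1) q^n\<close>.
  Sorting the overpartitions by their smallest part and multiplying their generating function by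
  \<open>\<phi>(-q^2)\<close> gives the series
  \<open>\<Sum>_(m\<ge>1) q^m/(1-q^m)^2 (-q;q^2)_m (q)_m^2/(q)_(2m)\<close>. The finite Jacobi triple product at the
  fourth root of unity \<open>\<i>\<close> expands \<open>(-q;q^2)_m/(q)_(2m)\<close> into the products
  \<open>1/((q)_(m-2r) (q)_(m+2r))\<close> with coefficients \<open>(-1)^r q^(2r^2)\<close>
  (\<open>gauss_identity\<close>), and for every fixed \<open>r \<noteq> 0\<close> the resulting sum over \<open>m\<close> telescopes to a series in
  \<open>q^2\<close> (\<open>geo2_G_ratio_telescope\<close>). The odd part therefore comes from \<open>r = 0\<close> alone,
  where it is that of \<open>\<Sum>q^m/(1-q^m)^2 = \<Sum>\<sigma>(n) q^n\<close> (\<open>smallest_series_odd\<close>).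

  As for \<open>U\<close>, the divisor series equals \<open>\<psi>(q)^4\<close>
  (\<open>sigma_odd_series_eq\<close>), so \<open>F\<close> is a quotient of theta functions. Splitting \<open>phi\<close> according to the
  residues of the exponents modulo \<open>5\<close> expresses it by two series \<open>a\<close>, \<open>b\<close> in \<open>q\<close> whose product and
  whose \<open>a^5 - b^5\<close> are known series in \<open>q^5\<close>; the latter is obtained from the product of
  \<open>phi\<close> over \<open>q \<mapsto> \<zeta>q\<close>, \<open>\<zeta>^5 = 1\<close>
  (\<open>phi_norm\<close>). Let \<open>t\<close> be the generator \<open>t_fun\<close> of the field of modular functions of level ten
  and put \<open>f0 = F (1+4t)/(1+5t)^2\<close> and \<open>g0 = f0 phi/phi5\<close> with \<open>phi5 = \<phi>(-q^5)\<close>; these are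
  eta quotients. Polynomial identities in \<open>a\<close> and \<open>b\<close> (\<open>key_identity\<close>, \<open>sections_NN\<close>)
  show \<open>U f0 = -g0\<close>, \<open>U g0 = -f0\<close>, and that \<open>f0\<close> has no terms \<open>q^n\<close> with
  \<open>n \<equiv> 1, 3\<close> modulo \<open>5\<close>. The quintic equation of \<open>phi\<close> over the series in \<open>q^5\<close>
  (\<open>Dp_Np\<close>) adds recurrences that lead to \<open>U(f0 t^j) = g0 A_j(t)\<close> and \<open>U(g0 t^j) = f0 B_j(t)\<close>
  with integer polynomials for \<open>j < 5\<close>, and the modular equation of degree five extends this to all \<open>j\<close>.

  The coefficients of \<open>t^i\<close> in \<open>A_j\<close> and \<open>B_j\<close> are divisible by powers of \<open>5\<close> growing like
  \<open>(i - j)/2\<close>. Hence \<open>U\<close> maps suitable lattices \<open>f0 L\<close>, \<open>g0 L'\<close> of integer polynomials in \<open>t\<close>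
  to \<open>\<int>g0 + 5 g0 L'\<close> and \<open>\<int>f0 + 5 f0 L\<close> (\<open>lattice_transfer\<close>).
  Since \<open>f0\<close> and \<open>g0\<close> are permuted by \<open>-U\<close>, induction yields
  \<open>U^l F = c_l h_l + 5^l h_l r_l(t)\<close> for \<open>l \<ge> 1\<close>, where \<open>h_l\<close> is \<open>f0\<close> for even \<open>l\<close> and \<open>g0\<close> for odd \<open>l\<close>, and
  \<open>c_(l+1) \<equiv> -c_l\<close> modulo \<open>5^l\<close> (\<open>approximates_step\<close>). So \<open>U^(l+2) F \<equiv> U^l F\<close>
  modulo \<open>5^l\<close>, which is the first congruence, and for even \<open>l\<close> the coefficients of \<open>U^l F\<close> at
  \<open>5n+1\<close> and \<open>5n+3\<close>, where \<open>f0\<close> vanishes, are divisible by \<open>5^l\<close>, which is the second one.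
\<close>

section \<open>Truncated series and Euler products\<close>

definition agree :: "nat \<Rightarrow> 'a fps \<Rightarrow> 'a fps \<Rightarrow> bool" where
  "agree N f g \<longleftrightarrow> (\<forall>i<N. f $ i = g $ i)"

lemma agree_refl [simp]: "agree N f f"
  by (simp add: agree_def)

lemma agree_sym: "agree N f g \<Longrightarrow> agree N g f"
  by (simp add: agree_def)

lemma agree_trans [trans]: "agree N f g \<Longrightarrow> agree N g h \<Longrightarrow> agree N f h"
  by (simp add: agree_def)

lemma agree_eqI: "(\<And>N. agree N f g) \<Longrightarrow> f = g"
  unfolding agree_def fps_eq_iff by blast

lemma agree_sum: "(\<And>x. x \<in> A \<Longrightarrow> agree N (f x) (g x)) \<Longrightarrow> agree N (\<Sum>x\<in>A. f x) (\<Sum>x\<in>A. g x)"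
  by (auto simp: agree_def fps_sum_nth)

lemma agree_mult:
  "agree N f g \<Longrightarrow> agree N f' g' \<Longrightarrow> agree N (f * f') (g * g' :: 'a :: comm_semiring_1 fps)"
  by (auto simp: agree_def fps_mult_nth intro!: sum.cong)

lemma agree_X_power_mult:
  fixes f :: "'a :: comm_ring_1 fps"
  shows "N \<le> k + M \<Longrightarrow> agree M f g \<Longrightarrow> agree N (fps_X ^ k * f) (fps_X ^ k * g)"
  by (auto simp: agree_def fps_X_power_mult_nth)

text \<open>
  The coefficients are those of \<open>-q f'/f\<close> for \<open>f = \<Prod>(1 - q^d)^(e d)\<close>. Describing an infinite
  product by its logarithmic derivative avoids limits, allows negative exponents, and turns identities between
  products into identities between their exponents.
\<close>

definition log_series :: "(nat \<Rightarrow> 'a) \<Rightarrow> 'a :: comm_ring_1 fps" where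
  "log_series e = Abs_fps (\<lambda>N. if N = 0 then 0 else \<Sum>d | d dvd N. of_nat d * e d)"

definition euler_product :: "'a :: field_char_0 fps \<Rightarrow> (nat \<Rightarrow> 'a) \<Rightarrow> bool" where
  "euler_product f e \<longleftrightarrow> f $ 0 = 1 \<and> fps_X * fps_deriv f = - (f * log_series e)"

lemma log_series_add: "log_series (\<lambda>d. e d + e' d) = log_series e + log_series e'"
  by (auto simp: log_series_def fps_eq_iff sum.distrib algebra_simps)

lemma log_series_uminus: "log_series (\<lambda>d. - e d) = - log_series e"
  by (auto simp: log_series_def fps_eq_iff sum_negf)

lemma log_series_agree:
  assumes "\<And>d. 0 < d \<Longrightarrow> d < N \<Longrightarrow> e d = e' d"
  shows "agree N (log_series e) (log_series e')"
  unfolding agree_def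
proof (intro allI impI)
  fix i assume i: "i < N"
  have "(\<Sum>d | d dvd i. of_nat d * e d) = (\<Sum>d | d dvd i. of_nat d * e' d)" if "i > 0"
  proof (intro sum.cong refl)
    fix d assume "d \<in> {d. d dvd i}"
    with that i have "0 < d" "d < N"
      by (auto dest: dvd_imp_le intro: Nat.gr0I)
    then show "of_nat d * e d = of_nat d * e' d" using assms by simp
  qed
  then show "log_series e $ i = log_series e' $ i" by (simp add: log_series_def)
qed

text \<open>
  The differential equation is a recursion \<open>n f_n = -\<Sum>f_i l_(n-i)\<close> for the coefficients of
  \<open>f\<close>, and the logarithmic series up to degree \<open>n\<close> only involves exponents \<open>e d\<close> with \<open>d \<le> n\<close>.
\<close>

lemma euler_product_agree:
  assumes f: "euler_product f e" and g: "euler_product g e'"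
    and e: "\<And>d. 0 < d \<Longrightarrow> d < N \<Longrightarrow> e d = e' d"
  shows "agree N f g"
proof -
  have "f $ n = g $ n" if "n < N" for n
    using that
  proof (induction n rule: less_induct)
    case (less n)
    show ?case
    proof (cases "n = 0")
      case True
      then show ?thesis using f g by (simp add: euler_product_def)
    next
      case False
      have coeff: "of_nat n * h $ n = - (\<Sum>i<n. h $ i * log_series u $ (n - i))"
        if h: "euler_product h u" for h :: "'a fps" and u
      proof -
        have "(fps_X * fps_deriv h) $ n = of_nat n * h $ n"
          using False by (simp add: fps_X_mult_nth)
        moreover have "(h * log_series u) $ n = (\<Sum>i<n. h $ i * log_series u $ (n - i))"
          by (simp add: fps_mult_nth atLeast0AtMost lessThan_Suc_atMost[symmetric])
            (simp add: log_series_def)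
        moreover have "fps_X * fps_deriv h = - (h * log_series u)"
          using h by (simp add: euler_product_def)
        ultimately show ?thesis by (metis fps_neg_nth)
      qed
      have "(\<Sum>i<n. f $ i * log_series e $ (n - i)) = (\<Sum>i<n. g $ i * log_series e' $ (n - i))"
        using less log_series_agree[of N e e', OF e] by (intro sum.cong) (auto simp: agree_def)
      then have "of_nat n * f $ n = of_nat n * g $ n"
        using coeff[OF f] coeff[OF g] by simp
      then show ?thesis using False by simp
    qed
  qed
  then show ?thesis by (simp add: agree_def)
qed

lemma euler_product_unique:
  assumes "euler_product f e" "euler_product g e'" "\<And>d. 0 < d \<Longrightarrow> e d = e' d"
  shows "f = g"
  using euler_product_agree[OF assms(1,2)] assms(3) by (intro agree_eqI) blast

lemma euler_product_1: "euler_product 1 (\<lambda>_. 0)"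
  by (simp add: euler_product_def log_series_def fps_eq_iff)

lemma euler_product_mult:
  assumes "euler_product f e" "euler_product g e'"
  shows "euler_product (f * g) (\<lambda>d. e d + e' d)"
proof -
  have "fps_X * fps_deriv (f * g) = f * (fps_X * fps_deriv g) + g * (fps_X * fps_deriv f)"
    by (simp add: algebra_simps)
  also have "\<dots> = - (f * g * log_series (\<lambda>d. e d + e' d))"
    using assms by (simp add: euler_product_def log_series_add algebra_simps)
  finally show ?thesis using assms by (simp add: euler_product_def)
qed

lemma euler_product_power:
  assumes "euler_product f e"
  shows "euler_product (f ^ k) (\<lambda>d. of_nat k * e d)"
proof (induction k)
  case (Suc k)
  from euler_product_mult[OF assms Suc] show ?case
    by (simp add: algebra_simps)
qed (simp add: euler_product_1)

lemma euler_product_prod: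
  assumes "\<And>x. x \<in> A \<Longrightarrow> euler_product (f x) (e x)"
  shows "euler_product (\<Prod>x\<in>A. f x) (\<lambda>d. \<Sum>x\<in>A. e x d)"
  using assms
proof (induction A rule: infinite_finite_induct)
  case (insert x A)
  then show ?case using euler_product_mult[of "f x" "e x"] by simp
qed (simp_all add: euler_product_1)

lemma euler_product_cancel:
  assumes "euler_product f e" "euler_product (f * g) e'"
  shows "euler_product g (\<lambda>d. e' d - e d)"
proof -
  have f0: "f $ 0 = 1" using assms by (simp add: euler_product_def)
  have "fps_X * fps_deriv (f * g) = f * (fps_X * fps_deriv g) + g * (fps_X * fps_deriv f)"
    by (simp add: algebra_simps)
  moreover have "fps_X * fps_deriv (f * g) = - (f * g * log_series e')"
    "fps_X * fps_deriv f = - (f * log_series e)"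
    using assms by (simp_all add: euler_product_def)
  ultimately have "f * (fps_X * fps_deriv g) = - (f * g * log_series e') + g * (f * log_series e)"
    by (simp add: eq_diff_eq)
  then have "f * (fps_X * fps_deriv g) = f * (- (g * (log_series e' - log_series e)))"
    by (simp add: algebra_simps)
  moreover have "f \<noteq> 0" using f0 by auto
  ultimately have "fps_X * fps_deriv g = - (g * (log_series e' - log_series e))"
    using mult_left_cancel by blast
  moreover have "log_series e' - log_series e = log_series (\<lambda>d. e' d - e d)"
    using log_series_add[of e' "\<lambda>d. - e d"] by (simp add: log_series_uminus)
  moreover have "g $ 0 = 1" using assms f0 by (simp add: euler_product_def)
  ultimately show ?thesis by (simp add: euler_product_def)
qed

lemma euler_product_inverse:
  assumes "euler_product f e"
  shows "euler_product (inverse f) (\<lambda>d. - e d)"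
proof -
  have "f * inverse f = 1"
    using assms by (intro inverse_mult_eq_1') (simp add: euler_product_def)
  then show ?thesis using euler_product_cancel[OF assms, of "inverse f" "\<lambda>_. 0"] euler_product_1 by simp
qed

text \<open>
  Finite products whose factors are exhausted up to degree \<open>N\<close> determine the product of all factors.
\<close>

lemma euler_product_limit:
  assumes "\<And>N. \<exists>g e'. euler_product g e' \<and> agree N g f \<and> (\<forall>d. 0 < d \<and> d < N \<longrightarrow> e' d = e d)"
  shows "euler_product f e"
proof -
  have "f $ 0 = 1"
    using assms[of 1] by (auto simp: euler_product_def agree_def)
  moreover have "agree N (fps_X * fps_deriv f) (- (f * log_series e))" for N
  proof -
    obtain g e' where g: "euler_product g e'" "agree (N + 1) g f"
      and e: "\<And>d. 0 < d \<Longrightarrow> d < N + 1 \<Longrightarrow> e' d = e d"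
      using assms[of "N + 1"] by blast
    have "agree N (fps_X * fps_deriv f) (fps_X * fps_deriv g)"
      using g(2) by (auto simp: agree_def fps_X_mult_nth)
    also have "fps_X * fps_deriv g = - (g * log_series e')"
      using g(1) by (simp add: euler_product_def)
    also have "agree N (- (g * log_series e')) (- (f * log_series e))"
      using agree_mult[OF g(2) log_series_agree[OF e]] by (auto simp: agree_def)
    finally show ?thesis .
  qed
  then have "fps_X * fps_deriv f = - (f * log_series e)" by (rule agree_eqI)
  ultimately show ?thesis by (simp add: euler_product_def)
qed

lemma euler_product_one_minus:
  assumes "n > 0"
  shows "euler_product (1 - fps_X ^ n :: 'a :: field_char_0 fps) (\<lambda>d. if d = n then 1 else 0)"
proof -
  define L where "L = (log_series (\<lambda>d. if d = n then 1 else 0) :: 'a fps)"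
  have nth: "L $ N = (if N > 0 \<and> n dvd N then of_nat n else 0)" for N
  proof (cases "N = 0")
    case False
    have "(\<Sum>d | d dvd N. of_nat d * (if d = n then 1 else 0) :: 'a)
        = (\<Sum>d | d dvd N. if d = n then of_nat n else 0)"
      by (intro sum.cong) auto
    then show ?thesis using False by (simp add: L_def log_series_def sum.delta)
  qed (simp add: L_def log_series_def)
  have "(1 - fps_X ^ n) * L = of_nat n * fps_X ^ n"
  proof (rule fps_ext)
    fix N
    have "((1 - fps_X ^ n) * L) $ N = L $ N - (if N < n then 0 else L $ (N - n))"
      by (simp add: ring_distribs fps_X_power_mult_nth)
    moreover have "\<dots> = (if N = n then of_nat n else 0)"
      using assms by (auto simp: nth dvd_minus_self dest: dvd_imp_le)
    ultimately show "((1 - fps_X ^ n) * L) $ N = (of_nat n * fps_X ^ n) $ N"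
      by (simp add: fps_of_nat[symmetric])
  qed
  moreover have "fps_X * fps_deriv (1 - fps_X ^ n :: 'a fps) = - (of_nat n * fps_X ^ n)"
    using assms by (cases n) (simp_all add: fps_deriv_power' algebra_simps del: power_Suc flip: power_Suc)
  ultimately show ?thesis using assms by (simp add: euler_product_def L_def)
qed

lemma euler_product_one_plus:
  assumes "n > 0"
  shows "euler_product (1 + fps_X ^ n :: 'a :: field_char_0 fps)
           (\<lambda>d. (if d = 2 * n then 1 else 0) - (if d = n then 1 else 0))"
proof -
  have "(1 - fps_X ^ n) * (1 + fps_X ^ n :: 'a fps) = 1 - fps_X ^ (2 * n)"
    by (simp add: algebra_simps flip: power_add mult_2)
  then show ?thesis
    using euler_product_cancel[OF euler_product_one_minus[OF assms]]
      euler_product_one_minus[of "2 * n"] assms by (metis nat_0_less_mult_iff pos2)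
qed

section \<open>Formal sums and sections of series\<close>

text \<open>
  Theta series and products of two of them are sums over \<open>\<int>\<close> and \<open>\<int>\<^sup>2\<close>. They make sense as soon
  as every exponent occurs finitely often, and then the index set may be reordered freely.
\<close>

definition finite_fibres :: "'i set \<Rightarrow> ('i \<Rightarrow> nat) \<Rightarrow> bool" where
  "finite_fibres I e \<longleftrightarrow> (\<forall>n. finite {i \<in> I. e i = n})"

definition formal_sum :: "'i set \<Rightarrow> ('i \<Rightarrow> nat) \<Rightarrow> ('i \<Rightarrow> 'a) \<Rightarrow> 'a :: comm_ring_1 fps" where
  "formal_sum I e c = Abs_fps (\<lambda>n. \<Sum>i | i \<in> I \<and> e i = n. c i)"

lemma formal_sum_mult:
  assumes "finite_fibres I e" "finite_fibres J e'"
  shows "formal_sum I e c * formal_sum J e' c'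
       = formal_sum (I \<times> J) (\<lambda>(i, j). e i + e' j) (\<lambda>(i, j). c i * c' j)"
proof (rule fps_ext)
  fix n
  define A where "A k = {i \<in> I. e i = k}" for k
  define B where "B k = {j \<in> J. e' j = k}" for k
  have fin: "finite (A k)" "finite (B k)" for k
    using assms by (auto simp: A_def B_def finite_fibres_def)
  have "(formal_sum I e c * formal_sum J e' c') $ n
      = (\<Sum>k=0..n. (\<Sum>i\<in>A k. c i) * (\<Sum>j\<in>B (n - k). c' j))"
    by (simp add: fps_mult_nth formal_sum_def A_def B_def)
  also have "\<dots> = (\<Sum>k=0..n. \<Sum>p\<in>A k \<times> B (n - k). c (fst p) * c' (snd p))"
    by (intro sum.cong refl) (simp add: sum_product sum.cartesian_product case_prod_beta)
  also have "\<dots> = (\<Sum>p\<in>(\<Union>k\<in>{0..n}. A k \<times> B (n - k)). c (fst p) * c' (snd p))"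
  proof (rule sum.UNION_disjoint[symmetric])
    show "\<forall>k\<in>{0..n}. finite (A k \<times> B (n - k))" using fin by blast
    show "\<forall>k\<in>{0..n}. \<forall>l\<in>{0..n}. k \<noteq> l \<longrightarrow> A k \<times> B (n - k) \<inter> A l \<times> B (n - l) = {}"
      by (auto simp: A_def)
  qed simp
  also have "(\<Union>k\<in>{0..n}. A k \<times> B (n - k)) = {p \<in> I \<times> J. e (fst p) + e' (snd p) = n}"
    by (auto simp: A_def B_def)
  finally show "(formal_sum I e c * formal_sum J e' c') $ n
      = formal_sum (I \<times> J) (\<lambda>(i, j). e i + e' j) (\<lambda>(i, j). c i * c' j) $ n"
    by (simp add: formal_sum_def case_prod_beta)
qed

lemma formal_sum_reindex:
  assumes "bij_betw h J I" "\<And>j. j \<in> J \<Longrightarrow> e (h j) = e' j" "\<And>j. j \<in> J \<Longrightarrow> c (h j) = c' j"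
  shows "formal_sum I e c = formal_sum J e' c'"
proof (rule fps_ext)
  fix n
  have "bij_betw h {j \<in> J. e' j = n} {i \<in> I. e i = n}"
    using assms(1,2) by (auto simp: bij_betw_def inj_on_def)
  from sum.reindex_bij_betw[OF this, of c]
  have "(\<Sum>j | j \<in> J \<and> e' j = n. c (h j)) = (\<Sum>i | i \<in> I \<and> e i = n. c i)" .
  moreover have "(\<Sum>j | j \<in> J \<and> e' j = n. c (h j)) = (\<Sum>j | j \<in> J \<and> e' j = n. c' j)"
    using assms(3) by (intro sum.cong) auto
  ultimately show "formal_sum I e c $ n = formal_sum J e' c' $ n"
    by (simp add: formal_sum_def)
qed

lemma formal_sum_shift:
  "fps_X ^ k * formal_sum I e c = formal_sum I (\<lambda>i. e i + k) c"
proof (rule fps_ext)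
  fix n
  show "(fps_X ^ k * formal_sum I e c) $ n = formal_sum I (\<lambda>i. e i + k) c $ n"
    by (auto simp: fps_X_power_mult_nth formal_sum_def intro!: sum.cong sum.neutral)
qed

lemma formal_sum_const_mult:
  "fps_const b * formal_sum I e c = formal_sum I e (\<lambda>i. b * c i)"
  by (simp add: fps_eq_iff formal_sum_def sum_distrib_left)

lemma formal_sum_dilate:
  assumes "k > 0"
  shows "formal_sum I e c oo fps_X ^ k = formal_sum I (\<lambda>i. k * e i) c"
proof (rule fps_ext)
  fix n
  show "(formal_sum I e c oo fps_X ^ k) $ n = formal_sum I (\<lambda>i. k * e i) c $ n"
    using assms by (auto simp: fps_nth_compose_X_power formal_sum_def intro!: sum.cong sum.neutral)
qed

text \<open>
  The bijection \<open>h\<close> describes a partition of the index set into copies of one set \<open>J\<close>, as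
  in the decomposition of a lattice into cosets.
\<close>

lemma formal_sum_split:
  assumes "finite A" "finite_fibres I e" "bij_betw (\<lambda>(a, j). h a j) (A \<times> J) I"
  shows "formal_sum I e c = (\<Sum>a\<in>A. formal_sum J (\<lambda>j. e (h a j)) (\<lambda>j. c (h a j)))"
proof (rule fps_ext)
  fix n
  have bij: "bij_betw (\<lambda>(a, j). h a j) (SIGMA a:A. {j \<in> J. e (h a j) = n}) {i \<in> I. e i = n}"
    using assms(3) by (auto simp: bij_betw_def inj_on_def image_iff)
  then have "finite (SIGMA a:A. {j \<in> J. e (h a j) = n})"
    using assms(2) bij_betw_finite by (fastforce simp: finite_fibres_def)
  have fin: "finite {j \<in> J. e (h a j) = n}" if "a \<in> A" for a
    by (rule finite_imageD[of "\<lambda>j. (a, j)"], rule finite_subset[OF _ \<open>finite (SIGMA a:A. _ a)\<close>])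
      (use that in \<open>auto simp: inj_on_def\<close>)
  have "(\<Sum>i | i \<in> I \<and> e i = n. c i)
      = (\<Sum>p\<in>(SIGMA a:A. {j \<in> J. e (h a j) = n}). c (h (fst p) (snd p)))"
    using sum.reindex_bij_betw[OF bij, of c] by (simp add: case_prod_beta)
  also have "\<dots> = (\<Sum>a\<in>A. \<Sum>j | j \<in> J \<and> e (h a j) = n. c (h a j))"
    using assms(1) fin by (subst sum.Sigma) (auto simp: case_prod_beta)
  finally show "formal_sum I e c $ n
      = (\<Sum>a\<in>A. formal_sum J (\<lambda>j. e (h a j)) (\<lambda>j. c (h a j))) $ n"
    by (simp add: formal_sum_def fps_sum_nth)
qed

definition dissect :: "nat \<Rightarrow> nat \<Rightarrow> 'a fps \<Rightarrow> 'a fps" where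
  "dissect m r f = Abs_fps (\<lambda>n. f $ (m * n + r))"

lemma dissect_nth [simp]: "dissect m r f $ n = f $ (m * n + r)"
  by (simp add: dissect_def)

lemma dissect_linear:
  fixes f g :: "'a :: comm_ring_1 fps"
  shows "dissect m r (f + g) = dissect m r f + dissect m r g" "dissect m r (f - g) = dissect m r f - dissect m r g"
    "dissect m r (- f) = - dissect m r f" "dissect m r 0 = 0"
    "dissect m r (fps_const c * f) = fps_const c * dissect m r f"
  by (simp_all add: fps_eq_iff)

lemma dissect_sum: "dissect m r (\<Sum>i\<in>A. f i :: 'a :: comm_ring_1 fps) = (\<Sum>i\<in>A. dissect m r (f i))"
  by (simp add: fps_eq_iff fps_sum_nth)

text \<open>
  Multiplication by a series in \<open>q^m\<close> does not mix residue classes modulo \<open>m\<close>, so taking a section is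
  linear over such series.
\<close>

lemma dissect_dilate_mult:
  fixes f g :: "'a :: comm_ring_1 fps"
  assumes "r < m"
  shows "dissect m r ((f oo fps_X ^ m) * g) = f * dissect m r g"
proof (rule fps_ext)
  fix n
  have m: "m > 0" using assms by simp
  have "((f oo fps_X ^ m) * g) $ (m * n + r)
      = (\<Sum>i\<in>{0..m * n + r}. if m dvd i then f $ (i div m) * g $ (m * n + r - i) else 0)"
    using m by (simp add: fps_mult_nth fps_nth_compose_X_power if_distrib[of "\<lambda>x. x * _"] cong: if_cong)
  also have "\<dots> = (\<Sum>i\<in>{i\<in>{0..m * n + r}. m dvd i}. f $ (i div m) * g $ (m * n + r - i))"
    by (rule sum.inter_filter[symmetric]) simp
  also have "\<dots> = (\<Sum>j\<in>{0..n}. f $ j * g $ (m * (n - j) + r))"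
  proof (rule sum.reindex_bij_witness[of _ "\<lambda>j. m * j" "\<lambda>i. i div m"])
    fix i assume "i \<in> {i \<in> {0..m * n + r}. m dvd i}"
    then obtain j where j: "i = m * j" "m * j \<le> m * n + r" by auto
    have "m * j < m * Suc n" using j assms by simp
    then have jn: "j \<le> n" by (simp only: mult_less_cancel1 less_Suc_eq_le)
    then show "i div m \<in> {0..n}" "m * (i div m) = i" using j m by auto
    have "m * n + r - i = m * (n - j) + r" using jn j by (simp add: diff_mult_distrib2)
    then show "f $ (i div m) * g $ (m * (n - i div m) + r) = f $ (i div m) * g $ (m * n + r - i)"
      using j m by simp
  next
    fix j assume "j \<in> {0..n}"
    then show "m * j \<in> {i \<in> {0..m * n + r}. m dvd i}" "m * j div m = j"
      using m by (auto simp: trans_le_add1)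
  qed
  finally show "dissect m r ((f oo fps_X ^ m) * g) $ n = (f * dissect m r g) $ n"
    by (simp add: fps_mult_nth)
qed

lemma dissect_shift_dilate_mult:
  fixes f g :: "'a :: comm_ring_1 fps"
  assumes "r < m" "s < m"
  shows "dissect m r (fps_X ^ s * (f oo fps_X ^ m)) = (if r = s then f else 0)"
proof -
  have "dissect m r (fps_X ^ s * (f oo fps_X ^ m)) = f * dissect m r (fps_X ^ s)"
    using dissect_dilate_mult[OF assms(1), of f "fps_X ^ s"] by (simp add: mult.commute)
  moreover have "dissect m r (fps_X ^ s) = (if r = s then 1 else (0 :: 'a fps))"
  proof (rule fps_ext)
    fix n
    have "m * n + r = s \<longleftrightarrow> n = 0 \<and> r = s"
      using assms by (cases n) auto
    then show "dissect m r (fps_X ^ s) $ n = (if r = s then 1 else (0 :: 'a fps)) $ n" by auto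
  qed
  ultimately show ?thesis by simp
qed

section \<open>The Jacobi triple product\<close>

text \<open>
  The Gaussian binomial coefficients are introduced by their Pascal recursion because the quotient formula
  \<open>gbinom_qpoch\<close> needs divisions that a general ring does not have.
\<close>

fun gbinom :: "'a :: comm_ring_1 \<Rightarrow> nat \<Rightarrow> nat \<Rightarrow> 'a" where
  "gbinom Q n 0 = 1"
| "gbinom Q 0 (Suc k) = 0"
| "gbinom Q (Suc n) (Suc k) = gbinom Q n k + Q ^ Suc k * gbinom Q n (Suc k)"

definition qpoch :: "'a :: comm_ring_1 \<Rightarrow> nat \<Rightarrow> 'a" where
  "qpoch Q n = (\<Prod>i=1..n. 1 - Q ^ i)"

lemma qpoch_0 [simp]: "qpoch Q 0 = 1"
  and qpoch_Suc: "qpoch Q (Suc n) = qpoch Q n * (1 - Q ^ Suc n)"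
  by (simp_all add: qpoch_def)

lemma gbinom_eq_0: "n < k \<Longrightarrow> gbinom Q n k = 0"
  by (induction Q n k rule: gbinom.induct) auto

lemma gbinom_qpoch: "k \<le> n \<Longrightarrow> qpoch Q k * qpoch Q (n - k) * gbinom Q n k = qpoch Q n"
proof (induction Q n k rule: gbinom.induct)
  case (3 Q n k)
  have k: "k \<le> n" using 3 by simp
  have A: "qpoch Q (Suc k) * qpoch Q (n - k) * gbinom Q n k = (1 - Q ^ Suc k) * qpoch Q n"
  proof -
    have "qpoch Q (Suc k) * qpoch Q (n - k) * gbinom Q n k
        = (1 - Q ^ Suc k) * (qpoch Q k * qpoch Q (n - k) * gbinom Q n k)"
      by (simp only: qpoch_Suc mult_ac)
    then show ?thesis using 3(1)[OF k] by simp
  qed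
  have B: "qpoch Q (Suc k) * qpoch Q (n - k) * gbinom Q n (Suc k) = (1 - Q ^ (n - k)) * qpoch Q n"
  proof (cases "k = n")
    case False
    then obtain r where r: "n - k = Suc r" "n - Suc k = r" and "Suc k \<le> n"
      using k by (metis Suc_diff_Suc Suc_leI le_neq_implies_less)
    have "qpoch Q (Suc k) * qpoch Q (n - k) * gbinom Q n (Suc k)
        = (1 - Q ^ (n - k)) * (qpoch Q (Suc k) * qpoch Q (n - Suc k) * gbinom Q n (Suc k))"
      unfolding r by (simp only: qpoch_Suc mult_ac)
    then show ?thesis using 3(2)[OF \<open>Suc k \<le> n\<close>] by simp
  qed (simp add: gbinom_eq_0)
  have "qpoch Q (Suc k) * qpoch Q (n - k) * gbinom Q (Suc n) (Suc k)
      = qpoch Q (Suc k) * qpoch Q (n - k) * gbinom Q n k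
        + Q ^ Suc k * (qpoch Q (Suc k) * qpoch Q (n - k) * gbinom Q n (Suc k))"
    by (simp add: algebra_simps)
  also have "\<dots> = qpoch Q n * (1 - Q ^ Suc k + Q ^ Suc k * (1 - Q ^ (n - k)))"
    unfolding A B by (simp add: algebra_simps)
  also have "1 - Q ^ Suc k + Q ^ Suc k * (1 - Q ^ (n - k)) = 1 - Q ^ Suc n"
    using k by (simp add: algebra_simps flip: power_add power_Suc)
  finally show ?case by (simp add: qpoch_Suc)
qed auto

text \<open>
  The homogeneous form, with \<open>y\<close> as a second variable, is what turns into the triple product without negative
  powers of \<open>q\<close>: there \<open>y\<close> will be a power of \<open>q\<close>.
\<close>

lemma q_binomial_theorem:
  fixes x y Q :: "'a :: comm_ring_1"
  shows "(\<Prod>k<N. y + x * Q ^ k) = (\<Sum>k\<le>N. Q ^ (k choose 2) * gbinom Q N k * x ^ k * y ^ (N - k))"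
proof (induction N arbitrary: x)
  case (Suc N)
  let ?t = "\<lambda>k. Q ^ (k choose 2) * Q ^ k * gbinom Q N k * x ^ k * y ^ (N - k)"
  have "(\<Prod>k<Suc N. y + x * Q ^ k) = (y + x) * (\<Prod>k<N. y + (x * Q) * Q ^ k)"
    by (subst prod.lessThan_Suc_shift) (simp add: mult.assoc)
  also have "(\<Prod>k<N. y + (x * Q) * Q ^ k) = (\<Sum>k\<le>N. ?t k)"
    unfolding Suc.IH by (simp add: power_mult_distrib mult_ac)
  also have "(y + x) * (\<Sum>k\<le>N. ?t k) = y * (\<Sum>k\<le>N. ?t k) + x * (\<Sum>k\<le>N. ?t k)"
    by (simp add: algebra_simps)
  also have "y * (\<Sum>k\<le>N. ?t k) = (\<Sum>k\<le>Suc N. Q ^ (k choose 2) * Q ^ k * gbinom Q N k * x ^ k * y ^ (Suc N - k))"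
    by (simp add: sum_distrib_left gbinom_eq_0 Suc_diff_le mult_ac)
  also have "\<dots> = y ^ Suc N + (\<Sum>k\<le>N. Q ^ (Suc k choose 2) * Q ^ Suc k * gbinom Q N (Suc k) * x ^ Suc k * y ^ (N - k))"
    by (subst sum.atMost_Suc_shift) (simp add: binomial_eq_0)
  also have "x * (\<Sum>k\<le>N. ?t k) = (\<Sum>k\<le>N. Q ^ (Suc k choose 2) * gbinom Q N k * x ^ Suc k * y ^ (N - k))"
    by (simp add: sum_distrib_left numeral_2_eq_2 power_add mult_ac)
  also have "y ^ Suc N + (\<Sum>k\<le>N. Q ^ (Suc k choose 2) * Q ^ Suc k * gbinom Q N (Suc k) * x ^ Suc k * y ^ (N - k))
      + (\<Sum>k\<le>N. Q ^ (Suc k choose 2) * gbinom Q N k * x ^ Suc k * y ^ (N - k))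
      = y ^ Suc N + (\<Sum>k\<le>N. Q ^ (Suc k choose 2) * gbinom Q (Suc N) (Suc k) * x ^ Suc k * y ^ (N - k))"
    by (simp add: algebra_simps sum.distrib)
  also have "\<dots> = (\<Sum>k\<le>Suc N. Q ^ (k choose 2) * gbinom Q (Suc N) k * x ^ k * y ^ (Suc N - k))"
    by (subst sum.atMost_Suc_shift) (simp add: binomial_eq_0)
  finally show ?case .
qed (simp add: binomial_eq_0)

definition tri :: "int \<Rightarrow> nat" where
  "tri n = nat (n * (n + 1) div 2)"

lemma int_tri: "2 * int (tri n) = n * (n + 1)"
proof -
  have "n * (n + 1) \<ge> 0"
    by (cases "n \<ge> 0") (auto intro: mult_nonneg_nonneg mult_nonpos_nonpos)
  then show ?thesis by (simp add: tri_def)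
qed

definition theta_exp :: "nat \<Rightarrow> nat \<Rightarrow> int \<Rightarrow> nat" where
  "theta_exp a b n = a * tri n + b * tri (- n)"

lemma int_theta_exp: "2 * int (theta_exp a b n) = int a * (n * (n + 1)) + int b * (n * (n - 1))"
proof -
  have "2 * int (theta_exp a b n) = int a * (2 * int (tri n)) + int b * (2 * int (tri (- n)))"
    by (simp add: theta_exp_def)
  then show ?thesis unfolding int_tri by (simp add: algebra_simps)
qed

text \<open>
  This is Ramanujan's theta function \<open>f(c q^a, q^b/c)\<close>. In particular \<open>theta (-1) 1 1\<close> is
  \<open>\<phi>(-q)\<close>, \<open>theta 1 1 1\<close> is \<open>\<phi>(q)\<close>, \<open>theta 1 1 3\<close> is \<open>\<psi>(q)\<close>, and
  \<open>theta 1 1 0\<close> is \<open>2 \<psi>(q)\<close>.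
\<close>

definition theta :: "'a \<Rightarrow> nat \<Rightarrow> nat \<Rightarrow> 'a :: field_char_0 fps" where
  "theta c a b = formal_sum UNIV (theta_exp a b) (\<lambda>n. c powi n)"

lemma double_le_pronic: "2 * k \<le> k * (k - 1) + (2 :: nat)"
proof (cases "k < 3")
  case True
  then have "k = 0 \<or> k = 1 \<or> k = 2" by auto
  then show ?thesis by auto
next
  case False
  define j where "j = k - 3"
  have "k = j + 3" using False by (simp add: j_def)
  then show ?thesis by simp
qed

lemma theta_exp_ge:
  assumes "a + b > 0"
  shows "(a + b) * (nat \<bar>n\<bar> * (nat \<bar>n\<bar> - 1)) \<le> 2 * theta_exp a b n" "nat \<bar>n\<bar> \<le> theta_exp a b n + 1"
proof -
  define k where "k = nat \<bar>n\<bar>"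
  have kn: "int k = \<bar>n\<bar>" by (simp add: k_def)
  have kk: "int (k * (k - 1)) = \<bar>n\<bar> * (\<bar>n\<bar> - 1)"
    unfolding kn[symmetric] by (cases k) (simp_all add: algebra_simps)
  have *: "\<bar>n\<bar> * (\<bar>n\<bar> - 1) \<le> n * (n + 1)" "\<bar>n\<bar> * (\<bar>n\<bar> - 1) \<le> n * (n - 1)"
    by (auto simp: abs_if algebra_simps)
  have "int ((a + b) * (k * (k - 1))) = int a * (\<bar>n\<bar> * (\<bar>n\<bar> - 1)) + int b * (\<bar>n\<bar> * (\<bar>n\<bar> - 1))"
    unfolding of_nat_mult of_nat_add kk[unfolded of_nat_mult] by (simp add: algebra_simps)
  also have "\<dots> \<le> 2 * int (theta_exp a b n)"
    unfolding int_theta_exp by (intro add_mono mult_left_mono *) auto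
  finally have 1: "(a + b) * (k * (k - 1)) \<le> 2 * theta_exp a b n"
    by (metis of_nat_le_iff of_nat_mult of_nat_numeral)
  then show "(a + b) * (nat \<bar>n\<bar> * (nat \<bar>n\<bar> - 1)) \<le> 2 * theta_exp a b n"
    by (simp add: k_def)
  have "2 * k \<le> k * (k - 1) + 2" by (rule double_le_pronic)
  also have "k * (k - 1) \<le> (a + b) * (k * (k - 1))"
  proof -
    have "1 \<le> a + b" using assms by linarith
    from mult_le_mono1[OF this, of "k * (k - 1)"] show ?thesis by (simp only: mult_1)
  qed
  finally show "nat \<bar>n\<bar> \<le> theta_exp a b n + 1" using 1 by (simp add: k_def)
qed

lemma finite_fibres_theta_exp [simp]: "a + b > 0 \<Longrightarrow> finite_fibres UNIV (theta_exp a b)"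
  unfolding finite_fibres_def
proof
  fix n assume "a + b > 0"
  have "{i \<in> UNIV. theta_exp a b i = n} \<subseteq> {- int (n + 1)..int (n + 1)}"
  proof
    fix i assume "i \<in> {i \<in> UNIV. theta_exp a b i = n}"
    then have "nat \<bar>i\<bar> \<le> n + 1" using theta_exp_ge(2)[OF \<open>a + b > 0\<close>, of i] by simp
    then show "i \<in> {- int (n + 1)..int (n + 1)}" by auto
  qed
  then show "finite {i \<in> UNIV. theta_exp a b i = n}" by (rule finite_subset) simp
qed

text \<open>
  The \<open>q\<close>-binomial theorem is applied with base \<open>q^m\<close>, \<open>2n\<close> factors and \<open>y = q^s\<close>,
  \<open>s = mn - a\<close>. The upper \<open>n\<close> factors are multiples of the first factors of the triple product, the lower ones
  of the second factors in reversed order, and the monomial \<open>M\<close> collects what has been taken out.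
\<close>

lemma finite_jacobi_triple:
  fixes c :: "'a :: field_char_0"
  assumes "c \<noteq> 0" "m = a + b" "m > 0"
  shows "(\<Prod>i=1..n. (1 + fps_const c * fps_X ^ (m * i - b)) * (1 + fps_const (inverse c) * fps_X ^ (m * i - a)))
     = (\<Sum>j\<in>{- int n..int n}. fps_const (c powi j) * fps_X ^ theta_exp a b j
          * gbinom (fps_X ^ m) (2 * n) (nat (int n + j)))"
proof (cases "n = 0")
  case True
  then show ?thesis by (simp add: theta_exp_def tri_def)
next
  case False
  define X where "X = (fps_X :: 'a fps)"
  define s where "s = m * n - a"
  have "m * n \<ge> m * 1" using False by (intro mult_left_mono) auto
  then have sa: "s + a = m * n" using assms(2) unfolding s_def by linarith
  define M where "M = (\<Prod>i=1..n. fps_const c * X ^ (m * (n - i))) * (\<Prod>i=1..n. X ^ s)"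
  define P where "P = (\<Prod>i=1..n. (1 + fps_const c * X ^ (m * i - b)) * (1 + fps_const (inverse c) * X ^ (m * i - a)))"
  have M: "M = fps_const (c ^ n) * X ^ (m * (n choose 2) + n * s)"
  proof -
    have "(\<Sum>i=1..n. n - i) = n choose 2"
    proof -
      have "(\<Sum>i=1..n. n - i) = (\<Sum>i<n. i)"
        by (rule sum.reindex_bij_witness[of _ "\<lambda>i. n - i" "\<lambda>i. n - i"]) auto
      also have "\<dots> = n choose 2"
        using gauss_sum_nat[of "n - 1"] False
        by (simp add: choose_two lessThan_Suc_atMost[symmetric] atLeast0AtMost mult.commute)
      finally show ?thesis .
    qed
    then have "(\<Prod>i=1..n. X ^ (m * (n - i))) = X ^ (m * (n choose 2))"
      by (simp add: power_sum[symmetric] sum_distrib_left[symmetric])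
    then show ?thesis
      by (simp add: M_def prod.distrib power_add power_mult[symmetric] mult_ac fps_const_power)
  qed
  have split: "(\<Prod>k<2 * n. X ^ s + fps_const c * (X ^ m) ^ k)
      = (\<Prod>k<n. X ^ s + fps_const c * (X ^ m) ^ k) * (\<Prod>k\<in>{n..<2 * n}. X ^ s + fps_const c * (X ^ m) ^ k)"
    by (subst prod.union_disjoint[symmetric]) (auto intro!: prod.cong)
  have low: "(\<Prod>k<n. X ^ s + fps_const c * (X ^ m) ^ k)
      = (\<Prod>i=1..n. (fps_const c * X ^ (m * (n - i))) * (1 + fps_const (inverse c) * X ^ (m * i - a)))"
  proof (rule prod.reindex_bij_witness[of _ "\<lambda>i. n - i" "\<lambda>k. n - k"])
    fix k assume k: "k \<in> {..<n}"
    have "m * (n - k) \<ge> m * 1" using k by (intro mult_left_mono) auto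
    moreover have "m * k + m * (n - k) = m * n"
      using k by (simp add: add_mult_distrib2[symmetric])
    ultimately have "m * k + (m * (n - k) - a) = s"
      using assms(2) unfolding s_def by linarith
    then have "fps_const c * X ^ (m * k) * (1 + fps_const (inverse c) * X ^ (m * (n - k) - a))
        = fps_const c * X ^ (m * k) + fps_const (c * inverse c) * X ^ s"
      by (simp add: algebra_simps power_add[symmetric] fps_const_mult[symmetric] del: fps_const_mult)
    then show "fps_const c * X ^ (m * (n - (n - k))) * (1 + fps_const (inverse c) * X ^ (m * (n - k) - a))
        = X ^ s + fps_const c * (X ^ m) ^ k"
      using k assms(1) by (simp add: power_mult)
  qed auto
  have high: "(\<Prod>k\<in>{n..<2 * n}. X ^ s + fps_const c * (X ^ m) ^ k)
      = (\<Prod>i=1..n. X ^ s * (1 + fps_const c * X ^ (m * i - b)))"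
  proof (rule prod.reindex_bij_witness[of _ "\<lambda>i. n + i - 1" "\<lambda>k. k + 1 - n"])
    fix k assume k: "k \<in> {n..<2 * n}"
    define i where "i = k - n"
    have k': "k = n + i" "k + 1 - n = Suc i" using k by (auto simp: i_def)
    have "s + (m * Suc i - b) = m * k"
      using sa assms(2) by (simp add: k' algebra_simps)
    then show "X ^ s * (1 + fps_const c * X ^ (m * (k + 1 - n) - b)) = X ^ s + fps_const c * (X ^ m) ^ k"
      unfolding k'(2) by (simp add: algebra_simps power_add[symmetric] power_mult[symmetric])
  qed auto
  have "M * P = (\<Prod>k<2 * n. X ^ s + fps_const c * (X ^ m) ^ k)"
    unfolding split low high M_def P_def by (simp add: prod.distrib mult_ac)
  also have "\<dots> = (\<Sum>k\<le>2 * n. (X ^ m) ^ (k choose 2) * gbinom (X ^ m) (2 * n) k * fps_const c ^ k * (X ^ s) ^ (2 * n - k))"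
    by (rule q_binomial_theorem)
  also have "\<dots> = (\<Sum>j\<in>{- int n..int n}. M * (fps_const (c powi j) * X ^ theta_exp a b j
          * gbinom (X ^ m) (2 * n) (nat (int n + j))))"
  proof (rule sum.reindex_bij_witness[of _ "\<lambda>j. nat (int n + j)" "\<lambda>k. int k - int n"])
    fix k assume k: "k \<in> {..2 * n}"
    define j where "j = int k - int n"
    have kj: "int k = int n + j" by (simp add: j_def)
    have c2: "2 * int (k choose 2) = int k * (int k - 1)" for k
      by (cases k) (auto simp: choose_two algebra_simps zdiv_int)
    have "2 * int (m * (k choose 2) + s * (2 * n - k)) = 2 * int (m * (n choose 2) + n * s + theta_exp a b j)"
    proof -
      have s': "int s = int m * int n - int a" using sa by (metis add_diff_cancel_right' of_nat_add of_nat_mult)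
      have "2 * int (m * (k choose 2) + s * (2 * n - k)) = int m * (2 * int (k choose 2)) + 2 * int s * (2 * int n - int k)"
      proof -
        have *: "int (2 * n - k) = 2 * int n - int k" using k by simp
        show ?thesis by (simp only: of_nat_add of_nat_mult *) (simp add: algebra_simps)
      qed
      also have "\<dots> = int m * (int k * (int k - 1)) + 2 * int s * (2 * int n - int k)"
        by (simp only: c2)
      also have "\<dots> = int m * (int n * (int n - 1)) + 2 * int n * int s + (int a * (j * (j + 1)) + int b * (j * (j - 1)))"
        unfolding kj s' assms(2) of_nat_add by (simp add: algebra_simps)
      also have "\<dots> = 2 * int (m * (n choose 2) + n * s + theta_exp a b j)"
      proof -
        have "2 * int (m * (n choose 2) + n * s + theta_exp a b j)
            = int m * (2 * int (n choose 2)) + 2 * int n * int s + 2 * int (theta_exp a b j)"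
          by (simp add: algebra_simps)
        then show ?thesis by (simp only: c2 int_theta_exp)
      qed
      finally show ?thesis .
    qed
    then have ex: "m * (k choose 2) + s * (2 * n - k) = m * (n choose 2) + n * s + theta_exp a b j"
      by (simp only: mult_cancel_left of_nat_eq_iff) simp
    have ck: "c ^ k = c ^ n * c powi j"
      using assms(1) by (simp add: kj[symmetric] power_int_of_nat[symmetric] power_int_add[symmetric] del: power_int_of_nat)
    have "M * (fps_const (c powi j) * X ^ theta_exp a b j * gbinom (X ^ m) (2 * n) k)
        = fps_const (c ^ n * c powi j) * X ^ (m * (n choose 2) + n * s + theta_exp a b j) * gbinom (X ^ m) (2 * n) k"
      unfolding M by (simp add: power_add mult_ac fps_const_mult[symmetric] del: fps_const_mult)
    also have "\<dots> = (X ^ m) ^ (k choose 2) * gbinom (X ^ m) (2 * n) k * fps_const c ^ k * (X ^ s) ^ (2 * n - k)"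
      unfolding ck[symmetric] ex[symmetric]
      by (simp add: power_add mult_ac fps_const_power power_mult)
    finally show "M * (fps_const (c powi (int k - int n)) * X ^ theta_exp a b (int k - int n)
          * gbinom (X ^ m) (2 * n) (nat (int n + (int k - int n))))
        = (X ^ m) ^ (k choose 2) * gbinom (X ^ m) (2 * n) k * fps_const c ^ k * (X ^ s) ^ (2 * n - k)"
      by (simp add: j_def)
  qed auto
  finally have "M * P = M * (\<Sum>j\<in>{- int n..int n}. fps_const (c powi j) * X ^ theta_exp a b j
          * gbinom (X ^ m) (2 * n) (nat (int n + j)))"
    by (simp add: sum_distrib_left)
  moreover have "M \<noteq> 0" unfolding M using assms(1) by (simp add: X_def)
  ultimately show ?thesis by (simp add: P_def X_def)
qed

lemma qpoch_agree:
  assumes "n \<le> n'"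
  shows "agree (m * Suc n) (qpoch (fps_X ^ m) n) (qpoch (fps_X ^ m) n' :: 'a :: comm_ring_1 fps)"
  using assms
proof (induction n' rule: dec_induct)
  case (step k)
  have "m * Suc n \<le> m * Suc k" using step by (intro mult_left_mono) auto
  then have "agree (m * Suc n) (1 :: 'a fps) (1 - (fps_X ^ m) ^ Suc k)"
    by (auto simp: agree_def power_mult[symmetric] simp del: power_Suc)
  from agree_mult[OF step(3) this] show ?case by (simp add: qpoch_Suc)
qed simp

lemma qpoch_nth_0: "m > 0 \<Longrightarrow> qpoch (fps_X ^ m) n $ 0 = (1 :: 'a :: comm_ring_1)"
proof (induction n)
  case (Suc n)
  then show ?case by (simp add: qpoch_Suc power_mult[symmetric] del: power_Suc)
qed simp

lemma agree_cancel:
  fixes f g h :: "'a :: field fps"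
  assumes "h $ 0 \<noteq> 0" "agree N (h * f) (h * g)"
  shows "agree N f g"
proof -
  have *: "inverse h * (h * u) = u" for u
    unfolding mult.assoc[symmetric] inverse_mult_eq_1[OF assms(1)] by simp
  show ?thesis using agree_mult[OF agree_refl assms(2), of "inverse h"] by (simp only: *)
qed

text \<open>
  As \<open>n\<close> grows, \<open>(q)_n\<close> times the binomial coefficient \<open>(q)_(2n)/((q)_(n-j) (q)_(n+j))\<close> tends to
  \<open>1\<close>. All four products agree with the shortest one, \<open>(q)_(n-|j|)\<close>, below the degree of the first
  factor that it lacks.
\<close>

lemma qpoch_gbinom_agree:
  assumes "\<bar>j\<bar> \<le> int n" "m > 0"
  shows "agree (m * Suc (n - nat \<bar>j\<bar>))
     (qpoch (fps_X ^ m) n * gbinom (fps_X ^ m) (2 * n) (nat (int n + j))) (1 :: 'a :: field fps)"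
proof -
  define k where "k = nat (int n + j)"
  define r where "r = n - nat \<bar>j\<bar>"
  let ?p = "qpoch (fps_X ^ m :: 'a fps)" and ?A = "agree (m * Suc r) :: 'a fps \<Rightarrow> 'a fps \<Rightarrow> bool"
  have k: "k \<le> 2 * n" "r \<le> k" "r \<le> 2 * n - k" "r \<le> n" "r \<le> 2 * n"
    using assms by (auto simp: k_def r_def)
  have to: "?A (?p r) (?p i)" "?A (?p i) (?p r)" if "r \<le> i" for i
    by (rule qpoch_agree[OF that], rule agree_sym[OF qpoch_agree[OF that]])
  have "?A (?p (2 * n) * (?p n * gbinom (fps_X ^ m) (2 * n) k))
           (?p k * ?p (2 * n - k) * gbinom (fps_X ^ m) (2 * n) k)"
    unfolding mult.assoc[symmetric]
    by (intro agree_mult agree_refl agree_trans[OF to(2) to(1)] k)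
  also have "?p k * ?p (2 * n - k) * gbinom (fps_X ^ m) (2 * n) k = ?p (2 * n) * 1"
    using gbinom_qpoch[OF k(1), of "fps_X ^ m :: 'a fps"] by simp
  finally have "?A (?p (2 * n) * (?p n * gbinom (fps_X ^ m) (2 * n) k)) (?p (2 * n) * 1)" .
  moreover have "?p (2 * n) $ 0 \<noteq> 0" by (simp add: qpoch_nth_0[OF assms(2)])
  ultimately show ?thesis
    unfolding k_def[symmetric] r_def[symmetric] by (rule agree_cancel[rotated])
qed

lemma theta_agree:
  assumes "a + b > 0" "N \<le> n"
  shows "agree N (theta c a b) (\<Sum>j\<in>{- int n..int n}. fps_const (c powi j) * fps_X ^ theta_exp a b j)"
  unfolding agree_def
proof (intro allI impI)
  fix i assume i: "i < N"
  have sub: "{j \<in> UNIV. theta_exp a b j = i} \<subseteq> {- int n..int n}"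
  proof
    fix j assume "j \<in> {j \<in> UNIV. theta_exp a b j = i}"
    then have "nat \<bar>j\<bar> \<le> n" using theta_exp_ge(2)[OF assms(1), of j] i assms(2) by simp
    then show "j \<in> {- int n..int n}" by auto
  qed
  have "(\<Sum>j\<in>{- int n..int n}. fps_const (c powi j) * fps_X ^ theta_exp a b j) $ i
      = (\<Sum>j\<in>{- int n..int n}. if theta_exp a b j = i then c powi j else 0)"
    by (simp add: fps_sum_nth if_distrib[of "\<lambda>x. _ * x"] eq_commute cong: if_cong)
  also have "\<dots> = (\<Sum>j | j \<in> UNIV \<and> theta_exp a b j = i. c powi j)"
    using sub by (intro sum.mono_neutral_cong_right) auto
  finally show "theta c a b $ i = (\<Sum>j\<in>{- int n..int n}. fps_const (c powi j) * fps_X ^ theta_exp a b j) $ i"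
    by (simp add: theta_def formal_sum_def)
qed

text \<open>
  In the \<open>j\<close>-th summand the error of \<open>qpoch_gbinom_agree\<close> starts at degree \<open>m(n - |j| + 1)\<close> and is
  multiplied by \<open>q\<close> to the theta exponent. The latter grows quadratically in \<open>j\<close> and makes up for the loss
  \<open>m |j|\<close>.
\<close>

lemma jacobi_triple_agree:
  fixes c :: "'a :: field_char_0"
  assumes c: "c \<noteq> 0" and m: "m = a + b" "m > 0" and N: "N \<le> n"
  shows "agree N (qpoch (fps_X ^ m) n *
     (\<Prod>i=1..n. (1 + fps_const c * fps_X ^ (m * i - b)) * (1 + fps_const (inverse c) * fps_X ^ (m * i - a))))
     (theta c a b)"
proof -
  let ?q = "qpoch (fps_X ^ m) n :: 'a fps"
  let ?g = "\<lambda>j. gbinom (fps_X ^ m) (2 * n) (nat (int n + j)) :: 'a fps"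
  have "agree N (fps_X ^ theta_exp a b j * (?q * ?g j)) (fps_X ^ theta_exp a b j * 1)"
    if j: "j \<in> {- int n..int n}" for j
  proof (rule agree_X_power_mult)
    define k where "k = nat \<bar>j\<bar>"
    have k: "k \<le> n" using j by (auto simp: k_def)
    have "2 * k \<le> k * (k - 1) + 2" by (rule double_le_pronic)
    then have "m * (2 * k) \<le> m * (k * (k - 1) + 2)" by (intro mult_left_mono) auto
    also have "\<dots> \<le> 2 * theta_exp a b j + 2 * m"
      using theta_exp_ge(1)[of a b j] m by (simp add: k_def algebra_simps)
    finally have "m * k \<le> theta_exp a b j + m" by simp
    moreover have "m * n \<ge> n" using mult_le_mono1[of 1 m n] m by linarith
    moreover have "m * Suc (n - k) + m * k = m * n + m"
      using k by (simp add: add_mult_distrib2[symmetric])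
    ultimately show "N \<le> theta_exp a b j + m * Suc (n - nat \<bar>j\<bar>)"
      using N unfolding k_def[symmetric] by linarith
    show "agree (m * Suc (n - nat \<bar>j\<bar>)) (?q * ?g j) 1"
      using j m by (intro qpoch_gbinom_agree) auto
  qed
  then have "agree N (\<Sum>j\<in>{- int n..int n}. fps_const (c powi j) * (fps_X ^ theta_exp a b j * (?q * ?g j)))
      (\<Sum>j\<in>{- int n..int n}. fps_const (c powi j) * (fps_X ^ theta_exp a b j * 1))"
    by (intro agree_sum) (rule agree_mult[OF agree_refl])
  moreover have "agree N (\<Sum>j\<in>{- int n..int n}. fps_const (c powi j) * (fps_X ^ theta_exp a b j * 1)) (theta c a b)"
    using theta_agree[of a b N n c] m N by (simp add: agree_sym)
  ultimately show ?thesis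
    unfolding finite_jacobi_triple[OF c m]
    by (auto simp: sum_distrib_left mult_ac dest: agree_trans)
qed

lemma count_progression:
  fixes M r d n :: nat
  assumes "M > 0" "r < M" "0 < d" "d < n"
  shows "(\<Sum>i=1..n. if d = M * i - r then 1 else 0) = (of_bool (M dvd d + r) :: 'a :: semiring_1)"
proof -
  have *: "d = M * i - r \<longleftrightarrow> d + r = M * i" if "i \<in> {1..n}" for i
  proof -
    have "M * i \<ge> M * 1" using that by (intro mult_left_mono) auto
    then show ?thesis using assms by auto
  qed
  have "(\<Sum>i=1..n. if d = M * i - r then 1 else 0) = (\<Sum>i=1..n. if d + r = M * i then 1 else (0 :: 'a))"
    using * by (intro sum.cong) auto
  also have "\<dots> = of_bool (M dvd d + r)"
  proof (cases "M dvd d + r")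
    case True
    then obtain k where k: "d + r = M * k" by auto
    have "k \<ge> 1" using k assms by (cases k) auto
    moreover have "k \<le> n"
    proof -
      have "M * k < M * n + M"
        using k assms mult_le_mono1[of 1 M n] by linarith
      then have "M * k < M * Suc n" by simp
      then show ?thesis by (simp only: mult_less_cancel1 less_Suc_eq_le)
    qed
    moreover have "(d + r = M * i) = (i = k)" for i using k assms by auto
    ultimately show ?thesis using True by (simp add: sum.delta)
  qed (auto intro!: sum.neutral)
  finally show ?thesis .
qed

lemma progression_pos:
  fixes a b i :: nat
  assumes "a > 0" "i \<ge> 1"
  shows "b < (a + b) * i"
proof -
  have "b < (a + b) * 1" using assms by simp
  also have "\<dots> \<le> (a + b) * i" using assms by (intro mult_left_mono) auto
  finally show ?thesis .
qed

lemma euler_product_qpoch: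
  assumes "m > 0"
  shows "euler_product (qpoch (fps_X ^ m) n :: 'a :: field_char_0 fps) (\<lambda>d. \<Sum>i=1..n. if d = m * i - 0 then 1 else 0)"
  unfolding qpoch_def power_mult[symmetric] minus_nat.diff_0
  using assms by (intro euler_product_prod euler_product_one_minus) auto

lemma jacobi_triple_minus:
  assumes "a > 0" "b > 0"
  shows "euler_product (theta (-1) a b :: 'a :: field_char_0 fps)
    (\<lambda>d. of_bool (a + b dvd d) + of_bool (a + b dvd d + a) + of_bool (a + b dvd d + b))"
proof (rule euler_product_limit)
  fix N :: nat
  define n where "n = N + 1"
  define m where "m = a + b"
  have pos: "m * i - b > 0" "m * i - a > 0" if "i \<in> {1..n}" for i
    using that progression_pos[OF assms(1), of i b] progression_pos[OF assms(2), of i a]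
    by (simp_all add: m_def add.commute[of b a])
  let ?g = "qpoch (fps_X ^ m) n * (\<Prod>i=1..n. (1 - fps_X ^ (m * i - b)) * (1 - fps_X ^ (m * i - a))) :: 'a fps"
  let ?e = "\<lambda>d. (\<Sum>i=1..n. if d = m * i - 0 then 1 else 0) +
      (\<Sum>i=1..n. (if d = m * i - b then 1 else 0) + (if d = m * i - a then 1 else (0 :: 'a)))"
  have "euler_product ?g ?e"
    using assms pos by (intro euler_product_mult euler_product_qpoch euler_product_prod euler_product_one_minus)
      (auto simp: m_def)
  moreover have "agree N ?g (theta (-1) a b)"
    using jacobi_triple_agree[of "-1 :: 'a" m a b N n] assms
    by (simp add: m_def n_def fps_const_neg[symmetric] del: fps_const_neg)
  moreover have "?e d = of_bool (a + b dvd d) + of_bool (a + b dvd d + a) + of_bool (a + b dvd d + b)"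
    if "0 < d" "d < N" for d
    using that assms count_progression[of m 0 d n, where 'a = 'a] count_progression[of m a d n, where 'a = 'a]
      count_progression[of m b d n, where 'a = 'a]
    by (simp add: sum.distrib n_def m_def del: One_nat_def)
  ultimately show "\<exists>g e'. euler_product g e' \<and> agree N g (theta (-1) a b :: 'a fps) \<and>
      (\<forall>d. 0 < d \<and> d < N \<longrightarrow> e' d = of_bool (a + b dvd d) + of_bool (a + b dvd d + a) + of_bool (a + b dvd d + b))"
    by blast
qed

text \<open>
  The factors \<open>1 + q^k = (1 - q^(2k))/(1 - q^k)\<close> are responsible for the moduli \<open>2(a + b)\<close>.
\<close>

lemma jacobi_triple_plus:
  assumes "a > 0" "b > 0"
  shows "euler_product (theta 1 a b :: 'a :: field_char_0 fps)
    (\<lambda>d. of_bool (a + b dvd d)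
       + (of_bool (2 * (a + b) dvd d + 2 * a) - of_bool (a + b dvd d + a))
       + (of_bool (2 * (a + b) dvd d + 2 * b) - of_bool (a + b dvd d + b)))"
    (is "euler_product _ ?E")
proof (rule euler_product_limit)
  fix N :: nat
  define n where "n = N + 1"
  define m where "m = a + b"
  have pos: "m * i - b > 0" "m * i - a > 0" if "i \<in> {1..n}" for i
    using that progression_pos[OF assms(1), of i b] progression_pos[OF assms(2), of i a]
    by (simp_all add: m_def add.commute[of b a])
  let ?g = "qpoch (fps_X ^ m) n * (\<Prod>i=1..n. (1 + fps_X ^ (m * i - b)) * (1 + fps_X ^ (m * i - a))) :: 'a fps"
  let ?e = "\<lambda>d. (\<Sum>i=1..n. if d = m * i - 0 then 1 else 0) +
      (\<Sum>i=1..n. ((if d = 2 * (m * i - b) then 1 else 0) - (if d = m * i - b then 1 else 0))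
        + ((if d = 2 * (m * i - a) then 1 else 0) - (if d = m * i - a then 1 else (0 :: 'a))))"
  have "euler_product ?g ?e"
    using assms pos by (intro euler_product_mult euler_product_qpoch euler_product_prod euler_product_one_plus)
      (auto simp: m_def)
  moreover have "agree N ?g (theta 1 a b)"
    using jacobi_triple_agree[of "1 :: 'a" m a b N n] assms by (simp add: m_def n_def)
  moreover have "?e d = ?E d" if "0 < d" "d < N" for d
  proof -
    have d: "d < n" using that by (simp add: n_def)
    have two: "2 * (m * i - r) = 2 * m * i - 2 * r" for i r
      by (simp add: diff_mult_distrib2)
    note count = count_progression[OF _ _ that(1) d, where 'a = 'a]
    have sums: "(\<Sum>i=1..n. if d = m * i - 0 then 1 else 0) = (of_bool (m dvd d + 0) :: 'a)"
      "(\<Sum>i=1..n. if d = m * i - a then 1 else 0) = (of_bool (m dvd d + a) :: 'a)"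
      "(\<Sum>i=1..n. if d = m * i - b then 1 else 0) = (of_bool (m dvd d + b) :: 'a)"
      "(\<Sum>i=1..n. if d = 2 * m * i - 2 * a then 1 else 0) = (of_bool (2 * m dvd d + 2 * a) :: 'a)"
      "(\<Sum>i=1..n. if d = 2 * m * i - 2 * b then 1 else 0) = (of_bool (2 * m dvd d + 2 * b) :: 'a)"
      using assms by (intro count; simp add: m_def)+
    show ?thesis
      unfolding sum.distrib sum_subtractf two sums by (simp add: m_def)
  qed
  ultimately show "\<exists>g e'. euler_product g e' \<and> agree N g (theta 1 a b :: 'a fps) \<and>
      (\<forall>d. 0 < d \<and> d < N \<longrightarrow> e' d = ?E d)"
    by blast
qed

section \<open>Theta identities from decompositions of lattices\<close>

lemma minus_one_powi: "(- 1 :: 'a :: field) powi n = (if even n then 1 else - 1)"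
  by (cases "even n") (auto simp: power_int_minus_left_even power_int_minus_left_odd)

lemma one_or_minus_one_powi:
  fixes c :: "'a :: field"
  assumes "c = 1 \<or> c = -1"
  shows "c powi n = (if even n then 1 else c)"
  using assms by (auto simp: minus_one_powi)

lemma theta_dilate:
  assumes "k > 0"
  shows "theta c a b oo fps_X ^ k = theta c (k * a) (k * b)"
proof -
  have "theta_exp (k * a) (k * b) = (\<lambda>n. k * theta_exp a b n)"
    by (auto simp: theta_exp_def algebra_simps)
  then show ?thesis using assms by (simp add: theta_def formal_sum_dilate)
qed

lemma finite_fibres_prod:
  assumes "finite_fibres I e" "finite_fibres J e'"
  shows "finite_fibres (I \<times> J) (\<lambda>(i, j). e i + e' j)"
  unfolding finite_fibres_def
proof
  fix n
  have "{p \<in> I \<times> J. (\<lambda>(i, j). e i + e' j) p = n} \<subseteq> (\<Union>k\<le>n. {i \<in> I. e i = k}) \<times> (\<Union>k\<le>n. {j \<in> J. e' j = k})"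
    by auto
  then show "finite {p \<in> I \<times> J. (\<lambda>(i, j). e i + e' j) p = n}"
    by (rule finite_subset) (use assms in \<open>auto simp: finite_fibres_def\<close>)
qed

lemma theta_mult:
  assumes "a + b > 0" "a' + b' > 0"
  shows "theta c a b * theta c' a' b' = formal_sum UNIV
     (\<lambda>(u, v). theta_exp a b u + theta_exp a' b' v) (\<lambda>(u, v). c powi u * c' powi v)"
  unfolding theta_def using assms by (subst formal_sum_mult) auto

text \<open>
  A sum over a coset of a sublattice is a product of two theta series as soon as the coordinates \<open>g\<close>
  separate the quadratic exponent and make the weight a constant times a product of powers.
\<close>

lemma lattice_sum_theta:
  fixes g :: "int \<times> int \<Rightarrow> int \<times> int"
  assumes g: "bij g" and pos: "a + b > 0" "a' + b' > 0"
    and e: "\<And>u v. e (u, v) = theta_exp a b (fst (g (u, v))) + theta_exp a' b' (snd (g (u, v))) + k"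
    and w: "\<And>u v. w (u, v) = d * (c powi fst (g (u, v)) * c' powi snd (g (u, v)))"
  shows "formal_sum UNIV e w = fps_const d * fps_X ^ k * (theta c a b * theta c' a' b')"
proof -
  have "fps_const d * fps_X ^ k * (theta c a b * theta c' a' b')
      = formal_sum UNIV (\<lambda>p. theta_exp a b (fst p) + theta_exp a' b' (snd p) + k)
          (\<lambda>p. d * (c powi fst p * c' powi snd p))"
    unfolding theta_mult[OF pos] mult.assoc
    by (simp add: formal_sum_shift formal_sum_const_mult case_prod_beta)
  also have "\<dots> = formal_sum UNIV e w"
    using g e w by (intro formal_sum_reindex[of g]) (auto simp: bij_def bij_betw_def)
  finally show ?thesis by simp
qed

lemma theta_sq_split:
  fixes c :: "'a :: field_char_0"
  assumes "finite A" "bij_betw (\<lambda>(j, p). h j p) (A \<times> UNIV) UNIV" "a + b > 0"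
  shows "theta c a b ^ 2 = (\<Sum>j\<in>A. formal_sum UNIV
     (\<lambda>p. theta_exp a b (fst (h j p)) + theta_exp a b (snd (h j p)))
     (\<lambda>p. c powi fst (h j p) * c powi snd (h j p)))"
proof -
  have "theta c a b ^ 2 = formal_sum UNIV (\<lambda>p. theta_exp a b (fst p) + theta_exp a b (snd p))
      (\<lambda>p. c powi fst p * c powi snd p)"
    using theta_mult[OF assms(3,3), of c c] by (simp add: power2_eq_square case_prod_unfold)
  also have "\<dots> = (\<Sum>j\<in>A. formal_sum UNIV
     (\<lambda>p. theta_exp a b (fst (h j p)) + theta_exp a b (snd (h j p)))
     (\<lambda>p. c powi fst (h j p) * c powi snd (h j p)))"
    using finite_fibres_prod[of UNIV "theta_exp a b" UNIV "theta_exp a b"] assms(3)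
    by (intro formal_sum_split[OF assms(1) _ assms(2)]) (simp add: case_prod_unfold)
  finally show ?thesis .
qed

text \<open>
  The inverse of the decomposition consists of the coset \<open>J\<close> of a point and its coordinates \<open>P\<close> there.
\<close>

lemma bij_betw_familyI:
  assumes "\<And>j p. j \<in> A \<Longrightarrow> J (h j p) = j \<and> P (h j p) = p"
    and "\<And>z. J z \<in> A \<and> h (J z) (P z) = z"
  shows "bij_betw (\<lambda>(j, p). h j p) (A \<times> UNIV) UNIV"
  by (rule bij_betw_byWitness[where f' = "\<lambda>z. (J z, P z)"]) (use assms in auto)

lemma theta_exp_sum_eqI:
  assumes "int a * (n * (n + 1)) + int b * (n * (n - 1))
      + (int a' * (m * (m + 1)) + int b' * (m * (m - 1)))
    = int d * (u * (u + 1)) + int e * (u * (u - 1))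
      + (int d' * (v * (v + 1)) + int e' * (v * (v - 1))) + 2 * int k"
  shows "theta_exp a b n + theta_exp a' b' m = theta_exp d e u + theta_exp d' e' v + k"
  using assms int_theta_exp[of a b n] int_theta_exp[of a' b' m]
    int_theta_exp[of d e u] int_theta_exp[of d' e' v] by linarith

lemma bij_translate: "bij (\<lambda>(u, v). (u + i, v + j :: int))" for i :: int
  by (rule o_bij[of "\<lambda>(u, v). (u - i, v - j)"]) auto

text \<open>
  The pairs \<open>(x, y)\<close> of integers are split by the parity of \<open>x + y\<close>. On each class
  \<open>(x, y) = (u + v + j, u - v)\<close> diagonalises \<open>x^2 + y^2\<close>.
\<close>

lemma theta_landen:
  fixes c :: "'a :: field_char_0"
  assumes c: "c = 1 \<or> c = -1"
  shows "theta c 1 1 ^ 2 = theta 1 2 2 ^ 2 + fps_const c * fps_X * theta 1 4 0 ^ 2"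
proof -
  define h :: "int \<Rightarrow> int \<times> int \<Rightarrow> int \<times> int" where "h = (\<lambda>j (u, v). (u + v + j, u - v))"
  have "bij_betw (\<lambda>(j, p). h j p) ({0, 1} \<times> UNIV) UNIV"
  proof (rule bij_betw_familyI[where J = "\<lambda>(x, y). (x + y) mod 2"
        and P = "\<lambda>(x, y). ((x - y - (x + y) mod 2) div 2 + y, (x - y - (x + y) mod 2) div 2)"])
    fix j :: int and p :: "int \<times> int" assume "j \<in> {0, 1}"
    obtain u v where p: "p = (u, v)" by (cases p)
    have m: "(u + v + j + (u - v)) mod 2 = j" using \<open>j \<in> {0, 1}\<close> by auto
    show "(case h j p of (x, y) \<Rightarrow> (x + y) mod 2) = j \<and>
        (case h j p of (x, y) \<Rightarrow> ((x - y - (x + y) mod 2) div 2 + y, (x - y - (x + y) mod 2) div 2)) = p"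
      by (simp only: p h_def case_prod_conv m) simp
  next
    fix z :: "int \<times> int"
    obtain x y where z: "z = (x, y)" by (cases z)
    have "2 * ((x - y - (x + y) mod 2) div 2) = x - y - (x + y) mod 2" by presburger
    then show "(case z of (x, y) \<Rightarrow> (x + y) mod 2) \<in> {0, 1} \<and> h (case z of (x, y) \<Rightarrow> (x + y) mod 2)
        (case z of (x, y) \<Rightarrow> ((x - y - (x + y) mod 2) div 2 + y, (x - y - (x + y) mod 2) div 2)) = z"
      by (simp add: h_def z) auto
  qed
  then have "theta c 1 1 ^ 2 = (\<Sum>j\<in>{0, 1}. formal_sum UNIV
     (\<lambda>p. theta_exp 1 1 (fst (h j p)) + theta_exp 1 1 (snd (h j p)))
     (\<lambda>p. c powi fst (h j p) * c powi snd (h j p)))"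
    by (intro theta_sq_split) auto
  moreover have "formal_sum UNIV (\<lambda>p. theta_exp 1 1 (fst (h 0 p)) + theta_exp 1 1 (snd (h 0 p)))
     (\<lambda>p. c powi fst (h 0 p) * c powi snd (h 0 p)) = fps_const 1 * fps_X ^ 0 * (theta 1 2 2 * theta 1 2 2)"
    by (rule lattice_sum_theta[of id]; (simp; fail)?;
        (unfold h_def, simp only: case_prod_conv fst_conv snd_conv id_apply, rule theta_exp_sum_eqI)?)
      (use c in \<open>auto simp: h_def one_or_minus_one_powi[OF c] algebra_simps\<close>)
  moreover have "formal_sum UNIV (\<lambda>p. theta_exp 1 1 (fst (h 1 p)) + theta_exp 1 1 (snd (h 1 p)))
     (\<lambda>p. c powi fst (h 1 p) * c powi snd (h 1 p)) = fps_const c * fps_X ^ 1 * (theta 1 4 0 * theta 1 4 0)"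
    by (rule lattice_sum_theta[of id]; (simp; fail)?;
        (unfold h_def, simp only: case_prod_conv fst_conv snd_conv id_apply, rule theta_exp_sum_eqI)?)
      (use c in \<open>auto simp: h_def one_or_minus_one_powi[OF c] algebra_simps\<close>)
  ultimately show ?thesis by (simp add: power2_eq_square)
qed

text \<open>
  Residues from \<open>-2\<close> to \<open>2\<close> make the four non-trivial cosets below come in symmetric pairs.
\<close>

definition cmod5 :: "int \<Rightarrow> int" where "cmod5 n = (n + 2) mod 5 - 2"

lemma cmod5: "cmod5 n \<in> {-2..2}" "5 dvd n - cmod5 n"
proof -
  show "cmod5 n \<in> {-2..2}" unfolding cmod5_def by simp
  show "5 dvd n - cmod5 n" unfolding cmod5_def by presburger
qed

lemma cmod5_eq: "j \<in> {-2..2} \<Longrightarrow> cmod5 (5 * v + j) = j"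
  unfolding cmod5_def by simp presburger

lemma sum_minus2_to_2: "(\<Sum>j\<in>{-2..2::int}. f j) = f (-2) + f (-1) + f 0 + f 1 + f 2"
proof -
  have "{-2..2::int} = {-2, -1, 0, 1, 2}" by auto
  then show ?thesis by (simp add: add.assoc)
qed

lemma theta_sym: "c = 1 \<or> c = - 1 \<Longrightarrow> theta c a b = theta c b a"
  unfolding theta_def
  by (rule formal_sum_reindex[of uminus])
    (auto simp: theta_exp_def one_or_minus_one_powi bij_uminus)

text \<open>
  The lattice \<open>\<int>\<^sup>2\<close> is the union of five cosets of the sublattice spanned by \<open>(2, -1)\<close> and \<open>(1, 2)\<close>,
  on which \<open>x^2 + y^2\<close> becomes \<open>5(u^2 + v^2)\<close>. The sublattice contributes \<open>\<phi>(-q^5)^2\<close>, and the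
  four other cosets contribute one and the same product.
\<close>

lemma phi_sq_quintic:
  "theta (-1) 1 1 ^ 2 = theta (-1) 5 5 ^ 2 - 4 * fps_X * (theta (-1) 7 3 * theta (-1) 9 1 :: 'a :: field_char_0 fps)"
proof -
  define h :: "int \<Rightarrow> int \<times> int \<Rightarrow> int \<times> int" where "h = (\<lambda>j (u, v). (2 * u + v + j, 2 * v - u))"
  define S :: "int \<Rightarrow> 'a fps" where "S j = formal_sum UNIV
     (\<lambda>p. theta_exp 1 1 (fst (h j p)) + theta_exp 1 1 (snd (h j p)))
     (\<lambda>p. (-1) powi fst (h j p) * (-1) powi snd (h j p))" for j
  define v where "v x y = (x + 2 * y - cmod5 (x + 2 * y)) div 5" for x y
  have v: "5 * v x y = x + 2 * y - cmod5 (x + 2 * y)" for x y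
    using cmod5(2)[of "x + 2 * y"] by (simp add: v_def)
  have "bij_betw (\<lambda>(j, p). h j p) ({-2..2} \<times> UNIV) UNIV"
  proof (rule bij_betw_familyI[where J = "\<lambda>(x, y). cmod5 (x + 2 * y)"
        and P = "\<lambda>(x, y). (2 * v x y - y, v x y)"])
    fix j :: int and p :: "int \<times> int" assume j: "j \<in> {-2..2}"
    obtain u w where p: "p = (u, w)" by (cases p)
    have "2 * u + w + j + 2 * (2 * w - u) = 5 * w + j" by simp
    then have c: "cmod5 (2 * u + w + j + 2 * (2 * w - u)) = j" by (simp only: cmod5_eq[OF j])
    then have "v (2 * u + w + j) (2 * w - u) = w" using v[of "2 * u + w + j" "2 * w - u"] by simp
    then show "(case h j p of (x, y) \<Rightarrow> cmod5 (x + 2 * y)) = j \<and>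
        (case h j p of (x, y) \<Rightarrow> (2 * v x y - y, v x y)) = p"
      using c by (simp add: h_def p)
  next
    fix z :: "int \<times> int"
    obtain x y where z: "z = (x, y)" by (cases z)
    show "(case z of (x, y) \<Rightarrow> cmod5 (x + 2 * y)) \<in> {-2..2} \<and> h (case z of (x, y) \<Rightarrow> cmod5 (x + 2 * y))
        (case z of (x, y) \<Rightarrow> (2 * v x y - y, v x y)) = z"
      using v[of x y] cmod5(1)[of "x + 2 * y"] by (simp add: h_def z)
  qed
  then have "theta (-1) 1 1 ^ 2 = (\<Sum>j\<in>{-2..2}. S j)"
    unfolding S_def by (intro theta_sq_split) auto
  moreover have "S 0 = fps_const 1 * fps_X ^ 0 * (theta (-1) 5 5 * theta (-1) 5 5)" unfolding S_def
    by (rule lattice_sum_theta[of id]; (simp; fail)?;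
        (unfold h_def, simp only: case_prod_conv fst_conv snd_conv id_apply, rule theta_exp_sum_eqI)?)
      (auto simp: h_def minus_one_powi algebra_simps)
  moreover have "S 1 = fps_const (-1) * fps_X ^ 1 * (theta (-1) 9 1 * theta (-1) 7 3)" unfolding S_def
    by (rule lattice_sum_theta[of id]; (simp; fail)?;
        (unfold h_def, simp only: case_prod_conv fst_conv snd_conv id_apply, rule theta_exp_sum_eqI)?)
      (auto simp: h_def minus_one_powi algebra_simps)
  moreover have "S (-1) = fps_const (-1) * fps_X ^ 1 * (theta (-1) 1 9 * theta (-1) 3 7)" unfolding S_def
    by (rule lattice_sum_theta[of id]; (simp; fail)?;
        (unfold h_def, simp only: case_prod_conv fst_conv snd_conv id_apply, rule theta_exp_sum_eqI)?)
      (auto simp: h_def minus_one_powi algebra_simps)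
  moreover have "S 2 = fps_const (-1) * fps_X ^ 1 * (theta (-1) 3 7 * theta (-1) 9 1)" unfolding S_def
    by (rule lattice_sum_theta[OF bij_translate[of 1 0]]; (simp; fail)?;
        (unfold h_def, simp only: case_prod_conv fst_conv snd_conv id_apply, rule theta_exp_sum_eqI)?)
      (auto simp: h_def minus_one_powi algebra_simps)
  moreover have "S (-2) = fps_const (-1) * fps_X ^ 1 * (theta (-1) 7 3 * theta (-1) 1 9)" unfolding S_def
    by (rule lattice_sum_theta[OF bij_translate[of "-1" 0]]; (simp; fail)?;
        (unfold h_def, simp only: case_prod_conv fst_conv snd_conv id_apply, rule theta_exp_sum_eqI)?)
      (auto simp: h_def minus_one_powi algebra_simps)
  ultimately show ?thesis
    unfolding sum_minus2_to_2
    by (simp add: power2_eq_square theta_sym[of "-1" 1 9] theta_sym[of "-1" 3 7]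
        fps_const_neg[symmetric] algebra_simps del: fps_const_neg One_nat_def)
qed

text \<open>
  The cosets of the same sublattice of index five, for a sum of two triangular numbers instead of two squares. The
  factor \<open>4\<close> is that of \<open>(2 \<psi>(q))^2\<close>.
\<close>

lemma psi_sq_quintic:
  "theta 1 1 0 ^ 2 = fps_X * theta 1 5 0 ^ 2 + 4 * (theta 1 1 4 * theta 1 2 3 :: 'a :: field_char_0 fps)"
proof -
  define h :: "int \<Rightarrow> int \<times> int \<Rightarrow> int \<times> int" where "h = (\<lambda>j (u, v). (2 * u + v + 1, 2 * v - u - j))"
  define S :: "int \<Rightarrow> 'a fps" where "S j = formal_sum UNIV
     (\<lambda>p. theta_exp 1 0 (fst (h j p)) + theta_exp 1 0 (snd (h j p)))
     (\<lambda>p. 1 powi fst (h j p) * 1 powi snd (h j p))" for j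
  define c where "c k l = cmod5 (2 * (k + 2 * l - 1))" for k l
  define v where "v k l = (k + 2 * l - 1 + 2 * c k l) div 5" for k l
  have v: "5 * v k l = k + 2 * l - 1 + 2 * c k l" for k l
  proof -
    have "5 dvd 2 * (k + 2 * l - 1) - c k l" using cmod5(2) by (simp add: c_def)
    then have "5 dvd k + 2 * l - 1 + 2 * c k l" by presburger
    then show ?thesis by (simp add: v_def)
  qed
  have "bij_betw (\<lambda>(j, p). h j p) ({-2..2} \<times> UNIV) UNIV"
  proof (rule bij_betw_familyI[where J = "\<lambda>(k, l). c k l"
        and P = "\<lambda>(k, l). (2 * v k l - c k l - l, v k l)"])
    fix j :: int and p :: "int \<times> int" assume j: "j \<in> {-2..2}"
    obtain u w where p: "p = (u, w)" by (cases p)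
    have "2 * (2 * u + w + 1 + 2 * (2 * w - u - j) - 1) = 5 * (2 * w - j) + j" by simp
    then have c: "c (2 * u + w + 1) (2 * w - u - j) = j" by (simp only: c_def cmod5_eq[OF j])
    then have "v (2 * u + w + 1) (2 * w - u - j) = w" using v[of "2 * u + w + 1" "2 * w - u - j"] by simp
    then show "(case h j p of (k, l) \<Rightarrow> c k l) = j \<and>
        (case h j p of (k, l) \<Rightarrow> (2 * v k l - c k l - l, v k l)) = p"
      using c by (simp add: h_def p)
  next
    fix z :: "int \<times> int"
    obtain k l where z: "z = (k, l)" by (cases z)
    have "c k l \<in> {-2..2}" using cmod5(1) by (simp only: c_def)
    then show "(case z of (k, l) \<Rightarrow> c k l) \<in> {-2..2} \<and> h (case z of (k, l) \<Rightarrow> c k l)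
        (case z of (k, l) \<Rightarrow> (2 * v k l - c k l - l, v k l)) = z"
      using v[of k l] by (simp add: h_def z)
  qed
  then have "theta 1 1 0 ^ 2 = (\<Sum>j\<in>{-2..2}. S j)"
    unfolding S_def by (intro theta_sq_split) auto
  moreover have "S 0 = fps_const 1 * fps_X ^ 1 * (theta 1 5 0 * theta 1 5 0)" unfolding S_def
    by (rule lattice_sum_theta[of id]; (simp; fail)?;
        (unfold h_def, simp only: case_prod_conv fst_conv snd_conv id_apply, rule theta_exp_sum_eqI)?)
      (auto simp: h_def algebra_simps)
  moreover have "S 1 = fps_const 1 * fps_X ^ 0 * (theta 1 1 4 * theta 1 3 2)" unfolding S_def
    by (rule lattice_sum_theta[OF bij_translate[of 1 0]]; (simp; fail)?;
        (unfold h_def, simp only: case_prod_conv fst_conv snd_conv id_apply, rule theta_exp_sum_eqI)?)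
      (auto simp: h_def algebra_simps)
  moreover have "S (-1) = fps_const 1 * fps_X ^ 0 * (theta 1 4 1 * theta 1 2 3)" unfolding S_def
    by (rule lattice_sum_theta[OF bij_translate[of 0 1]]; (simp; fail)?;
        (unfold h_def, simp only: case_prod_conv fst_conv snd_conv id_apply, rule theta_exp_sum_eqI)?)
      (auto simp: h_def algebra_simps)
  moreover have "S 2 = fps_const 1 * fps_X ^ 0 * (theta 1 2 3 * theta 1 1 4)" unfolding S_def
    by (rule lattice_sum_theta[OF bij_translate[of 1 0]]; (simp; fail)?;
        (unfold h_def, simp only: case_prod_conv fst_conv snd_conv id_apply, rule theta_exp_sum_eqI)?)
      (auto simp: h_def algebra_simps)
  moreover have "S (-2) = fps_const 1 * fps_X ^ 0 * (theta 1 3 2 * theta 1 4 1)" unfolding S_def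
    by (rule lattice_sum_theta[OF bij_translate[of 0 1]]; (simp; fail)?;
        (unfold h_def, simp only: case_prod_conv fst_conv snd_conv id_apply, rule theta_exp_sum_eqI)?)
      (auto simp: h_def algebra_simps)
  ultimately show ?thesis
    unfolding sum_minus2_to_2
    by (simp add: power2_eq_square theta_sym[of 1 4 1] theta_sym[of 1 3 2] algebra_simps del: One_nat_def)
qed

text \<open>
  Every triangular number \<open>n(n+1)/2\<close> is taken twice over the integers, at \<open>n\<close> and at \<open>-1-n\<close>. One of the
  two is odd, \<open>2k - 1\<close>, and the other is \<open>-2k\<close>.
\<close>

lemma theta_1_1_0: "theta 1 1 0 = (2 * theta 1 1 3 :: 'a :: field_char_0 fps)"
proof -
  define h :: "int \<Rightarrow> int \<Rightarrow> int" where "h j n = (if j = 0 then 2 * n - 1 else - 2 * n)" for j n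
  have "theta 1 1 0 = (\<Sum>j\<in>{0, 1}. formal_sum UNIV (\<lambda>n. theta_exp 1 0 (h j n)) (\<lambda>n. 1 powi h j n) :: 'a fps)"
    unfolding theta_def
  proof (rule formal_sum_split)
    show "bij_betw (\<lambda>(j, n). h j n) ({0, 1} \<times> UNIV) UNIV"
      by (rule bij_betw_byWitness[where f' = "\<lambda>k. if odd k then (0, (k + 1) div 2) else (1, - (k div 2))"])
        (auto simp: h_def elim!: oddE evenE)
  qed auto
  moreover have "theta_exp 1 0 (h j n) = theta_exp 1 3 n" if "j = 0 \<or> j = 1" for j n
    using that int_theta_exp[of 1 0 "h j n"] int_theta_exp[of 1 3 n]
    by (auto simp: h_def algebra_simps)
  ultimately show ?thesis by (simp add: theta_def)
qed

section \<open>Theta identities from products\<close>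

text \<open>
  The exponents of \<open>1 - q^d\<close> in the two triple products, as integers: they are periodic in \<open>d\<close>, so that an
  identity between products of theta functions reduces to a finite computation with residues.
\<close>

definition triple_minus :: "nat \<Rightarrow> nat \<Rightarrow> nat \<Rightarrow> int" where
  "triple_minus a b d = of_bool (a + b dvd d) + of_bool (a + b dvd d + a) + of_bool (a + b dvd d + b)"

definition triple_plus :: "nat \<Rightarrow> nat \<Rightarrow> nat \<Rightarrow> int" where
  "triple_plus a b d = of_bool (a + b dvd d)
       + (of_bool (2 * (a + b) dvd d + 2 * a) - of_bool (a + b dvd d + a))
       + (of_bool (2 * (a + b) dvd d + 2 * b) - of_bool (a + b dvd d + b))"

lemma euler_product_theta_minus:
  assumes "a > 0" "b > 0"
  shows "euler_product (theta (-1) a b :: 'a :: field_char_0 fps) (\<lambda>d. of_int (triple_minus a b d))"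
  using jacobi_triple_minus[OF assms, where 'a = 'a] by (simp add: triple_minus_def)

lemma euler_product_theta_plus:
  assumes "a > 0" "b > 0"
  shows "euler_product (theta 1 a b :: 'a :: field_char_0 fps) (\<lambda>d. of_int (triple_plus a b d))"
  using jacobi_triple_plus[OF assms, where 'a = 'a] by (simp add: triple_plus_def)

lemma dvd_mod_shift:
  fixes k M d c :: nat
  assumes "k dvd M"
  shows "k dvd d mod M + c \<longleftrightarrow> k dvd d + c" "k dvd d mod M \<longleftrightarrow> k dvd d"
proof -
  have "(d + c) mod k = (d mod M + c) mod k"
    using assms by (metis mod_add_left_eq mod_mod_cancel)
  then show "k dvd d mod M + c \<longleftrightarrow> k dvd d + c" by (simp add: dvd_eq_mod_eq_0)
  show "k dvd d mod M \<longleftrightarrow> k dvd d" using assms by (simp add: dvd_mod_iff)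
qed

lemma triple_minus_mod: "a + b dvd M \<Longrightarrow> triple_minus a b (d mod M) = triple_minus a b d"
  by (simp only: triple_minus_def dvd_mod_shift)

lemma triple_plus_mod: "2 * (a + b) dvd M \<Longrightarrow> triple_plus a b (d mod M) = triple_plus a b d"
  using dvd_trans[of "a + b" "2 * (a + b)" M] by (simp only: triple_plus_def dvd_mod_shift dvd_triv_right)

lemma psi_sq: "theta 1 1 3 ^ 2 = (theta 1 1 1 * theta 1 2 6 :: 'a :: field_char_0 fps)"
proof -
  have eq: "2 * triple_plus 1 3 d = triple_plus 1 1 d + triple_plus 2 6 d" for d
  proof -
    have "\<forall>r\<in>set [0..<16]. 2 * triple_plus 1 3 r = triple_plus 1 1 r + triple_plus 2 6 r"
      by code_simp
    from bspec[OF this, of "d mod 16"] show ?thesis by (simp add: triple_plus_mod)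
  qed
  have "2 * of_int (triple_plus 1 3 d)
      = of_int (triple_plus 1 1 d) + (of_int (triple_plus 2 6 d) :: 'a)" for d
    using arg_cong[OF eq[of d], of "of_int :: int \<Rightarrow> 'a"] by (simp only: of_int_add of_int_mult of_int_numeral)
  then show ?thesis
    by (intro euler_product_unique[OF euler_product_power[OF euler_product_theta_plus]
          euler_product_mult[OF euler_product_theta_plus euler_product_theta_plus]]) auto
qed

lemma phi_mult: "theta 1 1 1 * theta (-1) 1 1 = (theta (-1) 2 2 ^ 2 :: 'a :: field_char_0 fps)"
proof -
  have eq: "triple_plus 1 1 d + triple_minus 1 1 d = 2 * triple_minus 2 2 d" for d
  proof -
    have "\<forall>r\<in>set [0..<4]. triple_plus 1 1 r + triple_minus 1 1 r = 2 * triple_minus 2 2 r"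
      by code_simp
    from bspec[OF this, of "d mod 4"] show ?thesis by (simp add: triple_plus_mod triple_minus_mod del: One_nat_def)
  qed
  have "of_int (triple_plus 1 1 d) + of_int (triple_minus 1 1 d)
      = 2 * (of_int (triple_minus 2 2 d) :: 'a)" for d
    using arg_cong[OF eq[of d], of "of_int :: int \<Rightarrow> 'a"] by (simp only: of_int_add of_int_mult of_int_numeral)
  then show ?thesis
    by (intro euler_product_unique[OF euler_product_mult[OF euler_product_theta_plus euler_product_theta_minus]
          euler_product_power[OF euler_product_theta_minus]]) auto
qed

text \<open>
  The four theta functions occurring in \<open>phi_sq_quintic\<close> and \<open>psi_sq_quintic\<close> multiply to
  \<open>\<psi>(q^5)^2 \<phi>(-q^5)^2\<close>, which ties the two quintic identities together.
\<close>

lemma theta_quintic_mult: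
  "theta (-1) 7 3 * theta (-1) 9 1 * (theta 1 1 4 * theta 1 2 3)
     = (theta 1 5 15 * theta (-1) 5 5) ^ 2" (is "?L = (?R :: 'a :: field_char_0 fps)")
proof -
  have eq: "triple_minus 7 3 d + triple_minus 9 1 d + (triple_plus 1 4 d + triple_plus 2 3 d)
      = 2 * (triple_plus 5 15 d + triple_minus 5 5 d)" for d
  proof -
    have "\<forall>r\<in>set [0..<40]. triple_minus 7 3 r + triple_minus 9 1 r + (triple_plus 1 4 r + triple_plus 2 3 r)
      = 2 * (triple_plus 5 15 r + triple_minus 5 5 r)"
      by code_simp
    from bspec[OF this, of "d mod 40"] show ?thesis by (simp add: triple_plus_mod triple_minus_mod del: One_nat_def)
  qed
  have "of_int (triple_minus 7 3 d) + of_int (triple_minus 9 1 d) + (of_int (triple_plus 1 4 d) + of_int (triple_plus 2 3 d))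
      = 2 * (of_int (triple_plus 5 15 d) + of_int (triple_minus 5 5 d) :: 'a)" for d
    using arg_cong[OF eq[of d], of "of_int :: int \<Rightarrow> 'a"] by (simp only: of_int_add of_int_mult of_int_numeral)
  then show ?thesis
    by (intro euler_product_unique[OF
          euler_product_mult[OF euler_product_mult[OF euler_product_theta_minus euler_product_theta_minus]
            euler_product_mult[OF euler_product_theta_plus euler_product_theta_plus]]
          euler_product_power[OF euler_product_mult[OF euler_product_theta_plus euler_product_theta_minus]]]) auto
qed

section \<open>The divisor series as a fourth power\<close>

definition sigma :: "nat \<Rightarrow> nat" where
  "sigma n = (\<Sum>d | d dvd n. d)"

definition sigma_odd_series :: "'a :: field_char_0 fps" where
  "sigma_odd_series = Abs_fps (\<lambda>n. of_nat (sigma (2 * n + 1)))"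

text \<open>
  An odd divisor \<open>d\<close> of an even number is paired with the divisor \<open>2d\<close>.
\<close>

lemma sum_divisors_even_odd:
  fixes n :: nat
  assumes "n > 0" "even n"
  shows "(\<Sum>d | d dvd n. of_nat d * (2 * of_bool (odd d) - of_bool (d mod 4 = 2)) :: 'a :: field_char_0) = 0"
proof -
  have fin: "finite {d. d dvd n}" using assms by simp
  have "(\<Sum>d | d dvd n. of_nat d * (2 * of_bool (odd d) - of_bool (d mod 4 = 2)) :: 'a)
      = (\<Sum>d | d dvd n. of_bool (odd d) * (2 * of_nat d)) - (\<Sum>d | d dvd n. of_bool (d mod 4 = 2) * of_nat d)"
    by (simp add: sum_subtractf[symmetric] algebra_simps)
  also have "(\<Sum>d | d dvd n. of_bool (odd d) * (2 * of_nat d) :: 'a) = (\<Sum>d | d dvd n \<and> odd d. 2 * of_nat d)"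
    using fin by (intro sum.mono_neutral_cong_right) auto
  also have "(\<Sum>d | d dvd n. of_bool (d mod 4 = 2) * of_nat d :: 'a) = (\<Sum>d | d dvd n \<and> d mod 4 = 2. of_nat d)"
    using fin by (intro sum.mono_neutral_cong_right) auto
  also have "\<dots> = (\<Sum>d | d dvd n \<and> odd d. 2 * of_nat d)"
  proof (rule sum.reindex_bij_witness[of _ "\<lambda>d. 2 * d" "\<lambda>d. d div 2"])
    fix d assume d: "d \<in> {d. d dvd n \<and> d mod 4 = 2}"
    then have "d mod 4 = 2" by simp
    then have "even d" by presburger
    have "odd (d div 2)" using \<open>d mod 4 = 2\<close> by presburger
    have "d div 2 dvd n" using d \<open>even d\<close> by (metis dvd_div_mult_self dvd_mult_left mem_Collect_eq)
    with \<open>even d\<close> \<open>odd (d div 2)\<close> show "2 * (d div 2) = d" "d div 2 \<in> {d. d dvd n \<and> odd d}" "2 * of_nat (d div 2) = (of_nat d :: 'a)"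
      by (auto simp flip: of_nat_mult[of 2 "_ :: nat", where 'a = 'a, simplified])
  next
    fix d assume d: "d \<in> {d. d dvd n \<and> odd d}"
    then have "coprime 2 d" by simp
    then have "2 * d dvd n" using d assms by (intro divides_mult) auto
    moreover have "2 * d mod 4 = 2"
    proof -
      have "odd d" using d by simp
      then show ?thesis by presburger
    qed
    ultimately show "2 * d \<in> {d. d dvd n \<and> d mod 4 = 2}" by simp
  qed auto
  finally show ?thesis by simp
qed

text \<open>
  The left side is the logarithmic derivative of \<open>\<phi>(q)/\<phi>(-q)\<close>, which is the source of the odd divisor sums.
\<close>

lemma log_series_phi_quotient:
  "log_series (\<lambda>d. of_int (triple_minus 1 1 d) - of_int (triple_plus 1 1 d))
     = 4 * fps_X * (sigma_odd_series oo fps_X ^ 2 :: 'a :: field_char_0 fps)"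
proof (rule fps_ext)
  fix n
  have e: "of_int (triple_minus 1 1 d) - of_int (triple_plus 1 1 d)
      = 4 * of_bool (odd d) - 2 * (of_bool (d mod 4 = 2) :: 'a)" for d
  proof -
    have "\<forall>r\<in>set [0..<4]. triple_minus 1 1 r - triple_plus 1 1 r = 4 * of_bool (r mod 2 = 1) - 2 * of_bool (r mod 4 = 2)"
      by code_simp
    from bspec[OF this, of "d mod 4"]
    have "triple_minus 1 1 d - triple_plus 1 1 d = 4 * of_bool (odd d) - 2 * of_bool (d mod 4 = 2)"
      by (simp add: triple_plus_mod triple_minus_mod mod_mod_cancel odd_iff_mod_2_eq_one del: One_nat_def)
    then have "(of_int (triple_minus 1 1 d - triple_plus 1 1 d) :: 'a) = of_int (4 * of_bool (odd d) - 2 * of_bool (d mod 4 = 2))"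
      by simp
    then show ?thesis by simp
  qed
  have rhs: "(4 * fps_X * (sigma_odd_series oo fps_X ^ 2)) $ n
      = (if odd n then 4 * of_nat (sigma n) else (0 :: 'a))"
  proof (cases n)
    case (Suc m)
    have "(4 * fps_X * (sigma_odd_series oo fps_X ^ 2)) $ n = 4 * (sigma_odd_series oo fps_X ^ 2 :: 'a fps) $ m"
      by (simp add: Suc mult.assoc numeral_fps_const)
    then show ?thesis
      by (auto simp: Suc fps_nth_compose_X_power sigma_odd_series_def)
  qed (simp add: mult.assoc numeral_fps_const)
  show "log_series (\<lambda>d. of_int (triple_minus 1 1 d) - of_int (triple_plus 1 1 d)) $ n
      = (4 * fps_X * (sigma_odd_series oo fps_X ^ 2 :: 'a fps)) $ n"
  proof (cases "n = 0")
    case False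
    have "(\<Sum>d | d dvd n. of_nat d * (4 * of_bool (odd d) - 2 * of_bool (d mod 4 = 2)))
        = 2 * (\<Sum>d | d dvd n. of_nat d * (2 * of_bool (odd d) - of_bool (d mod 4 = 2)) :: 'a)"
      by (simp add: sum_distrib_left algebra_simps)
    also have "\<dots> = (if odd n then 4 * of_nat (sigma n) else (0 :: 'a))"
    proof (cases "odd n")
      case True
      have "odd d \<and> d mod 4 \<noteq> 2" if "d dvd n" for d
      proof -
        have "odd d" using that True dvd_trans by blast
        then show ?thesis by presburger
      qed
      then have "(\<Sum>d | d dvd n. of_nat d * (2 * of_bool (odd d) - of_bool (d mod 4 = 2)) :: 'a) = (\<Sum>d | d dvd n. of_nat d * 2)"
        by (intro sum.cong) auto
      then show ?thesis using True by (simp add: sigma_def sum_distrib_left mult_ac)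
    next
      case even: False
      then show ?thesis using sum_divisors_even_odd[of n, where 'a = 'a] False by simp
    qed
    finally show ?thesis using False unfolding rhs e by (simp add: log_series_def)
  qed (simp add: log_series_def rhs)
qed

text \<open>
  Unlike Euler products, logarithmic derivatives survive substitutions \<open>q \<mapsto> cq\<close>, which is needed for roots of
  unity \<open>c\<close>.
\<close>

definition has_log_deriv :: "'a :: field_char_0 fps \<Rightarrow> 'a fps \<Rightarrow> bool" where
  "has_log_deriv f L \<longleftrightarrow> f $ 0 = 1 \<and> fps_X * fps_deriv f = f * L"

lemma euler_product_has_log_deriv: "euler_product f e \<Longrightarrow> has_log_deriv f (- log_series e)"
  by (simp add: euler_product_def has_log_deriv_def)

lemma has_log_deriv_mult:
  "has_log_deriv f L \<Longrightarrow> has_log_deriv g M \<Longrightarrow> has_log_deriv (f * g) (L + M)"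
proof -
  assume a: "has_log_deriv f L" "has_log_deriv g M"
  have "fps_X * fps_deriv (f * g) = f * (fps_X * fps_deriv g) + g * (fps_X * fps_deriv f)"
    by (simp add: algebra_simps)
  also have "\<dots> = f * g * (L + M)"
    using a by (simp add: has_log_deriv_def algebra_simps)
  finally show ?thesis using a by (simp add: has_log_deriv_def)
qed

lemma has_log_deriv_1: "has_log_deriv 1 0"
  by (simp add: has_log_deriv_def)

lemma has_log_deriv_prod:
  "(\<And>i. i \<in> A \<Longrightarrow> has_log_deriv (f i) (L i)) \<Longrightarrow> has_log_deriv (\<Prod>i\<in>A. f i) (\<Sum>i\<in>A. L i)"
  by (induction A rule: infinite_finite_induct) (auto intro: has_log_deriv_mult has_log_deriv_1)

lemma has_log_deriv_power: "has_log_deriv f L \<Longrightarrow> has_log_deriv (f ^ n) (of_nat n * L)"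
  using has_log_deriv_prod[of "{..<n}" "\<lambda>_. f" "\<lambda>_. L"] by simp

lemma has_log_deriv_unique:
  assumes "has_log_deriv f L" "has_log_deriv g L"
  shows "f = g"
proof -
  define h where "h = f * inverse g"
  have g: "inverse g * g = 1"
    using assms by (intro inverse_mult_eq_1) (simp add: has_log_deriv_def)
  then have f: "f = h * g" by (simp add: h_def mult.assoc)
  have "fps_X * fps_deriv f = h * (fps_X * fps_deriv g) + (fps_X * g) * fps_deriv h"
    unfolding f by (simp add: algebra_simps)
  moreover have "fps_X * fps_deriv f = h * (g * L)" "fps_X * fps_deriv g = g * L"
    using assms f by (simp_all only: has_log_deriv_def mult.assoc)
  ultimately have "(fps_X * g) * fps_deriv h = 0" by simp
  moreover have "fps_X * g \<noteq> 0" using assms by (auto simp: has_log_deriv_def)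
  ultimately have "fps_deriv h = 0" by simp
  then obtain c where c: "h = fps_const c" using fps_deriv_eq_0_iff by blast
  have "h $ 0 = 1" using assms by (simp add: h_def has_log_deriv_def)
  then have "h = 1" unfolding c by simp
  then show ?thesis using f by simp
qed

lemma fps_X_deriv_dilate:
  fixes f :: "'a :: field_char_0 fps"
  assumes "k > 0"
  shows "fps_X * fps_deriv (f oo fps_X ^ k) = of_nat k * ((fps_X * fps_deriv f) oo fps_X ^ k)"
proof (rule fps_ext)
  fix n
  have "(fps_X * fps_deriv g) $ m = of_nat m * g $ m" for g :: "'a fps" and m
    by (cases m) auto
  then show "(fps_X * fps_deriv (f oo fps_X ^ k)) $ n = (of_nat k * ((fps_X * fps_deriv f) oo fps_X ^ k)) $ n"
    using assms by (auto simp: fps_nth_compose_X_power fps_of_nat[symmetric] elim!: dvdE simp del: fps_of_nat)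
qed

lemma dilate_mult:
  fixes f g :: "'a :: field_char_0 fps"
  assumes "k > 0"
  shows "(f * g) oo fps_X ^ k = (f oo fps_X ^ k) * (g oo fps_X ^ k)"
  using assms by (intro fps_compose_mult_distrib) simp

lemma dilate_power:
  fixes f g :: "'a :: field_char_0 fps"
  assumes "k > 0"
  shows "(f ^ n) oo fps_X ^ k = (f oo fps_X ^ k) ^ n"
  using assms by (induction n) (simp_all add: dilate_mult)

lemma has_log_deriv_dilate:
  assumes "k > 0" "has_log_deriv f L"
  shows "has_log_deriv (f oo fps_X ^ k) (of_nat k * (L oo fps_X ^ k))"
  using assms fps_X_deriv_dilate[OF assms(1), of f]
  by (simp add: has_log_deriv_def dilate_mult mult_ac)

lemma dilate_inj:
  fixes f g :: "'a :: field_char_0 fps"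
  assumes "k > 0" "f oo fps_X ^ k = g oo fps_X ^ k"
  shows "f = g"
proof (rule fps_ext)
  fix n
  have "(f oo fps_X ^ k) $ (k * n) = (g oo fps_X ^ k) $ (k * n)" using assms by simp
  then show "f $ n = g $ n" using assms(1) by (simp add: fps_nth_compose_X_power)
qed

text \<open>
  A coefficient at \<open>n > 0\<close> equals the one at \<open>n/k\<close> or, if \<open>k\<close> does not divide \<open>n\<close>, vanishes; so it
  vanishes by descent.
\<close>

lemma dilate_fixed_const:
  fixes f :: "'a :: field_char_0 fps"
  assumes "k > 1" "f = f oo fps_X ^ k"
  shows "f = fps_const (f $ 0)"
proof -
  have "f $ n = 0" if "n > 0" for n
    using that
  proof (induction n rule: less_induct)
    case (less n)
    have *: "f $ n = (if k dvd n then f $ (n div k) else 0)"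
      using assms fps_nth_compose_X_power[of f k n] by simp
    show ?case
    proof (cases "k dvd n")
      case True
      then have "0 < n div k" "n div k < n" using assms(1) less.prems by (auto elim!: dvdE)
      then show ?thesis using * less.IH by auto
    qed (use * in simp)
  qed
  then show ?thesis by (auto simp: fps_eq_iff)
qed

text \<open>
  Put \<open>m = \<phi>(-q)\<close>, \<open>u = \<psi>(q^2)\<close> and \<open>E = \<Sum>\<sigma>(2n+1) q^(2n)\<close>, where \<open>4qE\<close> is the logarithmic
  derivative of \<open>\<phi>(q)/\<phi>(-q)\<close>. Differentiating Jacobi's identity
  \<open>\<phi>(q)^4 = \<phi>(-q)^4 + 16 q \<psi>(q^2)^4\<close> gives \<open>m^4 E = u^4 Y\<close> with \<open>Y\<close> built from the logarithmic
  derivatives of \<open>\<phi>(q)\<close> and \<open>\<psi>(q^2)\<close>. Differentiating instead the two Landen identities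
  \<open>\<phi>(\<plusminus>q)^2 = \<phi>(q^2)^2 \<plusminus> 4 q \<psi>(q^4)^2\<close> gives \<open>m(q^2)^4 E = u^4 Y(q^2)\<close>. So
  \<open>R = E/u^4 = Y/m^4\<close> satisfies \<open>R(q) = R(q^2)\<close>, which makes it the constant \<open>1\<close>.
\<close>

theorem sigma_odd_series_eq: "sigma_odd_series = (theta 1 1 3 ^ 4 :: 'a :: field_char_0 fps)"
proof -
  define D where "D f = fps_X * fps_deriv f" for f :: "'a fps"
  have D_mult: "D (f * g) = f * D g + g * D f" for f g
    by (simp add: D_def algebra_simps)
  have D_power: "D (f ^ n) = of_nat n * (f ^ (n - 1) * D f)" for f n
    by (simp add: D_def fps_deriv_power' mult_ac)
  define p m P2 u u4 where "p = (theta 1 1 1 :: 'a fps)" and "m = (theta (-1) 1 1 :: 'a fps)"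
    and "P2 = (theta 1 2 2 :: 'a fps)" and "u = (theta 1 2 6 :: 'a fps)" and "u4 = (theta 1 4 12 :: 'a fps)"
  define W where "W = 4 * fps_X * u4 ^ 2"
  define E where "E = (sigma_odd_series oo fps_X ^ 2 :: 'a fps)"
  define Lp Lm Lu where "Lp = (log_series (\<lambda>d. of_int (triple_plus 1 1 d)) :: 'a fps)"
    and "Lm = (log_series (\<lambda>d. of_int (triple_minus 1 1 d)) :: 'a fps)"
    and "Lu = (log_series (\<lambda>d. of_int (triple_plus 2 6 d)) :: 'a fps)"
  have Dp: "D p = - (p * Lp)" and Dm: "D m = - (m * Lm)" and Du: "D u = - (u * Lu)"
    using euler_product_theta_plus[of 1 1, where 'a = 'a] euler_product_theta_minus[of 1 1, where 'a = 'a]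
      euler_product_theta_plus[of 2 6, where 'a = 'a]
    by (simp_all add: D_def p_def m_def u_def Lp_def Lm_def Lu_def euler_product_def)
  have nth_0: "m $ 0 = 1" "u $ 0 = 1" "p $ 0 = 1"
    using euler_product_theta_plus[of 1 1, where 'a = 'a] euler_product_theta_minus[of 1 1, where 'a = 'a]
      euler_product_theta_plus[of 2 6, where 'a = 'a]
    by (simp_all add: p_def m_def u_def euler_product_def)
  have diff: "Lm - Lp = 4 * fps_X * E"
    using log_series_phi_quotient[where 'a = 'a]
      log_series_add[of "\<lambda>d. of_int (triple_minus 1 1 d) :: 'a" "\<lambda>d. - of_int (triple_plus 1 1 d)"]
    by (simp add: log_series_uminus E_def Lm_def Lp_def)
  have W: "W = fps_X * theta 1 4 0 ^ 2"
  proof -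
    have "theta 1 4 0 = (theta 1 1 0 oo fps_X ^ 4 :: 'a fps)" by (simp add: theta_dilate)
    also have "\<dots> = (2 * theta 1 1 3) oo fps_X ^ 4" by (simp only: theta_1_1_0)
    also have "\<dots> = 2 * u4"
      by (simp add: dilate_mult u4_def theta_dilate numeral_fps_const)
    finally show ?thesis by (simp add: W_def power2_eq_square)
  qed
  have p2: "p ^ 2 = P2 ^ 2 + W" and m2: "m ^ 2 = P2 ^ 2 - W"
    using theta_landen[of "1 :: 'a"] theta_landen[of "-1 :: 'a"]
    by (simp_all add: p_def m_def P2_def W fps_const_neg[symmetric] del: fps_const_neg)
  have P2: "P2 = p oo fps_X ^ 2" and u4: "u4 = u oo fps_X ^ 2"
    by (simp_all add: P2_def p_def u4_def u_def theta_dilate)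
  have u2: "u ^ 2 = P2 * u4"
  proof -
    have "(theta 1 1 3 ^ 2) oo fps_X ^ 2 = ((theta 1 1 1 * theta 1 2 6) oo fps_X ^ 2 :: 'a fps)"
      by (simp only: psi_sq)
    then show ?thesis by (simp add: dilate_mult dilate_power theta_dilate u_def P2_def u4_def)
  qed
  have quartic: "p ^ 4 = m ^ 4 + 16 * (fps_X * u ^ 4)"
  proof -
    have "p ^ 4 = (P2 ^ 2 + W) ^ 2" "m ^ 4 = (P2 ^ 2 - W) ^ 2" "u ^ 4 = (P2 * u4) ^ 2"
      by (simp_all flip: p2 m2 u2 power_mult)
    then show ?thesis by (simp add: W_def power2_eq_square algebra_simps)
  qed
  define Y where "Y = 1 + 4 * Lp - 4 * Lu"
  have eq1: "m ^ 4 * E = u ^ 4 * Y"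
  proof -
    have "D (p ^ 4) = D (m ^ 4) + D (16 * (fps_X * u ^ 4))"
      unfolding quartic by (simp add: D_def algebra_simps)
    moreover have "D (p ^ 4) = - 4 * p ^ 4 * Lp" "D (m ^ 4) = - 4 * m ^ 4 * Lm"
      by (simp_all add: D_power Dp Dm) (simp_all add: eval_nat_numeral mult_ac)
    moreover have "D (16 * (fps_X * u ^ 4)) = 16 * fps_X * u ^ 4 * (1 - 4 * Lu)"
    proof -
      have "D 16 = 0" "D fps_X = fps_X" by (simp_all add: D_def)
      then show ?thesis
        by (simp add: D_mult D_power Du) (simp add: eval_nat_numeral algebra_simps)
    qed
    ultimately have "- 4 * (m ^ 4 + 16 * (fps_X * u ^ 4)) * Lp
        = - 4 * m ^ 4 * Lm + 16 * fps_X * u ^ 4 * (1 - 4 * Lu)"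
      unfolding quartic by simp
    then have "4 * (m ^ 4 * (Lm - Lp)) = 16 * fps_X * (u ^ 4 * Y)"
      unfolding Y_def by (simp add: algebra_simps)
    then have "16 * fps_X * (m ^ 4 * E) = 16 * fps_X * (u ^ 4 * Y)"
      unfolding diff by (simp add: mult_ac)
    then show ?thesis by (simp del: mult.assoc)
  qed
  have eq2: "(m oo fps_X ^ 2) ^ 4 * E = u ^ 4 * (Y oo fps_X ^ 2)"
  proof -
    have DP2: "D P2 = - 2 * P2 * (Lp oo fps_X ^ 2)"
    proof -
      have "D P2 = 2 * (D p oo fps_X ^ 2)" unfolding D_def P2 by (simp add: fps_X_deriv_dilate)
      then show ?thesis by (simp add: Dp fps_compose_uminus dilate_mult P2)
    qed
    have Du4: "D u4 = - 2 * u4 * (Lu oo fps_X ^ 2)"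
    proof -
      have "D u4 = 2 * (D u oo fps_X ^ 2)" unfolding D_def u4 by (simp add: fps_X_deriv_dilate)
      then show ?thesis by (simp add: Du fps_compose_uminus dilate_mult u4)
    qed
    have Y2: "Y oo fps_X ^ 2 = 1 + 4 * (Lp oo fps_X ^ 2) - 4 * (Lu oo fps_X ^ 2)"
      by (simp add: Y_def fps_compose_add_distrib fps_compose_sub_distrib dilate_mult numeral_fps_const)
    define A where "A = D (P2 ^ 2)"
    have A: "A = - 4 * P2 ^ 2 * (Lp oo fps_X ^ 2)"
      by (simp add: A_def D_power DP2) (simp add: eval_nat_numeral mult_ac)
    have DW: "D W = W * (1 - 4 * (Lu oo fps_X ^ 2))"
    proof -
      have "D 4 = 0" "D fps_X = fps_X" by (simp_all add: D_def)
      then show ?thesis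
        unfolding W_def by (simp add: D_mult D_power Du4) (simp add: eval_nat_numeral algebra_simps)
    qed
    have "D (p ^ 2) = A + D W" "D (m ^ 2) = A - D W"
      unfolding p2 m2 A_def by (simp_all add: D_def algebra_simps)
    moreover have "D (p ^ 2) = - 2 * p ^ 2 * Lp" "D (m ^ 2) = - 2 * m ^ 2 * Lm"
      by (simp_all add: D_power Dp Dm) (simp_all add: eval_nat_numeral mult_ac)
    ultimately have eqs: "2 * p ^ 2 * Lp = - (A + D W)" "2 * m ^ 2 * Lm = - (A - D W)"
      by (metis minus_minus mult_minus_left)+
    have "2 * (p ^ 2 * m ^ 2 * (Lm - Lp)) = p ^ 2 * (2 * m ^ 2 * Lm) - m ^ 2 * (2 * p ^ 2 * Lp)"
      by (simp add: algebra_simps)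
    also have "\<dots> = 2 * (P2 ^ 2 * W * (Y oo fps_X ^ 2))"
      unfolding eqs A DW Y2 unfolding p2 m2 by (simp add: algebra_simps)
    finally have "p ^ 2 * m ^ 2 * (Lm - Lp) = P2 ^ 2 * W * (Y oo fps_X ^ 2)" by simp
    moreover have "p ^ 2 * m ^ 2 = (m oo fps_X ^ 2) ^ 4"
    proof -
      have "p * m = (m oo fps_X ^ 2) ^ 2"
        using phi_mult[where 'a = 'a] by (simp add: p_def m_def theta_dilate)
      then have "(p * m) ^ 2 = ((m oo fps_X ^ 2) ^ 2) ^ 2" by simp
      then show ?thesis by (simp add: power_mult_distrib flip: power_mult)
    qed
    moreover have "P2 ^ 2 * W = 4 * fps_X * u ^ 4"
    proof -
      have "u ^ 4 = (P2 * u4) ^ 2" by (simp flip: u2 power_mult)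
      then show ?thesis by (simp add: W_def power_mult_distrib)
    qed
    ultimately have "4 * fps_X * ((m oo fps_X ^ 2) ^ 4 * E) = 4 * fps_X * (u ^ 4 * (Y oo fps_X ^ 2))"
      unfolding diff by (simp add: mult_ac)
    then show ?thesis by (simp del: mult.assoc)
  qed
  \<comment> \<open>This series equals \<open>E / u ^ 4\<close> and is unchanged by \<open>q \<mapsto> q^2\<close>.\<close>
  define R where "R = Y * inverse (m ^ 4)"
  have m4: "m ^ 4 * inverse (m ^ 4) = 1"
    by (intro inverse_mult_eq_1') (simp add: nth_0 fps_nth_power_0)
  have E1: "E = u ^ 4 * R"
  proof -
    have "E = (m ^ 4 * inverse (m ^ 4)) * E" using m4 by simp
    also have "\<dots> = inverse (m ^ 4) * (m ^ 4 * E)" by (simp only: mult_ac)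
    finally show ?thesis unfolding eq1 R_def by (simp only: mult_ac)
  qed
  have m42: "(m oo fps_X ^ 2) ^ 4 * (inverse (m ^ 4) oo fps_X ^ 2) = 1"
    using arg_cong[OF m4, of "\<lambda>f. f oo fps_X ^ 2"] by (simp add: dilate_mult dilate_power)
  have E2: "E = u ^ 4 * (R oo fps_X ^ 2)"
  proof -
    have "E = ((m oo fps_X ^ 2) ^ 4 * (inverse (m ^ 4) oo fps_X ^ 2)) * E" using m42 by simp
    also have "\<dots> = (inverse (m ^ 4) oo fps_X ^ 2) * ((m oo fps_X ^ 2) ^ 4 * E)" by (simp only: mult_ac)
    finally show ?thesis unfolding eq2 R_def by (simp add: dilate_mult mult_ac)
  qed
  have "u \<noteq> 0" using nth_0 by auto
  then have "R = R oo fps_X ^ 2" using E1 E2 by (metis mult_cancel_left power_not_zero)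
  then have "R = fps_const (R $ 0)" by (rule dilate_fixed_const[of 2, rotated]) simp
  moreover have "R $ 0 = 1"
    by (simp add: R_def Y_def Lp_def Lu_def log_series_def nth_0 fps_nth_power_0 numeral_fps_const)
  ultimately have "R = 1" by simp
  then have "E = u ^ 4" unfolding E1 by simp
  moreover have "u = theta 1 1 3 oo fps_X ^ 2" by (simp add: u_def theta_dilate)
  ultimately have "sigma_odd_series oo fps_X ^ 2 = (theta 1 1 3 ^ 4) oo (fps_X ^ 2 :: 'a fps)"
    by (simp add: E_def dilate_power)
  then show ?thesis by (rule dilate_inj[of 2, rotated]) simp
qed

section \<open>The quintic dissection of the theta function\<close>

text \<open>
  The factors belonging to \<open>z^i\<close> and \<open>z^(4i)\<close> are multiplied first; the two products are conjugate over the
  rationals by \<open>c \<mapsto> -1 - c\<close>, where \<open>c = z + z^4\<close> is a root of \<open>c^2 + c = 1\<close>.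
\<close>

lemma quintic_norm:
  fixes x u v z :: "'a :: comm_ring_1"
  assumes z: "1 + z + z ^ 2 + z ^ 3 + z ^ 4 = 0"
  shows "(\<Prod>i<5. x - z ^ i * u - z ^ (4 * i) * v)
     = x ^ 5 - 5 * x ^ 3 * (u * v) + 5 * x * (u * v) ^ 2 - u ^ 5 - v ^ 5"
proof -
  define c where "c = z + z ^ 4"
  have z5: "z ^ 5 = 1"
  proof -
    have "z ^ 5 - 1 = (z - 1) * (1 + z + z ^ 2 + z ^ 3 + z ^ 4)"
      by (simp add: algebra_simps eval_nat_numeral)
    then show ?thesis unfolding z by simp
  qed
  have zz: "z ^ (5 + k) = z ^ k" for k by (simp add: power_add z5)
  have z8: "z ^ 8 = z ^ 3" "z ^ 12 = z ^ 2" "z ^ 16 = z"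
    "z ^ 6 = z" "z ^ 7 = z ^ 2"
    using zz[of 3] zz[of 2] zz[of 7] zz[of 1] zz[of 6] zz[of 11] by simp_all
  have c': "z ^ 2 + z ^ 3 = - 1 - c"
    using z by (simp add: c_def algebra_simps eq_neg_iff_add_eq_0)
  have c2: "c ^ 2 = 1 - c"
  proof -
    have "c ^ 2 = z ^ 2 + 2 * z ^ 5 + z ^ 8"
      by (simp add: c_def power2_eq_square algebra_simps eval_nat_numeral)
    also have "\<dots> = 2 + (z ^ 2 + z ^ 3)" by (simp add: z5 z8)
    finally show ?thesis by (simp add: c')
  qed
  have pair1: "(x - z * u - z ^ 4 * v) * (x - z ^ 4 * u - z * v) = x ^ 2 - c * (u + v) * x + u ^ 2 + v ^ 2 + (- 1 - c) * (u * v)"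
  proof -
    have "(x - z * u - z ^ 4 * v) * (x - z ^ 4 * u - z * v)
        = x ^ 2 - (z + z ^ 4) * (u + v) * x + z ^ 5 * (u ^ 2 + v ^ 2) + (z ^ 2 + z ^ 8) * (u * v)"
      by (simp add: algebra_simps eval_nat_numeral)
    then show ?thesis unfolding z5 z8 c' by (simp add: c_def)
  qed
  have pair2: "(x - z ^ 2 * u - z ^ 3 * v) * (x - z ^ 3 * u - z ^ 2 * v) = x ^ 2 - (- 1 - c) * (u + v) * x + u ^ 2 + v ^ 2 + c * (u * v)"
  proof -
    have "(x - z ^ 2 * u - z ^ 3 * v) * (x - z ^ 3 * u - z ^ 2 * v)
        = x ^ 2 - (z ^ 2 + z ^ 3) * (u + v) * x + z ^ 5 * (u ^ 2 + v ^ 2) + (z ^ 4 + z ^ 6) * (u * v)"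
      by (simp add: algebra_simps eval_nat_numeral)
    then show ?thesis unfolding z5 z8 c' by (simp add: c_def add.commute)
  qed
  have "(\<Prod>i<5. x - z ^ i * u - z ^ (4 * i) * v)
      = (x - u - v) * ((x - z * u - z ^ 4 * v) * (x - z ^ 4 * u - z * v))
          * ((x - z ^ 2 * u - z ^ 3 * v) * (x - z ^ 3 * u - z ^ 2 * v))"
  proof -
    have "{..<5::nat} = {0, 1, 2, 3, 4}" by auto
    then show ?thesis by (simp add: z8 mult_ac)
  qed
  also have "\<dots> = (x - u - v) * ((x ^ 2 + u ^ 2 + v ^ 2 - u * v - c * ((u + v) * x + u * v))
      * (x ^ 2 + (u + v) * x + u ^ 2 + v ^ 2 + c * ((u + v) * x + u * v)))"
    unfolding pair1 pair2 by (simp add: algebra_simps)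
  also have "(x ^ 2 + u ^ 2 + v ^ 2 - u * v - c * ((u + v) * x + u * v))
      * (x ^ 2 + (u + v) * x + u ^ 2 + v ^ 2 + c * ((u + v) * x + u * v))
     = (x ^ 2 + u ^ 2 + v ^ 2 - u * v) * (x ^ 2 + (u + v) * x + u ^ 2 + v ^ 2)
        + c * ((u + v) * x + u * v) * (x ^ 2 + u ^ 2 + v ^ 2 - u * v - (x ^ 2 + (u + v) * x + u ^ 2 + v ^ 2))
        - c ^ 2 * ((u + v) * x + u * v) ^ 2"
    by (simp add: power2_eq_square algebra_simps)
  also have "\<dots> = (x ^ 2 + u ^ 2 + v ^ 2 - u * v) * (x ^ 2 + (u + v) * x + u ^ 2 + v ^ 2)
        - ((u + v) * x + u * v) ^ 2"
    unfolding c2 by (simp add: power2_eq_square algebra_simps)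
  also have "(x - u - v) * \<dots> = x ^ 5 - 5 * x ^ 3 * (u * v) + 5 * x * (u * v) ^ 2 - u ^ 5 - v ^ 5"
    by (simp add: algebra_simps eval_nat_numeral)
  finally show ?thesis .
qed

abbreviation twist :: "complex \<Rightarrow> complex fps \<Rightarrow> complex fps" where
  "twist c f \<equiv> f oo (fps_const c * fps_X)"

lemma has_log_deriv_twist:
  assumes "has_log_deriv f L"
  shows "has_log_deriv (twist c f) (twist c L)"
proof -
  have D: "(fps_X * fps_deriv g) $ n = of_nat n * g $ n" for g :: "complex fps" and n
    by (cases n) auto
  have "fps_X * fps_deriv (twist c f) = twist c (fps_X * fps_deriv f)"
    by (rule fps_ext) (simp add: D)
  also have "\<dots> = twist c f * twist c L"
    using assms by (simp add: has_log_deriv_def fps_compose_mult_distrib)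
  finally show ?thesis using assms by (simp add: has_log_deriv_def)
qed

text \<open>
  The divisors of \<open>5M\<close> are those of \<open>M\<close> together with \<open>5\<close> times those of \<open>M\<close>, and the overlap
  consists of \<open>5\<close> times the divisors of \<open>M/5\<close>.
\<close>

lemma sum_divisors_5:
  fixes e :: "nat \<Rightarrow> int"
  assumes e: "\<And>d. e (5 * d) = e d" and M: "M > 0"
  shows "(\<Sum>d | d dvd 5 * M. int d * e d) + 5 * (if 5 dvd M then \<Sum>d | d dvd M div 5. int d * e d else 0)
      = 6 * (\<Sum>d | d dvd M. int d * e d)"
proof -
  let ?D = "\<lambda>n. {d. d dvd n}" and ?s = "\<lambda>A. \<Sum>d\<in>A. int d * e d"
  have fin: "finite (?D n)" if "n > 0" for n :: nat using that by simp
  have im: "?s ((*) 5 ` A) = 5 * ?s A" for A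
  proof -
    have "?s ((*) 5 ` A) = (\<Sum>d\<in>A. int (5 * d) * e (5 * d))"
      by (subst sum.reindex) (auto simp: inj_on_def)
    then show ?thesis unfolding e by (simp add: sum_distrib_left mult.assoc)
  qed
  have un: "?D (5 * M) = ?D M \<union> (*) 5 ` ?D M"
  proof safe
    fix d assume d: "d dvd 5 * M" "d \<notin> (*) 5 ` ?D M"
    have "\<not> 5 dvd d" using d by (auto simp: image_iff elim!: dvdE[of 5 d])
    moreover have "prime (5 :: nat)" by simp
    ultimately have "coprime d 5" by (metis coprime_commute prime_imp_coprime)
    then show "d dvd M" using d(1) coprime_dvd_mult_right_iff by blast
  qed auto
  have int: "?D M \<inter> (*) 5 ` ?D M = (if 5 dvd M then (*) 5 ` ?D (M div 5) else {})"
  proof (cases "5 dvd M")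
    case True
    then obtain k where k: "M = 5 * k" by auto
    then show ?thesis by (auto simp: image_iff)
  qed (auto dest: dvd_mult_left)
  have "?s (?D (5 * M)) + ?s (?D M \<inter> (*) 5 ` ?D M) = ?s (?D M) + ?s ((*) 5 ` ?D M)"
    unfolding un using fin[OF M] by (intro sum.union_inter) auto
  then show ?thesis unfolding int by (auto simp: im)
qed

lemma primitive_fifth_root:
  obtains z :: complex where "1 + z + z ^ 2 + z ^ 3 + z ^ 4 = 0" "z ^ 5 = 1" "z \<noteq> 1"
proof -
  define z where "z = cis (2 * pi / 5)"
  have z5: "z ^ 5 = 1" by (simp add: z_def DeMoivre)
  have "z \<noteq> 1"
  proof
    assume "z = 1"
    then have "sin (2 * pi / 5) = 0" by (simp add: z_def complex_eq_iff)
    moreover have "sin (2 * pi / 5) > 0" by (intro sin_gt_zero) auto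
    ultimately show False by simp
  qed
  moreover have "(z - 1) * (1 + z + z ^ 2 + z ^ 3 + z ^ 4) = z ^ 5 - 1"
    by (simp add: algebra_simps eval_nat_numeral)
  ultimately have "1 + z + z ^ 2 + z ^ 3 + z ^ 4 = 0" using z5 by auto
  with z5 \<open>z \<noteq> 1\<close> show ?thesis using that by blast
qed

text \<open>
  Summing a logarithmic derivative over \<open>q \<mapsto> z^i q\<close> keeps five times the coefficients at multiples of
  \<open>5\<close>. For \<open>\<phi>(-q)\<close>, whose product exponents do not change under \<open>d \<mapsto> 5d\<close>,
  \<open>sum_divisors_5\<close> expresses them by the series in \<open>q^5\<close> and \<open>q^25\<close>.
\<close>

lemma phi_norm:
  assumes z: "1 + z + z ^ 2 + z ^ 3 + z ^ 4 = 0" "z ^ 5 = 1" "z \<noteq> (1 :: complex)"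
  shows "(\<Prod>i<5. twist (z ^ i) (theta (-1) 1 1)) * theta (-1) 25 25 = theta (-1) 5 5 ^ 6"
proof -
  define L where "L = (- log_series (\<lambda>d. of_int (triple_minus 1 1 d)) :: complex fps)"
  have phi: "has_log_deriv (theta (-1) 1 1) L"
    unfolding L_def by (intro euler_product_has_log_deriv euler_product_theta_minus) auto
  have phi5: "has_log_deriv (theta (-1) 5 5) (of_nat 5 * (L oo fps_X ^ 5))"
    using has_log_deriv_dilate[OF _ phi, of 5] by (simp add: theta_dilate)
  have phi25: "has_log_deriv (theta (-1) 25 25) (of_nat 25 * (L oo fps_X ^ 25))"
    using has_log_deriv_dilate[OF _ phi, of 25] by (simp add: theta_dilate)
  \<comment> \<open>Orthogonality of the fifth roots of unity.\<close>
  have filter: "(\<Sum>i<5. (z ^ i) ^ n) = (if 5 dvd n then 5 else 0)" for n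
  proof (cases "5 dvd n")
    case True
    then obtain k where "n = 5 * k" by auto
    then have "(z ^ i) ^ n = 1" for i
      by (metis mult.assoc mult.left_commute power_mult power_one z(2))
    then show ?thesis using True by simp
  next
    case False
    have "z ^ n = z ^ (n mod 5)"
      by (metis div_mult_mod_eq mult.commute mult_1 power_add power_mult power_one z(2))
    moreover have "n mod 5 \<in> {1, 2, 3, 4}" using False by (auto simp: dvd_eq_mod_eq_0)
    moreover have "z ^ r \<noteq> 1" if "r \<in> {1, 2, 3, 4}" for r
    proof
      assume r: "z ^ r = 1"
      have "z = z ^ 6" using z(2) by (simp add: eval_nat_numeral)
      moreover have "z ^ 16 = z"
        using z(2) by (simp add: eval_nat_numeral)
      ultimately have "z = 1"
        using that r z(2) 
        by (auto simp: eval_nat_numeral)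
      then show False using z(3) by simp
    qed
    ultimately have "z ^ n \<noteq> 1" by auto
    moreover have "(z ^ n - 1) * (\<Sum>i<5. (z ^ n) ^ i) = (z ^ n) ^ 5 - 1"
      by (simp add: power_diff_1_eq)
    moreover have "(z ^ n) ^ 5 = 1" by (metis mult.commute power_mult power_one z(2))
    ultimately have "(\<Sum>i<5. (z ^ n) ^ i) = 0" by simp
    moreover have "(z ^ i) ^ n = (z ^ n) ^ i" for i by (simp flip: power_mult add: mult.commute)
    ultimately show ?thesis using False by simp
  qed
  have "(\<Sum>i<5. twist (z ^ i) L) + of_nat 25 * (L oo fps_X ^ 25) = of_nat 6 * (of_nat 5 * (L oo fps_X ^ 5))"
  proof (rule fps_ext)
    fix n
    define s where "s k = (\<Sum>d | d dvd k. int d * triple_minus 1 1 d)" for k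
    have L: "L $ k = (if k = 0 then 0 else - of_int (s k))" for k
      by (simp add: L_def log_series_def s_def)
    have lhs: "((\<Sum>i<5. twist (z ^ i) L) + of_nat 25 * (L oo fps_X ^ 25)) $ n
        = (if 5 dvd n then 5 * L $ n else 0) + 25 * (if 25 dvd n then L $ (n div 25) else 0)"
      by (simp add: fps_sum_nth sum_distrib_right[symmetric] filter fps_nth_compose_X_power
          fps_of_nat[symmetric] numeral_fps_const del: fps_of_nat)
    have rhs: "(of_nat 6 * (of_nat 5 * (L oo fps_X ^ 5))) $ n = 30 * (if 5 dvd n then L $ (n div 5) else 0)"
      by (simp add: fps_nth_compose_X_power fps_of_nat[symmetric] numeral_fps_const del: fps_of_nat)
    show "((\<Sum>i<5. twist (z ^ i) L) + of_nat 25 * (L oo fps_X ^ 25)) $ n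
        = (of_nat 6 * (of_nat 5 * (L oo fps_X ^ 5))) $ n"
    proof (cases "5 dvd n")
      case True
      then obtain k where k: "n = 5 * k" by auto
      show ?thesis
      proof (cases "k = 0")
        case False
        have "triple_minus 1 1 (5 * d) = triple_minus 1 1 d" for d
          unfolding triple_minus_def one_add_one by simp
        then have eq: "s (5 * k) + 5 * (if 5 dvd k then s (k div 5) else 0) = 6 * s k"
          using False unfolding s_def by (intro sum_divisors_5) auto
        have s5: "of_int (s (5 * k)) = 6 * of_int (s k) - (5 * (if 5 dvd k then of_int (s (k div 5)) else 0) :: complex)"
          using arg_cong[OF eq, of "of_int :: int \<Rightarrow> complex"] by (cases "5 dvd k") (simp_all add: eq_diff_eq)
        have "25 dvd 5 * k \<longleftrightarrow> 5 dvd k" "5 * k div 25 = k div 5"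
          using nat_mult_dvd_cancel1[of 5 5 k] div_mult_mult1[of 5 k 5] by simp_all
        moreover have "5 * k div 5 = k" "5 dvd 5 * k" by simp_all
        moreover have "k div 5 \<noteq> 0" if "5 dvd k" using that False by auto
        ultimately show ?thesis unfolding lhs rhs unfolding k unfolding L s5 using False
          by (cases "5 dvd k") (auto simp: s5)
      next
        case True
        then show ?thesis unfolding lhs rhs by (simp add: k L)
      qed
    next
      case False
      then have "\<not> 25 dvd n" using dvd_trans[of 5 25 n] by auto
      then show ?thesis unfolding lhs rhs using False by simp
    qed
  qed
  moreover have "has_log_deriv (\<Prod>i<5. twist (z ^ i) (theta (-1) 1 1)) (\<Sum>i<5. twist (z ^ i) L)"
    by (intro has_log_deriv_prod has_log_deriv_twist phi)
  ultimately have "has_log_deriv ((\<Prod>i<5. twist (z ^ i) (theta (-1) 1 1)) * theta (-1) 25 25)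
      (of_nat 6 * (of_nat 5 * (L oo fps_X ^ 5)))"
    using has_log_deriv_mult[OF _ phi25] by metis
  then show ?thesis
    by (rule has_log_deriv_unique) (rule has_log_deriv_power[OF phi5])
qed

text \<open>
  The squares of \<open>5n\<close>, \<open>5n \<plusminus> 1\<close> and \<open>5n \<plusminus> 2\<close> lie in the residue classes \<open>0\<close>, \<open>1\<close> and
  \<open>4\<close> modulo \<open>5\<close>.
\<close>

lemma phi_dissection:
  "theta (-1) 1 1 = theta (-1) 25 25 - 2 * (fps_X * theta (-1) 35 15) + 2 * (fps_X ^ 4 * theta (-1) 45 5 :: 'a :: field_char_0 fps)"
proof -
  define S :: "int \<Rightarrow> 'a fps" where
    "S j = formal_sum UNIV (\<lambda>n. theta_exp 1 1 (5 * n + j)) (\<lambda>n. (-1) powi (5 * n + j))" for j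
  have "bij_betw (\<lambda>(j, n :: int). 5 * n + j) ({-2..2} \<times> UNIV) UNIV"
  proof (rule bij_betw_familyI[where J = cmod5 and P = "\<lambda>n. (n - cmod5 n) div 5"])
    show "cmod5 (5 * n + j) = j \<and> (5 * n + j - cmod5 (5 * n + j)) div 5 = n" if "j \<in> {-2..2}" for j n
      using cmod5_eq[OF that] by simp
    show "cmod5 n \<in> {-2..2} \<and> 5 * ((n - cmod5 n) div 5) + cmod5 n = n" for n
      using cmod5[of n] by simp
  qed
  then have "theta (-1) 1 1 = (\<Sum>j\<in>{-2..2}. S j)"
    unfolding theta_def S_def by (intro formal_sum_split) auto
  moreover have S: "S j = fps_const c * (fps_X ^ k * theta (-1) a b)"
    if "\<And>n. theta_exp 1 1 (5 * n + j) = theta_exp a b n + k"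
      "\<And>n. (-1) powi (5 * n + j) = c * (-1) powi n" for j c k a b
    unfolding S_def theta_def formal_sum_shift formal_sum_const_mult using that by simp
  moreover have "S 0 = fps_const 1 * (fps_X ^ 0 * theta (-1) 25 25)"
  proof (rule S)
    show "theta_exp 1 1 (5 * n + 0) = theta_exp 25 25 n + 0" for n
      using int_theta_exp[of 1 1 "5 * n + 0"] int_theta_exp[of 25 25 n] by (simp add: algebra_simps)
  qed (simp add: minus_one_powi)
  moreover have "S 1 = fps_const (-1) * (fps_X ^ 1 * theta (-1) 35 15)"
  proof (rule S)
    show "theta_exp 1 1 (5 * n + 1) = theta_exp 35 15 n + 1" for n
      using int_theta_exp[of 1 1 "5 * n + 1"] int_theta_exp[of 35 15 n] by (simp add: algebra_simps)
  qed (simp add: minus_one_powi)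
  moreover have "S (-1) = fps_const (-1) * (fps_X ^ 1 * theta (-1) 15 35)"
  proof (rule S)
    show "theta_exp 1 1 (5 * n + -1) = theta_exp 15 35 n + 1" for n
      using int_theta_exp[of 1 1 "5 * n + -1"] int_theta_exp[of 15 35 n] by (simp add: algebra_simps)
  qed (simp add: minus_one_powi)
  moreover have "S 2 = fps_const 1 * (fps_X ^ 4 * theta (-1) 45 5)"
  proof (rule S)
    show "theta_exp 1 1 (5 * n + 2) = theta_exp 45 5 n + 4" for n
      using int_theta_exp[of 1 1 "5 * n + 2"] int_theta_exp[of 45 5 n] by (simp add: algebra_simps)
  qed (simp add: minus_one_powi)
  moreover have "S (-2) = fps_const 1 * (fps_X ^ 4 * theta (-1) 5 45)"
  proof (rule S)
    show "theta_exp 1 1 (5 * n + -2) = theta_exp 5 45 n + 4" for n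
      using int_theta_exp[of 1 1 "5 * n + -2"] int_theta_exp[of 5 45 n] by (simp add: algebra_simps)
  qed (simp add: minus_one_powi)
  ultimately show ?thesis
    unfolding sum_minus2_to_2
    by (simp add: theta_sym[of "-1" 15 35] theta_sym[of "-1" 5 45]
        fps_const_neg[symmetric] algebra_simps del: fps_const_neg One_nat_def)
qed

text \<open>
  Replacing \<open>q\<close> by \<open>z^i q\<close> multiplies the components \<open>a\<close> and \<open>b\<close> by \<open>z^i\<close> and
  \<open>z^(4i)\<close>. The last relation compares the norm form \<open>quintic_norm\<close> of the dissected series with
  its value from \<open>phi_norm\<close>.
\<close>

lemma phi_quintic_relation:
  fixes a b P :: "complex fps"
  defines "a \<equiv> fps_X * theta (-1) 35 15" and "b \<equiv> fps_X ^ 4 * theta (-1) 45 5" and "P \<equiv> theta (-1) 25 25"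
  shows "theta (-1) 1 1 = P - 2 * a + 2 * b"
    and "theta (-1) 5 5 ^ 2 = P ^ 2 - 4 * (a * b)"
    and "P * (a ^ 5 - b ^ 5) = P ^ 4 * (a * b) + P ^ 2 * (a * b) ^ 2 + 2 * (a * b) ^ 3"
proof -
  show phi: "theta (-1) 1 1 = P - 2 * a + 2 * b"
    using phi_dissection by (simp add: a_def b_def P_def)
  show phi5: "theta (-1) 5 5 ^ 2 = P ^ 2 - 4 * (a * b)"
  proof -
    have "(theta (-1) 1 1 ^ 2) oo fps_X ^ 5
        = (theta (-1) 5 5 ^ 2 - 4 * fps_X * (theta (-1) 7 3 * theta (-1) 9 1)) oo (fps_X ^ 5 :: complex fps)"
      by (simp only: phi_sq_quintic)
    then have "theta (-1) 5 5 ^ 2 = P ^ 2 - 4 * (fps_X ^ 5 * (theta (-1) 35 15 * theta (-1) 45 5 :: complex fps))"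
      by (simp add: dilate_mult dilate_power fps_compose_sub_distrib theta_dilate P_def numeral_fps_const mult.assoc)
    also have "fps_X ^ 5 * (theta (-1) 35 15 * theta (-1) 45 5 :: complex fps) = a * b"
      by (simp add: a_def b_def eval_nat_numeral mult_ac)
    finally show ?thesis .
  qed
  obtain z :: complex where z: "1 + z + z ^ 2 + z ^ 3 + z ^ 4 = 0" "z ^ 5 = 1" "z \<noteq> 1"
    by (rule primitive_fifth_root)
  define w where "w = fps_const z"
  have w: "1 + w + w ^ 2 + w ^ 3 + w ^ 4 = 0"
    using z(1) by (simp add: w_def fps_const_power flip: fps_const_1_eq_1)
  have twist_dil: "twist (z ^ i) (fps_X ^ r * (f oo fps_X ^ 5)) = w ^ (r * i) * (fps_X ^ r * (f oo fps_X ^ 5))" for i r f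
  proof (rule fps_ext)
    fix n
    have "(z ^ i) ^ n = z ^ (r * i)" if "5 dvd n - r" "r \<le> n"
    proof -
      from that obtain k where k: "n = r + 5 * k" by (metis dvdE le_add_diff_inverse)
      have "(z ^ i) ^ n = z ^ (r * i) * (z ^ 5) ^ (i * k)"
        by (simp add: k power_add algebra_simps flip: power_mult)
      then show ?thesis using z(2) by simp
    qed
    then show "twist (z ^ i) (fps_X ^ r * (f oo fps_X ^ 5)) $ n = (w ^ (r * i) * (fps_X ^ r * (f oo fps_X ^ 5))) $ n"
      by (auto simp: w_def fps_const_power fps_X_power_mult_nth fps_nth_compose_X_power)
  qed
  have tw: "twist (z ^ i) (theta (-1) 1 1) = P - w ^ i * (2 * a) - w ^ (4 * i) * (- (2 * b))" for i
  proof -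
    have "P = fps_X ^ 0 * (theta (-1) 5 5 oo fps_X ^ 5)" "a = fps_X ^ 1 * (theta (-1) 7 3 oo fps_X ^ 5)"
      "b = fps_X ^ 4 * (theta (-1) 9 1 oo fps_X ^ 5)"
      by (simp_all add: P_def a_def b_def theta_dilate)
    then have "twist (z ^ i) P = P" "twist (z ^ i) a = w ^ i * a" "twist (z ^ i) b = w ^ (4 * i) * b"
      using twist_dil[where i = i and r = 0] twist_dil[where i = i and r = 1] twist_dil[where i = i and r = 4]
      by simp_all
    then show ?thesis
      unfolding phi by (simp add: fps_compose_sub_distrib fps_compose_add_distrib fps_compose_mult_distrib
          numeral_fps_const algebra_simps)
  qed
  have "(\<Prod>i<5. P - w ^ i * (2 * a) - w ^ (4 * i) * (- (2 * b))) * P = (theta (-1) 5 5 ^ 2) ^ 3"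
    using phi_norm[OF z] unfolding tw by (simp add: P_def flip: power_mult)
  then have "(P ^ 5 - 5 * P ^ 3 * (2 * a * (- (2 * b))) + 5 * P * (2 * a * (- (2 * b))) ^ 2 - (2 * a) ^ 5 - (- (2 * b)) ^ 5) * P
      = (P ^ 2 - 4 * (a * b)) ^ 3"
    unfolding quintic_norm[OF w] phi5 .
  then have "32 * (P * (a ^ 5 - b ^ 5)) = 32 * (P ^ 4 * (a * b) + P ^ 2 * (a * b) ^ 2 + 2 * (a * b) ^ 3)"
    by (simp add: algebra_simps eval_nat_numeral)
  then show "P * (a ^ 5 - b ^ 5) = P ^ 4 * (a * b) + P ^ 2 * (a * b) ^ 2 + 2 * (a * b) ^ 3"
    by (rule mult_left_cancel[THEN iffD1, rotated]) simp
qed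

section \<open>Modular functions of level ten\<close>

definition phi :: "complex fps" where "phi = theta (-1) 1 1"
definition phi5 :: "complex fps" where "phi5 = theta (-1) 5 5"
definition sig :: "complex fps" where "sig = sigma_odd_series"

text \<open>
  In terms of \<open>f_k = \<Prod>(1 - q^(kn))\<close> with \<open>n\<close> running over the positive integers one has
  \<open>t = q f_2 f_10^3/(f_1^3 f_5)\<close>, a generator of the
  modular functions on \<open>\<Gamma>_0(10)\<close>, and \<open>1 + 4t = phi5^2/phi^2\<close>, \<open>s = t/(1 + 4t)\<close>.
\<close>

definition s_fun :: "complex fps" where
  "s_fun = fps_X * (theta (-1) 7 3 * theta (-1) 9 1) * inverse (phi5 ^ 2)"
definition t_fun :: "complex fps" where
  "t_fun = s_fun * (phi5 ^ 2 * inverse (phi ^ 2))"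

lemma theta_nth_0: "a > 0 \<Longrightarrow> b > 0 \<Longrightarrow> theta (-1) a b $ 0 = (1 :: complex)"
  using euler_product_theta_minus[of a b, where 'a = complex] by (simp add: euler_product_def)

lemma phi_nth_0 [simp]: "phi $ 0 = 1" "phi5 $ 0 = 1"
  by (simp_all add: phi_def phi5_def theta_nth_0 del: One_nat_def)

lemma phi_nonzero [simp]: "phi \<noteq> 0" "phi5 \<noteq> 0"
  using phi_nth_0 by (metis fps_zero_nth zero_neq_one)+

lemma phi_inverse: "phi ^ n * inverse (phi ^ n) = 1" "phi5 ^ n * inverse (phi5 ^ n) = 1"
  by (simp_all add: inverse_mult_eq_1' fps_nth_power_0)

lemma s_fun_nth_0 [simp]: "s_fun $ 0 = 0"
  by (simp add: s_fun_def)

lemma t_fun_nth_0 [simp]: "t_fun $ 0 = 0"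
  by (simp add: t_fun_def)

lemma phi_sq: "phi ^ 2 = phi5 ^ 2 * (1 - 4 * s_fun)"
proof -
  have "phi5 ^ 2 * (1 - 4 * s_fun)
      = phi5 ^ 2 - 4 * fps_X * (theta (-1) 7 3 * theta (-1) 9 1) * (phi5 ^ 2 * inverse (phi5 ^ 2))"
    by (simp add: s_fun_def algebra_simps)
  also have "\<dots> = phi5 ^ 2 - 4 * fps_X * (theta (-1) 7 3 * theta (-1) 9 1)"
    by (simp add: phi_inverse)
  also have "\<dots> = phi ^ 2"
    using phi_sq_quintic[where 'a = complex] by (simp add: phi_def phi5_def)
  finally show ?thesis ..
qed

lemma t_s_relation: "(1 + 4 * t_fun) * (1 - 4 * s_fun) = 1" "t_fun = s_fun * (1 + 4 * t_fun)"
  "phi5 ^ 2 = phi ^ 2 * (1 + 4 * t_fun)"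
proof -
  define u where "u = phi5 ^ 2 * inverse (phi ^ 2)"
  have "u * (1 - 4 * s_fun) = phi ^ 2 * inverse (phi ^ 2)"
    unfolding phi_sq u_def by (simp only: mult_ac)
  then have u: "u * (1 - 4 * s_fun) = 1" by (simp add: phi_inverse)
  then have "u = 1 + 4 * (s_fun * u)" by (simp add: algebra_simps)
  then have e: "u = 1 + 4 * t_fun" by (simp add: t_fun_def u_def)
  show "(1 + 4 * t_fun) * (1 - 4 * s_fun) = 1" using u e by simp
  show "t_fun = s_fun * (1 + 4 * t_fun)" using e by (simp add: t_fun_def u_def)
  have "phi ^ 2 * u = phi5 ^ 2 * (phi ^ 2 * inverse (phi ^ 2))" by (simp only: u_def mult_ac)
  then show "phi5 ^ 2 = phi ^ 2 * (1 + 4 * t_fun)" using e by (simp add: phi_inverse)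
qed

lemma one_plus_s: "(1 + s_fun) * (1 + 4 * t_fun) = 1 + 5 * t_fun"
proof -
  have "(1 + s_fun) * (1 + 4 * t_fun) = 1 + 4 * t_fun + s_fun * (1 + 4 * t_fun)"
    by (simp add: algebra_simps)
  also have "s_fun * (1 + 4 * t_fun) = t_fun" using t_s_relation(2) by simp
  finally show ?thesis by simp
qed

text \<open>
  With \<open>C\<close> the product of the two theta functions in \<open>psi_sq_quintic\<close>, that identity reads
  \<open>\<psi>(q)^2 = q \<psi>(q^5)^2 + C\<close>, and \<open>theta_quintic_mult\<close> says \<open>s C = q \<psi>(q^5)^2\<close>. Hence
  \<open>t \<psi>(q)^2 = q \<psi>(q^5)^2 (1 + 5t)\<close>, whose square is the claim.
\<close>

lemma sig_quintic: "sig * t_fun ^ 2 = fps_X ^ 2 * (sig oo fps_X ^ 5) * (1 + 5 * t_fun) ^ 2"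
proof -
  define psi psi5 C where "psi = (theta 1 1 3 :: complex fps)" and "psi5 = (theta 1 5 15 :: complex fps)"
    and "C = (theta 1 1 4 * theta 1 2 3 :: complex fps)"
  have sig: "sig = psi ^ 4" "sig oo fps_X ^ 5 = psi5 ^ 4"
    by (simp_all add: sig_def psi_def psi5_def sigma_odd_series_eq dilate_power theta_dilate)
  have "theta 1 5 0 = (theta 1 1 0 oo fps_X ^ 5 :: complex fps)" by (simp add: theta_dilate)
  also have "\<dots> = (2 * theta 1 1 3) oo fps_X ^ 5" by (simp only: theta_1_1_0)
  also have "\<dots> = 2 * psi5"
    by (simp add: dilate_mult psi5_def theta_dilate numeral_fps_const)
  finally have "(2 * psi) ^ 2 = fps_X * (2 * psi5) ^ 2 + 4 * C"
    using psi_sq_quintic[where 'a = complex] unfolding theta_1_1_0 by (simp add: psi_def C_def)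
  then have "4 * psi ^ 2 = 4 * (fps_X * psi5 ^ 2 + C)"
    by (simp add: power_mult_distrib algebra_simps)
  then have psi: "psi ^ 2 = fps_X * psi5 ^ 2 + C"
    by (rule mult_left_cancel[THEN iffD1, rotated]) simp
  have "s_fun * C = fps_X * (theta (-1) 7 3 * theta (-1) 9 1 * C) * inverse (phi5 ^ 2)"
    by (simp add: s_fun_def mult_ac)
  also have "theta (-1) 7 3 * theta (-1) 9 1 * C = (psi5 * phi5) ^ 2"
    using theta_quintic_mult[where 'a = complex] by (simp add: C_def psi5_def phi5_def)
  also have "fps_X * (psi5 * phi5) ^ 2 * inverse (phi5 ^ 2) = fps_X * psi5 ^ 2 * (phi5 ^ 2 * inverse (phi5 ^ 2))"
    by (simp add: power_mult_distrib mult_ac)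
  finally have sC: "s_fun * C = fps_X * psi5 ^ 2" by (simp add: phi_inverse)
  have "s_fun * psi ^ 2 = fps_X * psi5 ^ 2 * s_fun + s_fun * C"
    unfolding psi by (simp add: algebra_simps)
  then have "s_fun * psi ^ 2 = fps_X * psi5 ^ 2 * (1 + s_fun)"
    unfolding sC by (simp add: algebra_simps)
  then have "(s_fun * (1 + 4 * t_fun)) * psi ^ 2 = fps_X * psi5 ^ 2 * ((1 + s_fun) * (1 + 4 * t_fun))"
    by (simp add: mult_ac)
  then have "t_fun * psi ^ 2 = fps_X * psi5 ^ 2 * (1 + 5 * t_fun)"
    unfolding one_plus_s t_s_relation(2)[symmetric] .
  then have "(t_fun * psi ^ 2) ^ 2 = (fps_X * psi5 ^ 2 * (1 + 5 * t_fun)) ^ 2" by simp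
  then show ?thesis unfolding sig(2) unfolding sig(1)
    by (simp add: power_mult_distrib mult_ac flip: power_mult)
qed

section \<open>Residue classes of exponents modulo five\<close>

definition in_class :: "nat \<Rightarrow> complex fps \<Rightarrow> bool" where
  "in_class r f \<longleftrightarrow> (\<forall>n. f $ n \<noteq> 0 \<longrightarrow> n mod 5 = r)"

lemma in_class_mult: "in_class r f \<Longrightarrow> in_class s g \<Longrightarrow> (r + s) mod 5 = u \<Longrightarrow> in_class u (f * g)"
  unfolding in_class_def
proof (intro allI impI)
  fix n
  assume f: "\<forall>n. f $ n \<noteq> 0 \<longrightarrow> n mod 5 = r" and g: "\<forall>n. g $ n \<noteq> 0 \<longrightarrow> n mod 5 = s"
    and u: "(r + s) mod 5 = u" and n: "(f * g) $ n \<noteq> 0"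
  then obtain i where i: "i \<le> n" "f $ i \<noteq> 0" "g $ (n - i) \<noteq> 0"
    by (auto simp: fps_mult_nth elim!: sum.not_neutral_contains_not_neutral)
  then have "(i + (n - i)) mod 5 = (r + s) mod 5" using f g by (metis mod_add_eq)
  then show "n mod 5 = u" using u i by simp
qed

lemma in_class_add: "in_class r f \<Longrightarrow> in_class r g \<Longrightarrow> in_class r (f + g)"
  "in_class r f \<Longrightarrow> in_class r g \<Longrightarrow> in_class r (f - g)"
  "in_class r f \<Longrightarrow> in_class r (- f)"
  unfolding in_class_def by (auto, metis add.left_neutral, metis diff_self)

lemma in_class_dilate: "in_class 0 (f oo fps_X ^ 5)"
  by (auto simp: in_class_def fps_nth_compose_X_power split: if_splits)

lemma in_class_numeral: "in_class 0 (numeral n)"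
  by (auto simp: in_class_def fps_numeral_nth split: if_splits)

lemma in_class_X_power: "in_class (r mod 5) (fps_X ^ r)"
  by (auto simp: in_class_def split: if_splits)

lemma dissect_in_class: "in_class r f \<Longrightarrow> s < 5 \<Longrightarrow> s \<noteq> r \<Longrightarrow> dissect 5 s f = 0"
  by (auto simp: in_class_def fps_eq_iff)

text \<open>
  The normalised components of \<open>phi\<close>: \<open>x5\<close> is \<open>\<phi>(-q)/\<phi>(-q^25)\<close>, \<open>S5 = a5 b5\<close> is
  \<open>s\<close> at \<open>q^5\<close>, and \<open>D5\<close> turns out to be \<open>t x5^2\<close>. The sum \<open>N0 + N2 + N3\<close>, written as
  its parts in the classes \<open>0\<close>, \<open>2\<close>, \<open>3\<close> modulo \<open>5\<close>, is the form \<open>f0\<close> below up to a power of \<open>q\<close> and a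
  series in \<open>q^5\<close>; its missing classes are what makes coefficients of \<open>f0\<close> vanish.
\<close>

definition a5 :: "complex fps" where "a5 = fps_X * theta (-1) 35 15 * inverse (phi5 oo fps_X ^ 5)"
definition b5 :: "complex fps" where "b5 = fps_X ^ 4 * theta (-1) 45 5 * inverse (phi5 oo fps_X ^ 5)"
definition S5 :: "complex fps" where "S5 = a5 * b5"
definition x5 :: "complex fps" where "x5 = 1 - 2 * a5 + 2 * b5"
definition D5 :: "complex fps" where "D5 = a5 - b5 - a5 ^ 2 - b5 ^ 2 + S5"
definition N0 :: "complex fps" where "N0 = - (S5 + S5 ^ 2)"
definition N2 :: "complex fps" where "N2 = - (S5 * a5 ^ 2) - b5 ^ 3"
definition N3 :: "complex fps" where "N3 = a5 ^ 3 - S5 * b5 ^ 2"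

lemma dissection_basic:
  shows "phi = (phi5 oo fps_X ^ 5) * x5" and "phi5 ^ 2 = (phi5 oo fps_X ^ 5) ^ 2 * (1 - 4 * S5)"
    and "a5 ^ 5 - b5 ^ 5 = S5 + S5 ^ 2 + 2 * S5 ^ 3" and "S5 = s_fun oo fps_X ^ 5"
proof -
  define P where "P = phi5 oo fps_X ^ 5"
  define i where "i = inverse P"
  have P: "P = theta (-1) 25 25" by (simp add: P_def phi5_def theta_dilate)
  have i: "P * i = 1" unfolding i_def P by (intro inverse_mult_eq_1') (simp add: theta_nth_0)
  define a b where "a = fps_X * (theta (-1) 35 15 :: complex fps)" and "b = fps_X ^ 4 * (theta (-1) 45 5 :: complex fps)"
  have ab: "a5 = a * i" "b5 = b * i" by (simp_all add: a5_def b5_def a_def b_def i_def P_def)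
  have aP: "a = P * a5" "b = P * b5"
    using i by (simp_all add: ab mult.left_commute)
  have rel: "phi = P - 2 * a + 2 * b" "phi5 ^ 2 = P ^ 2 - 4 * (a * b)"
    "P * (a ^ 5 - b ^ 5) = P ^ 4 * (a * b) + P ^ 2 * (a * b) ^ 2 + 2 * (a * b) ^ 3"
    using phi_quintic_relation by (simp_all add: phi_def phi5_def P a_def b_def)
  show "phi = P * x5" unfolding rel(1) aP x5_def by (simp add: algebra_simps)
  show "phi5 ^ 2 = P ^ 2 * (1 - 4 * S5)" unfolding rel(2) aP S5_def
    by (simp add: algebra_simps eval_nat_numeral)
  have "P ^ 6 * (a5 ^ 5 - b5 ^ 5) = P ^ 6 * (S5 + S5 ^ 2 + 2 * S5 ^ 3)"
    using rel(3) unfolding aP S5_def by (simp add: algebra_simps eval_nat_numeral)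
  moreover have "P \<noteq> 0" using i by auto
  ultimately show "a5 ^ 5 - b5 ^ 5 = S5 + S5 ^ 2 + 2 * S5 ^ 3" by simp
  have "inverse (phi5 ^ 2) oo fps_X ^ 5 = i ^ 2"
    by (simp add: i_def P_def fps_inverse_compose dilate_power fps_inverse_power)
  then have "s_fun oo fps_X ^ 5 = fps_X ^ 5 * (theta (-1) 35 15 * theta (-1) 45 5) * i ^ 2"
    by (simp add: s_fun_def dilate_mult theta_dilate)
  also have "\<dots> = S5" by (simp add: S5_def ab a_def b_def eval_nat_numeral mult_ac)
  finally show "S5 = s_fun oo fps_X ^ 5" ..
qed

lemma dissection_classes:
  "in_class 1 a5" "in_class 4 b5" "in_class 0 S5" "in_class 0 N0" "in_class 2 N2" "in_class 3 N3"
proof -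
  have inv: "inverse (phi5 oo fps_X ^ 5) = inverse phi5 oo fps_X ^ 5"
    by (simp add: fps_inverse_compose)
  have "theta (-1) 35 15 = theta (-1) 7 3 oo (fps_X ^ 5 :: complex fps)"
    "theta (-1) 45 5 = theta (-1) 9 1 oo (fps_X ^ 5 :: complex fps)"
    by (simp_all add: theta_dilate)
  then show a: "in_class 1 a5" and b: "in_class 4 b5"
    unfolding a5_def b5_def inv
    using in_class_mult[OF in_class_mult[OF in_class_X_power[of 1] in_class_dilate refl] in_class_dilate refl]
      in_class_mult[OF in_class_mult[OF in_class_X_power[of 4] in_class_dilate refl] in_class_dilate refl]
    by simp_all
  show S: "in_class 0 S5" unfolding S5_def by (rule in_class_mult[OF a b]) simp
  show "in_class 0 N0" unfolding N0_def power2_eq_square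
    by (intro in_class_add S in_class_mult[OF S S]) simp
  have a2: "in_class 2 (a5 ^ 2)" and b2: "in_class 3 (b5 ^ 2)" unfolding power2_eq_square
    by (rule in_class_mult[OF a a] in_class_mult[OF b b]; simp)+
  have a3: "in_class 3 (a5 ^ 3)" and b3: "in_class 2 (b5 ^ 3)" unfolding power3_eq_cube power2_eq_square[symmetric]
    by (rule in_class_mult[OF a2 a] in_class_mult[OF b2 b]; simp)+
  show "in_class 2 N2" unfolding N2_def by (intro in_class_add b3 in_class_mult[OF S a2]) simp
  show "in_class 3 N3" unfolding N3_def by (intro in_class_add a3 in_class_mult[OF S b2]) simp
qed

text \<open>
  As polynomials in \<open>a5\<close> and \<open>b5\<close> the two sides differ by a multiple of the relation for
  \<open>a5^5 - b5^5\<close>. The cofactor is found by polynomial division.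
\<close>

lemma key_identity: "x5 * (S5 * (1 + S5) ^ 3) = D5 ^ 2 * (N0 + N2 + N3)"
proof -
  have "x5 * (S5 * (1 + S5) ^ 3) - D5 ^ 2 * (N0 + N2 + N3)
      = (a5 ^ 2 * b5 - a5 ^ 2 - a5 * b5 ^ 2 + 2 * a5 - b5 ^ 2 - 2 * b5 - 1)
          * (a5 ^ 5 - b5 ^ 5 - (S5 + S5 ^ 2 + 2 * S5 ^ 3))"
    unfolding x5_def D5_def N0_def N2_def N3_def S5_def
    by (simp add: algebra_simps eval_nat_numeral)
  then show ?thesis unfolding dissection_basic(3) by simp
qed

text \<open>
  All products are sorted by residue classes, and in class \<open>0\<close> the series \<open>a5\<close> and \<open>b5\<close> only enter through
  \<open>S5\<close> and \<open>a5^5 - b5^5\<close>, which are polynomials in \<open>s\<close> at \<open>q^5\<close>.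
\<close>

lemma sections_NN:
  "dissect 5 0 (N0 + N2 + N3) = - (s_fun * (1 + s_fun))"
  "dissect 5 1 (N0 + N2 + N3) = 0" "dissect 5 4 (N0 + N2 + N3) = 0"
  "dissect 5 0 ((N0 + N2 + N3) * x5) = - (s_fun * (1 + s_fun))"
  "dissect 5 0 ((N0 + N2 + N3) * D5) = - (s_fun * (1 + s_fun) ^ 2)"
  "dissect 5 0 ((N0 + N2 + N3) * D5 * x5) = - (s_fun * (1 + s_fun) ^ 2 * (3 + 4 * s_fun))"
proof -
  note cl = dissection_classes
  have S5: "S5 = s_fun oo fps_X ^ 5" by (rule dissection_basic)
  have dil: "dissect 5 0 (f oo fps_X ^ 5) = f" for f :: "complex fps"
    using dissect_shift_dilate_mult[of 0 5 0 f] by simp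
  note sec0 = dissect_in_class[where s = 0, simplified]
  have 0: "dissect 5 0 N0 = - (s_fun * (1 + s_fun))"
  proof -
    have "N0 = (- (s_fun * (1 + s_fun))) oo fps_X ^ 5"
      by (simp add: N0_def S5 dilate_mult fps_compose_uminus fps_compose_add_distrib fps_compose_sub_distrib
          algebra_simps power2_eq_square)
    then show ?thesis by (rule ssubst) (rule dil)
  qed
  then show "dissect 5 0 (N0 + N2 + N3) = - (s_fun * (1 + s_fun))"
    using sec0[OF cl(5)] sec0[OF cl(6)] by (simp add: dissect_linear)
  show "dissect 5 1 (N0 + N2 + N3) = 0" "dissect 5 4 (N0 + N2 + N3) = 0"
    using cl(4-6) by (simp_all add: dissect_linear dissect_in_class)
  \<comment> \<open>The index of each of these parts of \<open>(N0 + N2 + N3) * D5\<close> is its residue class.\<close>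
  define d0 d1 d4 d2 d3 where "d0 = S5 * N0 - a5 ^ 2 * N3 - b5 ^ 2 * N2"
    and "d1 = a5 * N0 - b5 * N2 - b5 ^ 2 * N3" and "d4 = a5 * N3 - b5 * N0 - a5 ^ 2 * N2"
    and "d2 = S5 * N2 - a5 ^ 2 * N0 - b5 * N3" and "d3 = a5 * N2 + S5 * N3 - b5 ^ 2 * N0"
  have sq: "in_class 2 (a5 ^ 2)" "in_class 3 (b5 ^ 2)"
    unfolding power2_eq_square by (rule in_class_mult[OF cl(1) cl(1)] in_class_mult[OF cl(2) cl(2)]; simp)+
  have d: "in_class 1 d1" "in_class 2 d2" "in_class 3 d3" "in_class 4 d4"
    unfolding d1_def d2_def d3_def d4_def
    by (intro in_class_add; rule in_class_mult[OF cl(1) cl(4)] in_class_mult[OF cl(2) cl(5)]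
        in_class_mult[OF sq(2) cl(6)] in_class_mult[OF cl(3) cl(5)] in_class_mult[OF sq(1) cl(4)]
        in_class_mult[OF cl(2) cl(6)] in_class_mult[OF cl(1) cl(5)] in_class_mult[OF cl(3) cl(6)]
        in_class_mult[OF sq(2) cl(4)] in_class_mult[OF cl(1) cl(6)] in_class_mult[OF cl(2) cl(4)]
        in_class_mult[OF sq(1) cl(5)]; simp)+
  have dsum: "(N0 + N2 + N3) * D5 = d0 + d1 + d2 + d3 + d4"
    unfolding D5_def d0_def d1_def d2_def d3_def d4_def by (simp add: algebra_simps)
  have d0: "d0 = (- (s_fun * (1 + s_fun) ^ 2)) oo fps_X ^ 5"
  proof -
    have "d0 = - (a5 ^ 5 - b5 ^ 5) - S5 ^ 2 + S5 ^ 3"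
      unfolding d0_def N0_def N2_def N3_def S5_def by (simp add: algebra_simps eval_nat_numeral)
    also have "\<dots> = - (S5 * (1 + S5) ^ 2)"
      unfolding dissection_basic(3) by (simp add: algebra_simps eval_nat_numeral)
    also have "\<dots> = (- (s_fun * (1 + s_fun) ^ 2)) oo fps_X ^ 5"
      by (simp add: S5 dilate_mult dilate_power fps_compose_uminus fps_compose_add_distrib)
    finally show ?thesis .
  qed
  show "dissect 5 0 ((N0 + N2 + N3) * D5) = - (s_fun * (1 + s_fun) ^ 2)"
    unfolding dsum by (simp only: dissect_linear sec0[OF d(1)] sec0[OF d(2)] sec0[OF d(3)] sec0[OF d(4)]) (simp add: d0 dil)
  have mul: "dissect 5 0 (numeral n * (c * f)) = 0" if "in_class r c" "in_class s f" "(r + s) mod 5 \<noteq> 0" for n c f r s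
    using sec0[OF in_class_mult[OF in_class_numeral in_class_mult[OF that(1,2) refl] refl]] that(3) by simp
  have "(N0 + N2 + N3) * x5 = N0 + N2 + N3 + 2 * (b5 * N0) + 2 * (b5 * N2) + 2 * (b5 * N3)
      - 2 * (a5 * N0) - 2 * (a5 * N2) - 2 * (a5 * N3)"
    by (simp add: x5_def algebra_simps)
  then show "dissect 5 0 ((N0 + N2 + N3) * x5) = - (s_fun * (1 + s_fun))"
    using sec0[OF cl(5)] sec0[OF cl(6)]
    by (simp add: dissect_linear 0 mul[OF cl(1) cl(4)] mul[OF cl(1) cl(5)] mul[OF cl(1) cl(6)]
        mul[OF cl(2) cl(4)] mul[OF cl(2) cl(5)] mul[OF cl(2) cl(6)])
  have "in_class 0 d0" unfolding d0 by (rule in_class_dilate)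
  have "d0 + 2 * (b5 * d1) - 2 * (a5 * d4) = (- (s_fun * (1 + s_fun) ^ 2 * (3 + 4 * s_fun))) oo fps_X ^ 5"
  proof -
    have A: "2 * (b5 * d1) - 2 * (a5 * d4) = - 4 * (S5 ^ 2 + S5 ^ 3) - 2 * (1 + S5) * (a5 ^ 5 - b5 ^ 5)"
      unfolding d1_def d4_def N0_def N2_def N3_def S5_def by (simp add: algebra_simps eval_nat_numeral)
    have B: "d0 = - (S5 * (1 + S5) ^ 2)"
      unfolding d0 by (simp add: S5 dilate_mult dilate_power fps_compose_uminus fps_compose_add_distrib)
    have "d0 + 2 * (b5 * d1) - 2 * (a5 * d4) = d0 + (2 * (b5 * d1) - 2 * (a5 * d4))" by simp
    also have "\<dots> = - (S5 * (1 + S5) ^ 2) + (- 4 * (S5 ^ 2 + S5 ^ 3) - 2 * (1 + S5) * (S5 + S5 ^ 2 + 2 * S5 ^ 3))"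
      by (simp only: A B dissection_basic(3))
    also have "\<dots> = - (S5 * (1 + S5) ^ 2 * (3 + 4 * S5))"
      by (simp add: algebra_simps eval_nat_numeral)
    finally have "d0 + 2 * (b5 * d1) - 2 * (a5 * d4) = - (S5 * (1 + S5) ^ 2 * (3 + 4 * S5))" .
    then show ?thesis
      by (simp add: S5 dilate_mult dilate_power fps_compose_uminus fps_compose_add_distrib numeral_fps_const)
  qed
  moreover have "(N0 + N2 + N3) * D5 * x5 = (d0 + 2 * (b5 * d1) - 2 * (a5 * d4)) + d1 + d2 + d3 + d4
      + 2 * (b5 * d0) + 2 * (b5 * d2) + 2 * (b5 * d3) + 2 * (b5 * d4)
      - 2 * (a5 * d0) - 2 * (a5 * d1) - 2 * (a5 * d2) - 2 * (a5 * d3)"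
    unfolding dsum x5_def by (simp add: algebra_simps)
  ultimately show "dissect 5 0 ((N0 + N2 + N3) * D5 * x5) = - (s_fun * (1 + s_fun) ^ 2 * (3 + 4 * s_fun))"
    using \<open>in_class 0 d0\<close>
    by (simp only: dissect_linear dil sec0[OF d(1)] sec0[OF d(2)] sec0[OF d(3)] sec0[OF d(4)]
        mul[OF cl(1) _] mul[OF cl(2) _]) 
       (simp add: mul[OF cl(1) \<open>in_class 0 d0\<close>] mul[OF cl(1) d(1)] mul[OF cl(1) d(2)] mul[OF cl(1) d(3)]
        mul[OF cl(2) \<open>in_class 0 d0\<close>] mul[OF cl(2) d(2)] mul[OF cl(2) d(3)] mul[OF cl(2) d(4)])
qed

section \<open>Two forms interchanged by U\<close>

definition e_fun :: "complex fps" where "e_fun = 1 + 4 * t_fun"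
definition k_fun :: "complex fps" where "k_fun = 1 + 5 * t_fun"

text \<open>
  In the notation \<open>f_k\<close> above, \<open>f0 = f_2 f_5^2\<close> and \<open>g0 = f_1^2 f_10\<close>, two eta products of weight
  \<open>3/2\<close>. They are interchanged by \<open>-U\<close>, whereas the recurrences for sections below start from the
  quotients \<open>F1\<close> and \<open>G1\<close> by \<open>1 + 4t\<close>.
\<close>

definition F1 :: "complex fps" where "F1 = sig * inverse (phi * k_fun ^ 2)"
definition G1 :: "complex fps" where "G1 = sig * inverse (phi5 * k_fun ^ 2)"
definition f0 :: "complex fps" where "f0 = F1 * e_fun"
definition g0 :: "complex fps" where "g0 = G1 * e_fun"

lemma nth_0_simps [simp]: "k_fun $ 0 = 1" "e_fun $ 0 = 1"
  by (simp_all add: k_fun_def e_fun_def numeral_fps_const)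

lemma sig_nth_0 [simp]: "sig $ 0 = 1"
  by (simp add: sig_def sigma_odd_series_def sigma_def)

lemma nonzero_simps [simp]: "k_fun \<noteq> 0" "e_fun \<noteq> 0" "sig \<noteq> 0"
  using nth_0_simps sig_nth_0 by (metis fps_zero_nth zero_neq_one)+

lemma F1: "F1 * (phi * k_fun ^ 2) = sig" and G1: "G1 * (phi5 * k_fun ^ 2) = sig"
  unfolding F1_def G1_def mult.assoc by (subst inverse_mult_eq_1; simp add: fps_nth_power_0)+

lemma dilate_phi: "phi oo fps_X ^ 5 = phi5"
  by (simp add: phi_def phi5_def theta_dilate)

lemma G1_phi5: "G1 * phi5 = F1 * phi"
proof -
  have "k_fun ^ 2 * (G1 * phi5) = k_fun ^ 2 * (F1 * phi)"
    using F1 G1 by (simp only: mult_ac)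
  then show ?thesis by simp
qed

text \<open>
  The sections of \<open>q^2\<close> times a series in \<open>q^5\<close> are evident. Passing from \<open>F1 t^2 phi\<close> to \<open>F1\<close> and
  \<open>F1 t\<close> means dividing by \<open>phi\<close> and \<open>t\<close>, that is by polynomials in \<open>a5\<close> and \<open>b5\<close>, and this is
  what \<open>key_identity\<close> achieves.
\<close>

lemma F1_t2: "F1 * t_fun ^ 2 * phi = fps_X ^ 2 * (sig oo fps_X ^ 5)"
proof -
  have "k_fun ^ 2 * (F1 * t_fun ^ 2 * phi) = (F1 * (phi * k_fun ^ 2)) * t_fun ^ 2"
    by (simp only: mult_ac)
  also have "\<dots> = sig * t_fun ^ 2" by (simp only: F1)
  also have "\<dots> = fps_X ^ 2 * (sig oo fps_X ^ 5) * k_fun ^ 2"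
    by (simp only: sig_quintic k_fun_def)
  also have "\<dots> = k_fun ^ 2 * (fps_X ^ 2 * (sig oo fps_X ^ 5))" by (simp only: mult_ac)
  finally show ?thesis by simp
qed

definition P5 :: "complex fps" where "P5 = phi5 oo fps_X ^ 5"
definition W5 :: "complex fps" where "W5 = 1 - 4 * S5"
definition NN :: "complex fps" where "NN = N0 + N2 + N3"
definition T5 :: "complex fps" where "T5 = t_fun oo fps_X ^ 5"

lemma P5_nonzero [simp]: "P5 \<noteq> 0"
proof -
  have "P5 $ 0 = 1" by (simp add: P5_def)
  then show ?thesis by auto
qed

lemma phi_eq: "phi = P5 * x5" and phi5_sq: "phi5 ^ 2 = P5 ^ 2 * W5" and S5_eq: "S5 = s_fun oo fps_X ^ 5"
  using dissection_basic by (simp_all add: P5_def W5_def)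

lemma x5_nonzero [simp]: "x5 \<noteq> 0"
  using phi_eq phi_nonzero by auto

lemma W5_eq: "W5 = (1 - 4 * s_fun) oo fps_X ^ 5"
  by (simp add: W5_def S5_eq fps_compose_sub_distrib dilate_mult numeral_fps_const)

lemma e_x2: "e_fun * x5 ^ 2 = W5"
proof -
  have "P5 ^ 2 * (e_fun * x5 ^ 2) = phi ^ 2 * e_fun"
    by (simp add: phi_eq power_mult_distrib mult_ac)
  also have "\<dots> = P5 ^ 2 * W5"
    using t_s_relation(3) by (simp add: e_fun_def phi5_sq)
  finally show ?thesis by simp
qed

lemma W5_nonzero [simp]: "W5 \<noteq> 0"
  using e_x2 by auto

text \<open>
  Since \<open>1 + 4t = W5/x5^2\<close>, this is \<open>W5 - x5^2 = 4 D5\<close>, a polynomial identity.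
\<close>

lemma t_x2: "t_fun * x5 ^ 2 = D5"
proof -
  have "4 * (t_fun * x5 ^ 2) = W5 - x5 ^ 2"
    using e_x2 by (simp add: e_fun_def algebra_simps)
  also have "\<dots> = 4 * D5"
    unfolding W5_def x5_def D5_def S5_def by (simp add: algebra_simps power2_eq_square)
  finally show ?thesis by (rule mult_left_cancel[THEN iffD1, rotated]) simp
qed

definition M5 :: "complex fps" where "M5 = (s_fun * (1 + s_fun) ^ 3) oo fps_X ^ 5"

lemma M5: "M5 = S5 * (1 + S5) ^ 3"
  by (simp add: M5_def S5_eq dilate_mult dilate_power fps_compose_add_distrib)

text \<open>
  Up to series in \<open>q^5\<close>, \<open>f0\<close> is \<open>q^2 x5/D5^2\<close>, and \<open>key_identity\<close> clears the denominator.
\<close>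

lemma f0_dissection: "M5 * P5 * f0 = fps_X ^ 2 * ((sig oo fps_X ^ 5) * W5 * NN)"
proof -
  have D2: "f0 * D5 ^ 2 * P5 = fps_X ^ 2 * (sig oo fps_X ^ 5) * W5 * x5"
  proof -
    have "f0 * D5 ^ 2 * P5 = (F1 * t_fun ^ 2 * (P5 * x5)) * (e_fun * x5 ^ 2) * x5"
      unfolding t_x2[symmetric] f0_def by (simp add: power2_eq_square mult_ac)
    then show ?thesis unfolding phi_eq[symmetric] F1_t2 e_x2 .
  qed
  have "x5 * (M5 * P5 * f0) = (f0 * P5) * (x5 * (S5 * (1 + S5) ^ 3))"
    unfolding M5 by (simp only: mult_ac)
  also have "\<dots> = (f0 * D5 ^ 2 * P5) * NN"
    unfolding key_identity NN_def by (simp only: mult_ac)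
  also have "\<dots> = x5 * (fps_X ^ 2 * ((sig oo fps_X ^ 5) * W5 * NN))"
    unfolding D2 by (simp only: mult_ac)
  finally show ?thesis by simp
qed

lemma F1_f0: "F1 * W5 * t_fun = f0 * D5"
proof -
  have "F1 * W5 * t_fun = F1 * e_fun * (t_fun * x5 ^ 2)"
    unfolding e_x2[symmetric] by (simp only: mult_ac)
  then show ?thesis by (simp add: t_x2 f0_def)
qed

lemma F1_t_dissection: "M5 * P5 * (F1 * t_fun) = fps_X ^ 2 * ((sig oo fps_X ^ 5) * (NN * D5))"
proof -
  have "W5 * (M5 * P5 * (F1 * t_fun)) = (F1 * W5 * t_fun) * (M5 * P5)"
    by (simp only: mult_ac)
  also have "\<dots> = (M5 * P5 * f0) * D5"
    unfolding F1_f0 by (simp only: mult_ac)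
  also have "\<dots> = W5 * (fps_X ^ 2 * ((sig oo fps_X ^ 5) * (NN * D5)))"
    unfolding f0_dissection by (simp only: mult_ac)
  finally show ?thesis by simp
qed

lemma G1_F1: "phi5 * G1 = P5 * x5 * F1"
  using G1_phi5 phi_eq by (simp only: mult_ac)

lemma G1_t_dissection: "M5 * phi5 * (G1 * t_fun) = fps_X ^ 2 * ((sig oo fps_X ^ 5) * (NN * D5 * x5))"
proof -
  have "M5 * phi5 * (G1 * t_fun) = M5 * (phi5 * G1) * t_fun" by (simp only: mult_ac)
  also have "\<dots> = (M5 * P5 * (F1 * t_fun)) * x5" unfolding G1_F1 by (simp only: mult_ac)
  also have "\<dots> = fps_X ^ 2 * ((sig oo fps_X ^ 5) * (NN * D5 * x5))"
    unfolding F1_t_dissection by (simp only: mult_ac)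
  finally show ?thesis .
qed

lemma g0_dissection: "M5 * phi5 * g0 = fps_X ^ 2 * ((sig oo fps_X ^ 5) * W5 * (NN * x5))"
proof -
  have "M5 * phi5 * g0 = M5 * (phi5 * G1) * e_fun" by (simp only: g0_def mult_ac)
  also have "\<dots> = (M5 * P5 * f0) * x5" unfolding G1_F1 f0_def by (simp only: mult_ac)
  also have "\<dots> = fps_X ^ 2 * ((sig oo fps_X ^ 5) * W5 * (NN * x5))"
    unfolding f0_dissection by (simp only: mult_ac)
  finally show ?thesis .
qed

lemma dissect_X2: "dissect 5 2 (fps_X ^ 2 * f) = dissect 5 0 f" "dissect 5 3 (fps_X ^ 2 * f) = dissect 5 1 f"
  "dissect 5 1 (fps_X ^ 2 * f) = fps_X * dissect 5 4 f" for f :: "complex fps"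
proof -
  show "dissect 5 2 (fps_X ^ 2 * f) = dissect 5 0 f" "dissect 5 3 (fps_X ^ 2 * f) = dissect 5 1 f"
    by (simp_all add: fps_eq_iff fps_X_power_mult_nth)
  show "dissect 5 1 (fps_X ^ 2 * f) = fps_X * dissect 5 4 f"
  proof (rule fps_ext)
    fix n show "dissect 5 1 (fps_X ^ 2 * f) $ n = (fps_X * dissect 5 4 f) $ n"
      by (cases n) (simp_all add: fps_X_power_mult_nth add.commute[of 4])
  qed
qed

lemma s_fun_nonzero [simp]: "s_fun * (1 + s_fun) ^ 3 \<noteq> 0" "s_fun \<noteq> 0" "1 + s_fun \<noteq> 0"
proof -
  have "(1 + s_fun) $ 0 = 1" by simp
  then show 1: "1 + s_fun \<noteq> 0" by (metis fps_zero_nth zero_neq_one)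
  have t1: "(theta (-1) 7 3 :: complex fps) \<noteq> 0" "(theta (-1) 9 1 :: complex fps) \<noteq> 0"
    using theta_nth_0[of 7 3] theta_nth_0[of 9 1] by auto
  have "inverse (phi5 ^ 2) \<noteq> 0"
    using phi_inverse(2)[of 2] by (metis mult_zero_right zero_neq_one)
  then show 2: "s_fun \<noteq> 0" using t1 by (simp add: s_fun_def del: One_nat_def)
  show "s_fun * (1 + s_fun) ^ 3 \<noteq> 0" using 1 2 by simp
qed

lemma dissect_M5: "r < 5 \<Longrightarrow> dissect 5 r (M5 * P5 * f) = s_fun * (1 + s_fun) ^ 3 * phi5 * dissect 5 r f"
  "r < 5 \<Longrightarrow> dissect 5 r (M5 * phi5 * f) = s_fun * (1 + s_fun) ^ 3 * phi * dissect 5 r f"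
  unfolding M5_def P5_def dilate_phi[symmetric]
  by (simp_all only: dilate_mult[symmetric, of 5] dissect_dilate_mult zero_less_numeral)

lemma dissect_sig: "dissect 5 r ((sig oo fps_X ^ 5) * f) = sig * dissect 5 r f"
  "dissect 5 r ((sig oo fps_X ^ 5) * W5 * f) = sig * (1 - 4 * s_fun) * dissect 5 r f" if "r < 5"
  unfolding W5_eq using that by (simp_all only: dilate_mult[symmetric, of 5] dissect_dilate_mult zero_less_numeral)

text \<open>
  The factor \<open>q^2\<close> moves the classes \<open>4\<close> and \<open>1\<close>, which \<open>NN\<close> lacks, to \<open>1\<close> and \<open>3\<close>.
\<close>

lemma f0_sections: "dissect 5 1 f0 = 0" "dissect 5 3 f0 = 0"
proof -
  have "s_fun * (1 + s_fun) ^ 3 * phi5 * dissect 5 1 f0 = 0"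
    using arg_cong[OF f0_dissection, of "dissect 5 1"] sections_NN
    by (simp add: dissect_M5 dissect_X2 dissect_sig NN_def del: One_nat_def)
  then show "dissect 5 1 f0 = 0" by simp
  have "s_fun * (1 + s_fun) ^ 3 * phi5 * dissect 5 3 f0 = 0"
    using arg_cong[OF f0_dissection, of "dissect 5 3"] sections_NN
    by (simp add: dissect_M5 dissect_X2 dissect_sig NN_def del: One_nat_def)
  then show "dissect 5 3 f0 = 0" by simp
qed

lemma e_s_relation: "e_fun * (1 - 4 * s_fun) = 1" "e_fun * (1 + s_fun) = k_fun" "e_fun * s_fun = t_fun"
  using t_s_relation one_plus_s by (simp_all add: e_fun_def k_fun_def mult.commute)

lemma cancel_s:
  assumes "s_fun * (1 + s_fun) ^ 3 * p * f = c * (- (s_fun * (1 + s_fun) * d))"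
  shows "(1 + s_fun) ^ 2 * p * f = - (c * d)"
proof -
  from assms have "(s_fun * (1 + s_fun)) * ((1 + s_fun) ^ 2 * p * f) = (s_fun * (1 + s_fun)) * (- (c * d))"
    by (simp add: eval_nat_numeral mult_ac)
  then show ?thesis by (rule mult_left_cancel[THEN iffD1, rotated]) simp
qed

lemma U_f0: "dissect 5 2 f0 = - g0"
proof -
  have "s_fun * (1 + s_fun) ^ 3 * phi5 * dissect 5 2 f0 = sig * (1 - 4 * s_fun) * (- (s_fun * (1 + s_fun) * 1))"
    using arg_cong[OF f0_dissection, of "dissect 5 2"] sections_NN(1)
    by (simp add: dissect_M5 dissect_X2 dissect_sig NN_def)
  from cancel_s[OF this] have "(1 + s_fun) ^ 2 * phi5 * dissect 5 2 f0 = - (sig * (1 - 4 * s_fun))" by simp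
  then have "e_fun ^ 2 * ((1 + s_fun) ^ 2 * phi5 * dissect 5 2 f0) = e_fun ^ 2 * (- (sig * (1 - 4 * s_fun)))" by simp
  then have "(e_fun * (1 + s_fun)) ^ 2 * phi5 * dissect 5 2 f0 = - (sig * e_fun * (e_fun * (1 - 4 * s_fun)))"
    by (simp only: power2_eq_square mult_ac mult_minus_right)
  then have "(phi5 * k_fun ^ 2) * dissect 5 2 f0 = (phi5 * k_fun ^ 2) * (- g0)"
    unfolding e_s_relation G1[symmetric] g0_def by (simp add: mult_ac)
  then show ?thesis by (rule mult_left_cancel[THEN iffD1, rotated]) simp
qed

lemma U_g0: "dissect 5 2 g0 = - f0"
proof -
  have "s_fun * (1 + s_fun) ^ 3 * phi * dissect 5 2 g0 = sig * (1 - 4 * s_fun) * (- (s_fun * (1 + s_fun) * 1))"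
    using arg_cong[OF g0_dissection, of "dissect 5 2"] sections_NN(4)
    by (simp add: dissect_M5 dissect_X2 dissect_sig NN_def)
  from cancel_s[OF this] have "(1 + s_fun) ^ 2 * phi * dissect 5 2 g0 = - (sig * (1 - 4 * s_fun))" by simp
  then have "e_fun ^ 2 * ((1 + s_fun) ^ 2 * phi * dissect 5 2 g0) = e_fun ^ 2 * (- (sig * (1 - 4 * s_fun)))" by simp
  then have "(e_fun * (1 + s_fun)) ^ 2 * phi * dissect 5 2 g0 = - (sig * e_fun * (e_fun * (1 - 4 * s_fun)))"
    by (simp only: power2_eq_square mult_ac mult_minus_right)
  then have "(phi * k_fun ^ 2) * dissect 5 2 g0 = (phi * k_fun ^ 2) * (- f0)"
    unfolding e_s_relation F1[symmetric] f0_def by (simp add: mult_ac)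
  then show ?thesis by (rule mult_left_cancel[THEN iffD1, rotated]) simp
qed

text \<open>
  The lemmas \<open>relation_v\<close> and \<open>relation_h\<close> are linear recurrences for these two sequences of sections; the values at
  \<open>0\<close> and \<open>1\<close>, and for \<open>h_seq\<close> also at \<open>2\<close>, serve as initial data.
\<close>

definition v_seq :: "nat \<Rightarrow> complex fps" where "v_seq j = dissect 5 2 (F1 * t_fun ^ j)"
definition h_seq :: "nat \<Rightarrow> complex fps" where "h_seq j = dissect 5 2 (G1 * t_fun ^ j)"

lemma v_1: "phi5 * k_fun ^ 2 * v_seq 1 = sig * (- (e_fun * k_fun))"
proof -
  have "s_fun * (1 + s_fun) ^ 3 * phi5 * v_seq 1 = sig * (- (s_fun * (1 + s_fun) * (1 + s_fun)))"
  proof -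
    have "s_fun * (1 + s_fun) ^ 3 * phi5 * v_seq 1 = dissect 5 2 (M5 * P5 * (F1 * t_fun))"
      by (simp add: dissect_M5 v_seq_def)
    also have "\<dots> = sig * dissect 5 0 (NN * D5)"
      unfolding F1_t_dissection by (simp add: dissect_X2 dissect_sig)
    finally show ?thesis
      unfolding NN_def sections_NN(5) by (simp only: power2_eq_square mult_ac)
  qed
  from cancel_s[OF this] have "(1 + s_fun) * ((1 + s_fun) * phi5 * v_seq 1) = (1 + s_fun) * (- sig)"
    by (simp add: power2_eq_square mult_ac)
  then have "(1 + s_fun) * phi5 * v_seq 1 = - sig" by (rule mult_left_cancel[THEN iffD1, rotated]) simp
  then have "(e_fun * k_fun) * ((1 + s_fun) * phi5 * v_seq 1) = (e_fun * k_fun) * (- sig)" by simp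
  then have "(e_fun * (1 + s_fun)) * (phi5 * k_fun * v_seq 1) = sig * (- (e_fun * k_fun))"
    by (simp add: mult_ac)
  then show ?thesis unfolding e_s_relation by (simp add: power2_eq_square mult_ac)
qed

lemma h_1: "phi * k_fun ^ 2 * h_seq 1 = sig * (- ((3 + 16 * t_fun) * k_fun))"
proof -
  have "s_fun * (1 + s_fun) ^ 3 * phi * h_seq 1 = sig * (- (s_fun * (1 + s_fun) * ((1 + s_fun) * (3 + 4 * s_fun))))"
  proof -
    have "s_fun * (1 + s_fun) ^ 3 * phi * h_seq 1 = dissect 5 2 (M5 * phi5 * (G1 * t_fun))"
      by (simp add: dissect_M5 h_seq_def)
    also have "\<dots> = sig * dissect 5 0 (NN * D5 * x5)"
      unfolding G1_t_dissection by (simp add: dissect_X2 dissect_sig)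
    finally show ?thesis
      unfolding NN_def sections_NN(6) by (simp only: power2_eq_square mult_ac)
  qed
  from cancel_s[OF this] have "(1 + s_fun) * ((1 + s_fun) * phi * h_seq 1) = (1 + s_fun) * (- (sig * (3 + 4 * s_fun)))"
    by (simp add: power2_eq_square mult_ac)
  then have "(1 + s_fun) * phi * h_seq 1 = - (sig * (3 + 4 * s_fun))" by (rule mult_left_cancel[THEN iffD1, rotated]) simp
  then have "(e_fun * k_fun) * ((1 + s_fun) * phi * h_seq 1) = (e_fun * k_fun) * (- (sig * (3 + 4 * s_fun)))" by simp
  then have "(e_fun * (1 + s_fun)) * (phi * k_fun * h_seq 1) = sig * (- (k_fun * (3 * e_fun + 4 * (e_fun * s_fun))))"
    by (simp add: algebra_simps)
  then show ?thesis unfolding e_s_relation by (simp add: power2_eq_square e_fun_def algebra_simps)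
qed

lemma v_0: "phi5 * k_fun ^ 2 * v_seq 0 = sig * (- e_fun + 4 * (e_fun * k_fun))"
proof -
  have "f0 = F1 * t_fun ^ 0 + fps_const 4 * (F1 * t_fun ^ 1)"
    by (simp add: f0_def e_fun_def numeral_fps_const algebra_simps)
  then have "dissect 5 2 f0 = v_seq 0 + fps_const 4 * v_seq 1"
    by (metis v_seq_def dissect_linear(1) dissect_linear(5))
  then have "dissect 5 2 f0 = v_seq 0 + 4 * v_seq 1" by (simp only: numeral_fps_const)
  then have v0: "v_seq 0 = - g0 - 4 * v_seq 1"
    unfolding U_f0 by (simp add: algebra_simps)
  have "phi5 * k_fun ^ 2 * v_seq 0 = - (G1 * (phi5 * k_fun ^ 2) * e_fun) - 4 * (phi5 * k_fun ^ 2 * v_seq 1)"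
    unfolding v0 by (simp add: g0_def algebra_simps)
  then show ?thesis unfolding v_1 G1 by (simp add: algebra_simps)
qed

lemma h_0: "phi * k_fun ^ 2 * h_seq 0 = sig * (- e_fun + 4 * ((3 + 16 * t_fun) * k_fun))"
proof -
  have "g0 = G1 * t_fun ^ 0 + fps_const 4 * (G1 * t_fun ^ 1)"
    by (simp add: g0_def e_fun_def numeral_fps_const algebra_simps)
  then have "dissect 5 2 g0 = h_seq 0 + fps_const 4 * h_seq 1"
    by (metis h_seq_def dissect_linear(1) dissect_linear(5))
  then have "dissect 5 2 g0 = h_seq 0 + 4 * h_seq 1" by (simp only: numeral_fps_const)
  then have h0: "h_seq 0 = - f0 - 4 * h_seq 1"
    unfolding U_g0 by (simp add: algebra_simps)
  have "phi * k_fun ^ 2 * h_seq 0 = - (F1 * (phi * k_fun ^ 2) * e_fun) - 4 * (phi * k_fun ^ 2 * h_seq 1)"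
    unfolding h0 by (simp add: f0_def algebra_simps)
  then show ?thesis unfolding h_1 F1 by (simp add: algebra_simps)
qed

lemma h_2: "phi * k_fun ^ 2 * h_seq 2 = sig * k_fun ^ 2"
proof -
  have "G1 * t_fun ^ 2 * phi5 = (G1 * phi5) * t_fun ^ 2" by (simp only: mult_ac)
  also have "\<dots> = fps_X ^ 2 * (sig oo fps_X ^ 5)"
    unfolding G1_phi5 F1_t2[symmetric] by (simp only: mult_ac)
  finally have "G1 * t_fun ^ 2 * phi5 = fps_X ^ 2 * (sig oo fps_X ^ 5)" .
  then have "dissect 5 2 ((phi oo fps_X ^ 5) * (G1 * t_fun ^ 2)) = dissect 5 2 (fps_X ^ 2 * ((sig oo fps_X ^ 5) * 1))"
    by (simp add: dilate_phi mult_ac)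
  then have "phi * h_seq 2 = sig * dissect 5 0 1"
    by (simp add: dissect_dilate_mult[of 2 5] dissect_X2 dissect_sig h_seq_def del: mult_1_right)
  moreover have "dissect 5 0 (1 :: complex fps) = 1" by (simp add: fps_eq_iff)
  ultimately have "phi * h_seq 2 = sig" by simp
  moreover have "phi * k_fun ^ 2 * h_seq 2 = (phi * h_seq 2) * k_fun ^ 2" by (simp only: mult_ac)
  ultimately show ?thesis by simp
qed

section \<open>The modular equation\<close>

lemma T5: "T5 * W5 = S5" "(1 + 4 * T5) * W5 = 1"
proof -
  have dil: "(f oo fps_X ^ 5) * (g oo fps_X ^ 5) = (f * g) oo fps_X ^ 5" for f g :: "complex fps"
    by (simp add: dilate_mult)
  have "(1 + 4 * t_fun) oo fps_X ^ 5 = 1 + 4 * T5"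
    by (simp add: T5_def fps_compose_add_distrib dilate_mult numeral_fps_const)
  then show 1: "(1 + 4 * T5) * W5 = 1"
    using dil[of "1 + 4 * t_fun" "1 - 4 * s_fun"] by (simp add: W5_eq t_s_relation(1))
  have "4 * (T5 * W5) = 1 - W5" using 1 by (simp add: algebra_simps)
  also have "\<dots> = 4 * S5" by (simp add: W5_def)
  finally show "T5 * W5 = S5" by (rule mult_left_cancel[THEN iffD1, rotated]) simp
qed

text \<open>
  The quintic equation of \<open>x5\<close> over the series in \<open>q^5\<close> is of the form \<open>x5 P(x5^2) = Q(x5^2)\<close>. As
  \<open>x5^2\<close> is a rational function of \<open>t\<close> and \<open>T5\<close>, it makes \<open>x5\<close> itself the quotient of the
  polynomials \<open>Dp\<close> and \<open>(1 + 4 T5) Np\<close> of degree two in \<open>t\<close>.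
\<close>

definition Dp :: "complex fps" where
  "Dp = t_fun ^ 2 + (3 + 20 * T5) * (1 + 5 * T5) * t_fun + (1 + 5 * T5) ^ 2"
definition Np :: "complex fps" where
  "Np = (1 + 5 * T5) ^ 2 + 5 * (1 + 5 * T5) * (1 + 8 * T5) * t_fun + 5 * (1 + 20 * T5 + 80 * T5 ^ 2) * t_fun ^ 2"

lemma Dp_Np: "Dp = x5 * (1 + 4 * T5) * Np"
proof -
  have D: "x5 ^ 4 * W5 * (16 * Dp) = W5 * (e_fun * x5 ^ 2) ^ 2
      + (10 + 100 * T5) * ((1 + 4 * T5) * W5) * (e_fun * x5 ^ 2) * x5 ^ 2 + 5 * ((1 + 4 * T5) * W5) * x5 ^ 4"
    unfolding Dp_def e_fun_def by (simp add: algebra_simps eval_nat_numeral)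
  also have "\<dots> = W5 ^ 3 + (10 * W5 + 100 * (T5 * W5)) * x5 ^ 2 + 5 * x5 ^ 4"
    unfolding e_x2 T5(2) by (simp add: algebra_simps eval_nat_numeral)
  finally have D: "x5 ^ 4 * W5 * (16 * Dp) = W5 ^ 3 + (10 * W5 + 100 * S5) * x5 ^ 2 + 5 * x5 ^ 4"
    unfolding T5(1) .
  have "x5 ^ 4 * W5 * (16 * (x5 * (1 + 4 * T5) * Np)) = x5 * ((1 + 4 * T5) * W5) *
      (x5 ^ 4 + (10 + 60 * T5) * (e_fun * x5 ^ 2) * x5 ^ 2 + 5 * (1 + 20 * T5 + 80 * T5 ^ 2) * (e_fun * x5 ^ 2) ^ 2)"
    unfolding Np_def e_fun_def by (simp add: algebra_simps eval_nat_numeral)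
  also have "\<dots> = x5 * (x5 ^ 4 + (10 * W5 + 60 * (T5 * W5)) * x5 ^ 2
      + 5 * (W5 ^ 2 + 20 * (T5 * W5) * W5 + 80 * (T5 * W5) ^ 2))"
    unfolding e_x2 T5(2) by (simp add: algebra_simps eval_nat_numeral)
  finally have N: "x5 ^ 4 * W5 * (16 * (x5 * (1 + 4 * T5) * Np))
      = x5 * (x5 ^ 4 + (10 * W5 + 60 * S5) * x5 ^ 2 + 5 * (W5 ^ 2 + 20 * S5 * W5 + 80 * S5 ^ 2))"
    unfolding T5(1) .
  have "x5 * (x5 ^ 4 + (10 * W5 + 60 * S5) * x5 ^ 2 + 5 * (W5 ^ 2 + 20 * S5 * W5 + 80 * S5 ^ 2))
      - (W5 ^ 3 + (10 * W5 + 100 * S5) * x5 ^ 2 + 5 * x5 ^ 4)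
      = - 32 * (a5 ^ 5 - b5 ^ 5 - (S5 + S5 ^ 2 + 2 * S5 ^ 3))"
    unfolding x5_def W5_def S5_def by (simp add: algebra_simps eval_nat_numeral)
  then have "x5 ^ 4 * W5 * (16 * Dp) = x5 ^ 4 * W5 * (16 * (x5 * (1 + 4 * T5) * Np))"
    unfolding D N dissection_basic(3) by simp
  then have "(x5 ^ 4 * W5 * 16) * Dp = (x5 ^ 4 * W5 * 16) * (x5 * (1 + 4 * T5) * Np)"
    by (simp only: mult.assoc)
  then show ?thesis by (rule mult_left_cancel[THEN iffD1, rotated]) simp
qed

lemma Np_Dp: "Np = x5 * e_fun * Dp"
proof -
  have "x5 * e_fun * Dp = (e_fun * x5 ^ 2) * (1 + 4 * T5) * Np"
    by (subst Dp_Np) (simp add: power2_eq_square mult_ac)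
  also have "\<dots> = ((1 + 4 * T5) * W5) * Np" unfolding e_x2 by (simp only: mult_ac)
  finally show ?thesis by (simp add: T5(2))
qed

text \<open>
  Squaring the quotient formula for \<open>x5\<close> and comparing with \<open>x5^2 (1 + 4t)(1 + 4 T5) = 1\<close> eliminates
  \<open>x5\<close>.
\<close>

lemma modular_equation:
  "t_fun ^ 5 = (205 * T5 + 4300 * T5 ^ 2 + 34000 * T5 ^ 3 + 120000 * T5 ^ 4 + 160000 * T5 ^ 5) * t_fun ^ 4
     + (215 * T5 + 4475 * T5 ^ 2 + 35000 * T5 ^ 3 + 122000 * T5 ^ 4 + 160000 * T5 ^ 5) * t_fun ^ 3
     + (85 * T5 + 1750 * T5 ^ 2 + 13525 * T5 ^ 3 + 46500 * T5 ^ 4 + 60000 * T5 ^ 5) * t_fun ^ 2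
     + (15 * T5 + 305 * T5 ^ 2 + 2325 * T5 ^ 3 + 7875 * T5 ^ 4 + 10000 * T5 ^ 5) * t_fun
     + (T5 + 20 * T5 ^ 2 + 150 * T5 ^ 3 + 500 * T5 ^ 4 + 625 * T5 ^ 5)" (is "_ = ?rhs")
proof -
  have "x5 * (e_fun * Dp ^ 2) = x5 * ((1 + 4 * T5) * Np ^ 2)"
  proof -
    have "x5 * (e_fun * Dp ^ 2) = (x5 * e_fun * Dp) * Dp" by (simp add: power2_eq_square mult_ac)
    also have "\<dots> = Np * (x5 * (1 + 4 * T5) * Np)" by (simp only: Np_Dp[symmetric] Dp_Np[symmetric])
    finally show ?thesis by (simp add: power2_eq_square mult_ac)
  qed
  then have "e_fun * Dp ^ 2 - (1 + 4 * T5) * Np ^ 2 = 0" by simp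
  moreover have "e_fun * Dp ^ 2 - (1 + 4 * T5) * Np ^ 2 = 4 * (t_fun ^ 5 - ?rhs)"
    unfolding e_fun_def Dp_def Np_def by (simp add: algebra_simps eval_nat_numeral)
  ultimately have "4 * (t_fun ^ 5 - ?rhs) = 0" by simp
  then have "t_fun ^ 5 - ?rhs = 0" by (rule mult_eq_0_iff[THEN iffD1, THEN disjE]) simp_all
  then show ?thesis by simp
qed

section \<open>Images of powers of t under U\<close>

text \<open>
  Integer polynomials in \<open>t\<close> are kept as polynomials, evaluated only in the statements about series,
  because the divisibility of their coefficients by powers of \<open>5\<close> is the point of the argument.
\<close>

definition ev :: "int poly \<Rightarrow> complex fps" where
  "ev p = poly (map_poly of_int p) t_fun"

lemma map_poly_of_int_add: "map_poly of_int (p + q) = (map_poly of_int p + map_poly of_int q :: complex fps poly)"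
  and map_poly_of_int_diff: "map_poly of_int (p - q) = (map_poly of_int p - map_poly of_int q :: complex fps poly)"
  and map_poly_of_int_mult: "map_poly of_int (p * q) = (map_poly of_int p * map_poly of_int q :: complex fps poly)"
  by (rule poly_eqI; simp add: coeff_map_poly coeff_mult)+

lemma ev_add: "ev (p + q) = ev p + ev q"
  and ev_diff: "ev (p - q) = ev p - ev q"
  and ev_mult: "ev (p * q) = ev p * ev q"
  and ev_0: "ev 0 = 0"
  and ev_pCons: "ev (pCons c p) = of_int c + t_fun * ev p"
  by (simp_all add: ev_def map_poly_of_int_add map_poly_of_int_diff map_poly_of_int_mult map_poly_pCons)

lemma ev_smult: "ev (smult c p) = of_int c * ev p"
  using ev_mult[of "[:c:]" p] by (simp add: ev_pCons ev_0)

lemma ev_sum: "ev (\<Sum>i\<in>A. f i) = (\<Sum>i\<in>A. ev (f i))"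
  by (induction A rule: infinite_finite_induct) (simp_all add: ev_0 ev_add)

lemma ev_altdef: "ev p = (\<Sum>i\<le>degree p. of_int (coeff p i) * t_fun ^ i)"
proof -
  have "degree (map_poly of_int p :: complex fps poly) = degree p"
    by (rule degree_map_poly) (simp flip: fps_of_int)
  then show ?thesis by (simp add: ev_def poly_altdef coeff_map_poly)
qed

lemmas ev_simps = ev_pCons ev_0 ev_add ev_diff ev_mult

lemma dissect_t_dilate: "dissect 5 2 ((c oo fps_X ^ 5) * f) = c * dissect 5 2 f" for c f :: "complex fps"
  by (rule dissect_dilate_mult) simp

lemma dilate_numeral: "(numeral n oo f) = (numeral n :: complex fps)"
  by (simp add: numeral_fps_const)

lemma T5_dilate: "1 + 5 * T5 = k_fun oo fps_X ^ 5" "1 + 4 * T5 = e_fun oo fps_X ^ 5"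
  "3 + 20 * T5 = (3 + 20 * t_fun) oo fps_X ^ 5" "1 + 8 * T5 = (1 + 8 * t_fun) oo fps_X ^ 5"
  "1 + 20 * T5 + 80 * T5 ^ 2 = (1 + 20 * t_fun + 80 * t_fun ^ 2) oo fps_X ^ 5"
  by (simp_all add: T5_def k_fun_def e_fun_def fps_compose_add_distrib dilate_mult dilate_power numeral_fps_const)

text \<open>
  The quotient formula \<open>Dp = x5 (1 + 4 T5) Np\<close>, multiplied by \<open>F1 t^j\<close>, is an equation with coefficients in
  series of \<open>q^5\<close> between the \<open>F1 t^i\<close> on one side and the \<open>G1 t^i\<close> on the other. Taking the
  \<open>2\<close>-section replaces \<open>q^5\<close> by \<open>q\<close> in those coefficients.
\<close>

lemma relation_v:
  "phi5 * (v_seq (j + 2) + (3 + 20 * t_fun) * k_fun * v_seq (j + 1) + k_fun ^ 2 * v_seq j)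
   = phi * e_fun * (k_fun ^ 2 * h_seq j + 5 * k_fun * (1 + 8 * t_fun) * h_seq (j + 1)
       + 5 * (1 + 20 * t_fun + 80 * t_fun ^ 2) * h_seq (j + 2))"
proof -
  let ?V = "\<lambda>f. f oo fps_X ^ 5 :: complex fps"
  have "P5 * (F1 * t_fun ^ j * Dp) = (P5 * x5 * F1) * (1 + 4 * T5) * Np * t_fun ^ j"
    by (subst Dp_Np) (simp only: mult_ac)
  then have "P5 * (F1 * t_fun ^ j * Dp) = phi5 * (1 + 4 * T5) * (G1 * t_fun ^ j * Np)"
    unfolding G1_F1[symmetric] by (simp only: mult_ac)
  moreover have "P5 * (F1 * t_fun ^ j * Dp) = ?V phi5 * (F1 * t_fun ^ (j + 2))
      + ?V (phi5 * (3 + 20 * t_fun) * k_fun) * (F1 * t_fun ^ (j + 1)) + ?V (phi5 * k_fun ^ 2) * (F1 * t_fun ^ j)"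
    unfolding Dp_def T5_dilate by (simp only: dilate_mult dilate_power zero_less_numeral dilate_numeral power_add P5_def dilate_phi)
      (simp add: algebra_simps eval_nat_numeral numeral_fps_const)
  moreover have "phi5 * (1 + 4 * T5) * (G1 * t_fun ^ j * Np) = ?V (phi * e_fun * k_fun ^ 2) * (G1 * t_fun ^ j)
      + ?V (phi * e_fun * (5 * k_fun * (1 + 8 * t_fun))) * (G1 * t_fun ^ (j + 1))
      + ?V (phi * e_fun * (5 * (1 + 20 * t_fun + 80 * t_fun ^ 2))) * (G1 * t_fun ^ (j + 2))"
    unfolding Np_def T5_dilate
    by (simp only: dilate_mult dilate_power zero_less_numeral dilate_numeral power_add P5_def dilate_phi)
      (simp add: algebra_simps eval_nat_numeral numeral_fps_const)
  ultimately have "?V phi5 * (F1 * t_fun ^ (j + 2))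
      + ?V (phi5 * (3 + 20 * t_fun) * k_fun) * (F1 * t_fun ^ (j + 1)) + ?V (phi5 * k_fun ^ 2) * (F1 * t_fun ^ j)
    = ?V (phi * e_fun * k_fun ^ 2) * (G1 * t_fun ^ j)
      + ?V (phi * e_fun * (5 * k_fun * (1 + 8 * t_fun))) * (G1 * t_fun ^ (j + 1))
      + ?V (phi * e_fun * (5 * (1 + 20 * t_fun + 80 * t_fun ^ 2))) * (G1 * t_fun ^ (j + 2))"
    by simp
  from arg_cong[OF this, of "dissect 5 2"]
  have "phi5 * v_seq (j + 2) + phi5 * (3 + 20 * t_fun) * k_fun * v_seq (j + 1) + phi5 * k_fun ^ 2 * v_seq j
    = phi * e_fun * k_fun ^ 2 * h_seq j + phi * e_fun * (5 * k_fun * (1 + 8 * t_fun)) * h_seq (j + 1)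
      + phi * e_fun * (5 * (1 + 20 * t_fun + 80 * t_fun ^ 2)) * h_seq (j + 2)"
    by (simp only: dissect_linear dissect_t_dilate v_seq_def h_seq_def)
  then show ?thesis by (simp only: ring_distribs mult.assoc)
qed

text \<open>
  The same with the companion formula \<open>Np = x5 (1 + 4t) Dp\<close>. Its factor \<open>1 + 4t\<close> is not a series in
  \<open>q^5\<close> and raises the degree to \<open>t^3\<close>, so that the two relations together determine \<open>v_seq\<close> and
  \<open>h_seq\<close> alternately.
\<close>

lemma relation_h:
  "phi5 * (k_fun ^ 2 * v_seq j + 5 * k_fun * (1 + 8 * t_fun) * v_seq (j + 1)
       + 5 * (1 + 20 * t_fun + 80 * t_fun ^ 2) * v_seq (j + 2))
   = phi * (4 * h_seq (j + 3) + h_seq (j + 2) + (3 + 20 * t_fun) * k_fun * (h_seq (j + 1) + 4 * h_seq (j + 2))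
       + k_fun ^ 2 * (h_seq j + 4 * h_seq (j + 1)))"
proof -
  let ?V = "\<lambda>f. f oo fps_X ^ 5 :: complex fps"
  have "P5 * (F1 * t_fun ^ j * Np) = (P5 * x5 * F1) * (e_fun * Dp) * t_fun ^ j"
    by (subst Np_Dp) (simp only: mult_ac)
  then have "P5 * (F1 * t_fun ^ j * Np) = phi5 * (G1 * t_fun ^ j * (e_fun * Dp))"
    unfolding G1_F1[symmetric] by (simp only: mult_ac)
  moreover have "P5 * (F1 * t_fun ^ j * Np) = ?V (phi5 * k_fun ^ 2) * (F1 * t_fun ^ j)
      + ?V (phi5 * (5 * k_fun * (1 + 8 * t_fun))) * (F1 * t_fun ^ (j + 1))
      + ?V (phi5 * (5 * (1 + 20 * t_fun + 80 * t_fun ^ 2))) * (F1 * t_fun ^ (j + 2))"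
    unfolding Np_def T5_dilate
    by (simp only: dilate_mult dilate_power zero_less_numeral dilate_numeral power_add P5_def dilate_phi)
      (simp add: algebra_simps eval_nat_numeral numeral_fps_const)
  moreover have "phi5 * (G1 * t_fun ^ j * (e_fun * Dp)) = ?V (fps_const 4 * phi) * (G1 * t_fun ^ (j + 3)) + ?V phi * (G1 * t_fun ^ (j + 2))
      + ?V (phi * ((3 + 20 * t_fun) * k_fun)) * (G1 * t_fun ^ (j + 1))
      + ?V (fps_const 4 * phi * ((3 + 20 * t_fun) * k_fun)) * (G1 * t_fun ^ (j + 2))
      + ?V (phi * k_fun ^ 2) * (G1 * t_fun ^ j) + ?V (fps_const 4 * phi * k_fun ^ 2) * (G1 * t_fun ^ (j + 1))"
    unfolding Dp_def T5_dilate e_fun_def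
    by (simp only: dilate_mult dilate_power zero_less_numeral dilate_numeral fps_const_compose power_add P5_def dilate_phi)
      (simp add: algebra_simps eval_nat_numeral numeral_fps_const)
  ultimately have "?V (phi5 * k_fun ^ 2) * (F1 * t_fun ^ j)
      + ?V (phi5 * (5 * k_fun * (1 + 8 * t_fun))) * (F1 * t_fun ^ (j + 1))
      + ?V (phi5 * (5 * (1 + 20 * t_fun + 80 * t_fun ^ 2))) * (F1 * t_fun ^ (j + 2))
    = ?V (fps_const 4 * phi) * (G1 * t_fun ^ (j + 3)) + ?V phi * (G1 * t_fun ^ (j + 2))
      + ?V (phi * ((3 + 20 * t_fun) * k_fun)) * (G1 * t_fun ^ (j + 1))
      + ?V (fps_const 4 * phi * ((3 + 20 * t_fun) * k_fun)) * (G1 * t_fun ^ (j + 2))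
      + ?V (phi * k_fun ^ 2) * (G1 * t_fun ^ j) + ?V (fps_const 4 * phi * k_fun ^ 2) * (G1 * t_fun ^ (j + 1))"
    by simp
  from arg_cong[OF this, of "dissect 5 2"]
  have "phi5 * k_fun ^ 2 * v_seq j + phi5 * (5 * k_fun * (1 + 8 * t_fun)) * v_seq (j + 1)
      + phi5 * (5 * (1 + 20 * t_fun + 80 * t_fun ^ 2)) * v_seq (j + 2)
    = fps_const 4 * phi * h_seq (j + 3) + phi * h_seq (j + 2) + phi * ((3 + 20 * t_fun) * k_fun) * h_seq (j + 1)
      + fps_const 4 * phi * ((3 + 20 * t_fun) * k_fun) * h_seq (j + 2)
      + phi * k_fun ^ 2 * h_seq j + fps_const 4 * phi * k_fun ^ 2 * h_seq (j + 1)"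
    by (simp only: dissect_linear dissect_t_dilate v_seq_def h_seq_def)
  then show ?thesis unfolding numeral_fps_const[symmetric] by (simp only: ring_distribs mult_ac add_ac)
qed

text \<open>
  The polynomials with \<open>U(F1 t^j) = G1 alpha_j(t)\<close> and \<open>U(G1 t^j) = F1 beta_j(t)\<close>, as computed from
  the recurrences.
\<close>

definition alpha :: "nat \<Rightarrow> int poly" where
  "alpha j = [
     [:3, 32, 80:],
     [:-1, -9, -20:],
     [:1, 34, 425, 2520, 7200, 8000:],
     [:0, 149, 9566, 246005, 3479500, 30486000, 173720000, 648800000, 1539200000, 2112000000, 1280000000:],
     [:0, 168, 40957, 2863590, 100278925, 2145861500, 30926090000, 316719200000, 2374986400000, 13229024000000, 54836160000000, 167328000000000, 365824000000000, 543232000000000, 491520000000000, 204800000000000:],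
     [:0, 73, 70767, 11947000, 871214275, 36497581125, 1005400062500, 19654074500000, 285808912400000, 3187391164000000, 27803434960000000, 192000779200000000, 1055929222400000000, 4626963200000000000, 16071034880000000000, 43728025600000000000, 91296768000000000000, 141312000000000000000, 152862720000000000000, 103219200000000000000, 32768000000000000000:]] ! j"

definition beta :: "nat \<Rightarrow> int poly" where
  "beta j = [
     [:11, 120, 320:],
     [:-3, -31, -80:],
     [:1, 10, 25:],
     [:0, 41, 1270, 16425, 113500, 442000, 920000, 800000:],
     [:0, 86, 11055, 470700, 10455675, 142897000, 1297930000, 8124000000, 35396000000, 105920000000, 208320000000, 243200000000, 128000000000:],
     [:0, 51, 28005, 3112490, 157738925, 4701487625, 92937822500, 1302634700000, 13471244000000, 105247412000000, 628958480000000, 2884419200000000, 10094400000000000, 26528640000000000, 50764800000000000, 66867200000000000, 54272000000000000, 20480000000000000:]] ! j"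

definition v_val :: "nat \<Rightarrow> int poly \<Rightarrow> bool" where
  "v_val j p \<longleftrightarrow> phi5 * k_fun ^ 2 * v_seq j = sig * ev p"
definition h_val :: "nat \<Rightarrow> int poly \<Rightarrow> bool" where
  "h_val j p \<longleftrightarrow> phi * k_fun ^ 2 * h_seq j = sig * ev p"

lemma ev_consts: "ev [:1, 4:] = e_fun" "ev [:1, 5:] = k_fun" "ev [:3, 20:] = 3 + 20 * t_fun"
  "ev [:1, 8:] = 1 + 8 * t_fun" "ev [:1, 20, 80:] = 1 + 20 * t_fun + 80 * t_fun ^ 2" "ev [:5:] = 5" "ev [:4:] = 4"
  by (simp_all add: ev_simps e_fun_def k_fun_def power2_eq_square algebra_simps)

lemma v_step:
  assumes "v_val j a0" "v_val j1 a1" "h_val j b0" "h_val j1 b1" "h_val j2 b2"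
    and j: "j1 = j + 1" "j2 = j + 2"
    and a2: "a2 + [:3, 20:] * [:1, 5:] * a1 + [:1, 5:] * [:1, 5:] * a0
      = [:1, 4:] * ([:1, 5:] * [:1, 5:] * b0 + [:5:] * [:1, 5:] * [:1, 8:] * b1 + [:5:] * [:1, 20, 80:] * b2)"
  shows "v_val j2 a2"
proof -
  note vals = assms(1-5)[unfolded j v_val_def h_val_def]
  have "phi5 * k_fun ^ 2 * v_seq (j + 2)
      = k_fun ^ 2 * (phi5 * (v_seq (j + 2) + (3 + 20 * t_fun) * k_fun * v_seq (j + 1) + k_fun ^ 2 * v_seq j))
        - (3 + 20 * t_fun) * k_fun * (phi5 * k_fun ^ 2 * v_seq (j + 1)) - k_fun ^ 2 * (phi5 * k_fun ^ 2 * v_seq j)"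
    by (simp add: algebra_simps)
  also have "\<dots> = e_fun * (k_fun ^ 2 * (phi * k_fun ^ 2 * h_seq j) + 5 * k_fun * (1 + 8 * t_fun) * (phi * k_fun ^ 2 * h_seq (j + 1))
       + 5 * (1 + 20 * t_fun + 80 * t_fun ^ 2) * (phi * k_fun ^ 2 * h_seq (j + 2)))
        - (3 + 20 * t_fun) * k_fun * (phi5 * k_fun ^ 2 * v_seq (j + 1)) - k_fun ^ 2 * (phi5 * k_fun ^ 2 * v_seq j)"
    unfolding relation_v by (simp add: algebra_simps)
  also have "\<dots> = sig * (ev ([:1, 4:] * ([:1, 5:] * [:1, 5:] * b0 + [:5:] * [:1, 5:] * [:1, 8:] * b1 + [:5:] * [:1, 20, 80:] * b2))
      - ev ([:3, 20:] * [:1, 5:] * a1) - ev ([:1, 5:] * [:1, 5:] * a0))"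
    unfolding vals ev_mult ev_add ev_consts
    by (simp add: algebra_simps power2_eq_square)
  also have "\<dots> = sig * ev a2"
    unfolding a2[symmetric] ev_add by simp
  finally show ?thesis by (simp add: v_val_def j)
qed

lemma h_step:
  assumes "v_val j a0" "v_val j1 a1" "v_val j2 a2" "h_val j b0" "h_val j1 b1" "h_val j2 b2"
    and j: "j1 = j + 1" "j2 = j + 2" "j3 = j + 3"
    and b3: "[:4:] * b3 + b2 + [:3, 20:] * [:1, 5:] * (b1 + [:4:] * b2) + [:1, 5:] * [:1, 5:] * (b0 + [:4:] * b1)
      = [:1, 5:] * [:1, 5:] * a0 + [:5:] * [:1, 5:] * [:1, 8:] * a1 + [:5:] * [:1, 20, 80:] * a2"
  shows "h_val j3 b3"
proof -
  note vals = assms(1-6)[unfolded j v_val_def h_val_def]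
  have "4 * (phi * k_fun ^ 2 * h_seq (j + 3))
      = k_fun ^ 2 * (phi * (4 * h_seq (j + 3) + h_seq (j + 2) + (3 + 20 * t_fun) * k_fun * (h_seq (j + 1) + 4 * h_seq (j + 2))
       + k_fun ^ 2 * (h_seq j + 4 * h_seq (j + 1))))
       - phi * k_fun ^ 2 * h_seq (j + 2) - (3 + 20 * t_fun) * k_fun * (phi * k_fun ^ 2 * h_seq (j + 1) + 4 * (phi * k_fun ^ 2 * h_seq (j + 2)))
       - k_fun ^ 2 * (phi * k_fun ^ 2 * h_seq j + 4 * (phi * k_fun ^ 2 * h_seq (j + 1)))"
    by (simp add: algebra_simps)
  also have "\<dots> = (k_fun ^ 2 * (phi5 * k_fun ^ 2 * v_seq j) + 5 * k_fun * (1 + 8 * t_fun) * (phi5 * k_fun ^ 2 * v_seq (j + 1))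
       + 5 * (1 + 20 * t_fun + 80 * t_fun ^ 2) * (phi5 * k_fun ^ 2 * v_seq (j + 2)))
       - phi * k_fun ^ 2 * h_seq (j + 2) - (3 + 20 * t_fun) * k_fun * (phi * k_fun ^ 2 * h_seq (j + 1) + 4 * (phi * k_fun ^ 2 * h_seq (j + 2)))
       - k_fun ^ 2 * (phi * k_fun ^ 2 * h_seq j + 4 * (phi * k_fun ^ 2 * h_seq (j + 1)))"
    unfolding relation_h[symmetric] by (simp add: algebra_simps)
  also have "\<dots> = sig * (ev ([:1, 5:] * [:1, 5:] * a0 + [:5:] * [:1, 5:] * [:1, 8:] * a1 + [:5:] * [:1, 20, 80:] * a2)
      - ev b2 - ev ([:3, 20:] * [:1, 5:] * (b1 + [:4:] * b2)) - ev ([:1, 5:] * [:1, 5:] * (b0 + [:4:] * b1)))"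
    unfolding vals ev_mult ev_add ev_consts
    by (simp add: algebra_simps power2_eq_square)
  also have "\<dots> = 4 * (sig * ev b3)"
    unfolding b3[symmetric] ev_add by (simp add: ev_smult)
  finally have "phi * k_fun ^ 2 * h_seq (j + 3) = sig * ev b3"
    by (rule mult_left_cancel[THEN iffD1, rotated]) simp
  then show ?thesis by (simp add: h_val_def j)
qed

lemma v_h_values:
  "v_val 0 (alpha 0)" "v_val 1 (alpha 1)" "v_val 2 (alpha 2)" "v_val 3 (alpha 3)" "v_val 4 (alpha 4)" "v_val 5 (alpha 5)"
  "h_val 0 (beta 0)" "h_val 1 (beta 1)" "h_val 2 (beta 2)" "h_val 3 (beta 3)" "h_val 4 (beta 4)" "h_val 5 (beta 5)"
proof -
  show a0: "v_val 0 (alpha 0)" and a1: "v_val 1 (alpha 1)"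
    unfolding v_val_def v_0 v_1 by (simp_all add: alpha_def ev_simps e_fun_def k_fun_def algebra_simps)
  show b0: "h_val 0 (beta 0)" and b1: "h_val 1 (beta 1)" and b2: "h_val 2 (beta 2)"
    unfolding h_val_def h_0 h_1 h_2 by (simp_all add: beta_def ev_simps e_fun_def k_fun_def algebra_simps power2_eq_square)
  show a2: "v_val 2 (alpha 2)"
    by (rule v_step[OF a0 a1 b0 b1 b2]) (simp, simp, simp add: alpha_def beta_def)
  show b3: "h_val 3 (beta 3)"
    by (rule h_step[OF a0 a1 a2 b0 b1 b2]) (simp, simp, simp, simp add: alpha_def beta_def)
  show a3: "v_val 3 (alpha 3)"
    by (rule v_step[OF a1 a2 b1 b2 b3]) (simp, simp, simp add: alpha_def beta_def)
  show b4: "h_val 4 (beta 4)"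
    by (rule h_step[OF a1 a2 a3 b1 b2 b3]) (simp, simp, simp, simp add: alpha_def beta_def)
  show a4: "v_val 4 (alpha 4)"
    by (rule v_step[OF a2 a3 b2 b3 b4]) (simp, simp, simp add: alpha_def beta_def)
  show b5: "h_val 5 (beta 5)"
    by (rule h_step[OF a2 a3 a4 b2 b3 b4]) (simp, simp, simp, simp add: alpha_def beta_def)
  show "v_val 5 (alpha 5)"
    by (rule v_step[OF a3 a4 b3 b4 b5]) (simp, simp, simp add: alpha_def beta_def)
qed

text \<open>
  Since \<open>f0 = F1 + 4 F1 t\<close>, the image of \<open>f0 t^j\<close> involves \<open>alpha_j + 4 alpha_(j+1)\<close>, which must be
  divided by \<open>1 + 4t\<close> to write the result as a multiple of \<open>g0\<close>.
\<close>

definition trans_A :: "nat \<Rightarrow> int poly" where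
  "trans_A j = [
     [:-1:],
     [:3, 115, 1220, 5200, 8000:],
     [:1, 626, 36185, 841800, 10558000, 79720000, 376000000, 1091200000, 1792000000, 1280000000:],
     [:0, 821, 170110, 11019925, 360515500, 7171870000, 95190600000, 886763200000, 5954432000000, 29100480000000, 102944000000000, 257536000000000, 433152000000000, 440320000000000, 204800000000000:],
     [:0, 460, 322185, 49362850, 3387684625, 134585447500, 3514184550000, 64876279000000, 886105520000000, 9218371600000000, 74395089600000000, 470590086400000000, 2341722368000000000, 9141506560000000000, 27718604800000000000, 64037888000000000000, 109035520000000000000, 129105920000000000000, 95027200000000000000, 32768000000000000000:]] ! j"

definition trans_B :: "nat \<Rightarrow> int poly" where
  "trans_B j = [
     [:-1:],
     [:1, 5:],
     [:1, 170, 4425, 48000, 262000, 720000, 800000:],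
     [:0, 385, 43950, 1723425, 35042500, 431860000, 3465200000, 18636000000, 67040000000, 155520000000, 211200000000, 128000000000:],
     [:0, 290, 121915, 12433000, 591679375, 16582130000, 306720700000, 3991780000000, 37953252000000, 269282560000000, 1438912000000000, 5782272000000000, 17248640000000000, 37120000000000000, 54579200000000000, 49152000000000000, 20480000000000000:]] ! j"

lemma f0_step:
  assumes "v_val j a" "v_val (Suc j) a'" "[:1, 4:] * p = a + [:4:] * a'"
  shows "dissect 5 2 (f0 * t_fun ^ j) = g0 * ev p"
proof -
  have "f0 * t_fun ^ j = F1 * t_fun ^ j + fps_const 4 * (F1 * t_fun ^ Suc j)"
    by (simp add: f0_def e_fun_def numeral_fps_const algebra_simps)
  then have sec: "dissect 5 2 (f0 * t_fun ^ j) = v_seq j + fps_const 4 * v_seq (Suc j)"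
    by (metis v_seq_def dissect_linear(1) dissect_linear(5))
  have "(phi5 * k_fun ^ 2) * dissect 5 2 (f0 * t_fun ^ j)
      = phi5 * k_fun ^ 2 * v_seq j + 4 * (phi5 * k_fun ^ 2 * v_seq (Suc j))"
    unfolding sec by (simp add: numeral_fps_const algebra_simps)
  also have "\<dots> = sig * ev (a + [:4:] * a')"
    using assms(1,2) by (simp add: v_val_def ev_add ev_smult algebra_simps)
  also have "\<dots> = (G1 * (phi5 * k_fun ^ 2)) * (e_fun * ev p)"
    unfolding assms(3)[symmetric] G1 by (simp only: ev_mult ev_consts)
  finally have "(phi5 * k_fun ^ 2) * dissect 5 2 (f0 * t_fun ^ j) = (phi5 * k_fun ^ 2) * (g0 * ev p)"
    by (simp only: g0_def mult_ac)
  then show ?thesis by (rule mult_left_cancel[THEN iffD1, rotated]) simp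
qed

lemma g0_step:
  assumes "h_val j a" "h_val (Suc j) a'" "[:1, 4:] * p = a + [:4:] * a'"
  shows "dissect 5 2 (g0 * t_fun ^ j) = f0 * ev p"
proof -
  have "g0 * t_fun ^ j = G1 * t_fun ^ j + fps_const 4 * (G1 * t_fun ^ Suc j)"
    by (simp add: g0_def e_fun_def numeral_fps_const algebra_simps)
  then have sec: "dissect 5 2 (g0 * t_fun ^ j) = h_seq j + fps_const 4 * h_seq (Suc j)"
    by (metis h_seq_def dissect_linear(1) dissect_linear(5))
  have "(phi * k_fun ^ 2) * dissect 5 2 (g0 * t_fun ^ j)
      = phi * k_fun ^ 2 * h_seq j + 4 * (phi * k_fun ^ 2 * h_seq (Suc j))"
    unfolding sec by (simp add: numeral_fps_const algebra_simps)
  also have "\<dots> = sig * ev (a + [:4:] * a')"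
    using assms(1,2) by (simp add: h_val_def ev_add ev_smult algebra_simps)
  also have "\<dots> = (F1 * (phi * k_fun ^ 2)) * (e_fun * ev p)"
    unfolding assms(3)[symmetric] F1 by (simp only: ev_mult ev_consts)
  finally have "(phi * k_fun ^ 2) * dissect 5 2 (g0 * t_fun ^ j) = (phi * k_fun ^ 2) * (f0 * ev p)"
    by (simp only: f0_def mult_ac)
  then show ?thesis by (rule mult_left_cancel[THEN iffD1, rotated]) simp
qed

lemma trans_A_eqs:
  "[:1, 4:] * trans_A 0 = alpha 0 + [:4:] * alpha 1" "[:1, 4:] * trans_A 1 = alpha 1 + [:4:] * alpha 2"
  "[:1, 4:] * trans_A 2 = alpha 2 + [:4:] * alpha 3" "[:1, 4:] * trans_A 3 = alpha 3 + [:4:] * alpha 4"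
  "[:1, 4:] * trans_A 4 = alpha 4 + [:4:] * alpha 5"
  by (simp_all add: trans_A_def alpha_def)

lemma trans_B_eqs:
  "[:1, 4:] * trans_B 0 = beta 0 + [:4:] * beta 1" "[:1, 4:] * trans_B 1 = beta 1 + [:4:] * beta 2"
  "[:1, 4:] * trans_B 2 = beta 2 + [:4:] * beta 3" "[:1, 4:] * trans_B 3 = beta 3 + [:4:] * beta 4"
  "[:1, 4:] * trans_B 4 = beta 4 + [:4:] * beta 5"
  by (simp_all add: trans_B_def beta_def)

lemma less_5_cases: "j < 5 \<Longrightarrow> j = 0 \<or> j = 1 \<or> j = 2 \<or> j = 3 \<or> j = (4 :: nat)"
  by auto

lemma trans_A: "j < 5 \<Longrightarrow> dissect 5 2 (f0 * t_fun ^ j) = g0 * ev (trans_A j)"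
  using less_5_cases[of j] f0_step[OF v_h_values(1) _ trans_A_eqs(1)] f0_step[OF v_h_values(2) _ trans_A_eqs(2)]
    f0_step[OF v_h_values(3) _ trans_A_eqs(3)] f0_step[OF v_h_values(4) _ trans_A_eqs(4)]
    f0_step[OF v_h_values(5) _ trans_A_eqs(5)] v_h_values(2-6)
  by (auto simp: eval_nat_numeral)

lemma trans_B: "j < 5 \<Longrightarrow> dissect 5 2 (g0 * t_fun ^ j) = f0 * ev (trans_B j)"
  using less_5_cases[of j] g0_step[OF v_h_values(7) _ trans_B_eqs(1)] g0_step[OF v_h_values(8) _ trans_B_eqs(2)]
    g0_step[OF v_h_values(9) _ trans_B_eqs(3)] g0_step[OF v_h_values(10) _ trans_B_eqs(4)]
    g0_step[OF v_h_values(11) _ trans_B_eqs(5)] v_h_values(8-12)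
  by (auto simp: eval_nat_numeral)

definition start_poly :: "int poly" where "start_poly = [:18, 720, 7625, 32500, 50000:]"

lemma transfer_start: "dissect 5 2 (sig * inverse phi) = g0 * ev start_poly"
proof -
  have "F1 * k_fun ^ 2 = F1 * k_fun ^ 2 * (phi * inverse phi)" using phi_inverse(1)[of 1] by simp
  also have "\<dots> = (F1 * (phi * k_fun ^ 2)) * inverse phi" by (simp only: mult_ac)
  finally have "sig * inverse phi = F1 * k_fun ^ 2" by (simp only: F1)
  also have "\<dots> = F1 * t_fun ^ 0 + fps_const 10 * (F1 * t_fun ^ 1) + fps_const 25 * (F1 * t_fun ^ 2)"
    by (simp add: k_fun_def numeral_fps_const algebra_simps power2_eq_square)
  finally have sec: "dissect 5 2 (sig * inverse phi) = v_seq 0 + fps_const 10 * v_seq 1 + fps_const 25 * v_seq 2"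
    by (simp only: dissect_linear v_seq_def)
  have "(phi5 * k_fun ^ 2) * dissect 5 2 (sig * inverse phi)
      = phi5 * k_fun ^ 2 * v_seq 0 + 10 * (phi5 * k_fun ^ 2 * v_seq 1) + 25 * (phi5 * k_fun ^ 2 * v_seq 2)"
    unfolding sec by (simp add: numeral_fps_const algebra_simps)
  also have "\<dots> = sig * ev (alpha 0 + smult 10 (alpha 1) + smult 25 (alpha 2))"
    using v_h_values(1-3) unfolding v_val_def by (simp add: ev_add ev_smult algebra_simps)
  also have "alpha 0 + smult 10 (alpha 1) + smult 25 (alpha 2) = [:1, 4:] * start_poly"
    by (simp add: alpha_def start_poly_def)
  also have "sig * ev \<dots> = (G1 * (phi5 * k_fun ^ 2)) * (e_fun * ev start_poly)"
    unfolding G1 by (simp only: ev_mult ev_consts)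
  finally have "(phi5 * k_fun ^ 2) * dissect 5 2 (sig * inverse phi) = (phi5 * k_fun ^ 2) * (g0 * ev start_poly)"
    by (simp only: g0_def mult_ac)
  then show ?thesis by (rule mult_left_cancel[THEN iffD1, rotated]) simp
qed

section \<open>Powers of five dividing the images\<close>

text \<open>
  The coefficients of the modular equation, as polynomials in \<open>T5\<close>. They lie in series of \<open>q^5\<close>, hence the
  images of all powers of \<open>t\<close> under \<open>U\<close> obey the recurrence with \<open>T5\<close> replaced by \<open>t\<close>.
\<close>

definition mod_coeff :: "nat \<Rightarrow> int poly" where
  "mod_coeff k =
     [[:0, 1, 20, 150, 500, 625:],
      [:0, 15, 305, 2325, 7875, 10000:],
      [:0, 85, 1750, 13525, 46500, 60000:],
      [:0, 215, 4475, 35000, 122000, 160000:],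
      [:0, 205, 4300, 34000, 120000, 160000:]] ! k"

lemma modular_recursion:
  "t_fun ^ (n + 5) = (\<Sum>k<5. (ev (mod_coeff k) oo fps_X ^ 5) * t_fun ^ (n + k))"
proof -
  have "t_fun ^ 5 = (\<Sum>k<5. (ev (mod_coeff k) oo fps_X ^ 5) * t_fun ^ k)"
  proof -
    have "{..<5::nat} = {0, 1, 2, 3, 4}" by auto
    then show ?thesis unfolding modular_equation
      by (simp add: mod_coeff_def ev_simps fps_compose_add_distrib dilate_mult dilate_numeral T5_def[symmetric])
        (simp add: algebra_simps eval_nat_numeral)
  qed
  then show ?thesis by (simp add: power_add sum_distrib_left mult_ac)
qed

text \<open>
  The power of \<open>5\<close> guaranteed in the coefficient of \<open>t^i\<close> of the image of \<open>t^j\<close>, with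
  \<open>\<epsilon> = 0\<close> for the step from \<open>f0\<close> to \<open>g0\<close> and \<open>\<epsilon> = 1\<close> for the step back. It is a difference
  of a weight of \<open>i\<close> and a weight of \<open>j\<close>, so that it adds up along the recurrence; truncated subtraction
  means that nothing is claimed where the difference is negative. Constant terms are exempt from all conditions.
\<close>

definition level :: "nat \<Rightarrow> nat \<Rightarrow> nat \<Rightarrow> nat" where
  "level \<epsilon> i j = (i + 1 + \<epsilon>) div 2 - (j - \<epsilon>) div 2"

definition tame :: "nat \<Rightarrow> nat \<Rightarrow> int poly \<Rightarrow> bool" where
  "tame \<epsilon> j p \<longleftrightarrow> (\<forall>i\<ge>1. 5 ^ level \<epsilon> i j dvd coeff p i)"

lemma tame_check:
  assumes "degree p < N" "\<forall>i\<in>set [1..<N]. 5 ^ level \<epsilon> i j dvd coeff p i"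
  shows "tame \<epsilon> j p"
  unfolding tame_def
proof (intro allI impI)
  fix i :: nat assume "i \<ge> 1"
  show "5 ^ level \<epsilon> i j dvd coeff p i"
    using assms \<open>i \<ge> 1\<close> by (cases "i < N") (auto simp: coeff_eq_0)
qed

lemma tame_trans_A: "j < 5 \<Longrightarrow> tame 0 j (trans_A j)"
proof -
  have "\<forall>j\<in>set [0..<5]. degree (trans_A j) < 25 \<and> (\<forall>i\<in>set [1..<25]. 5 ^ level 0 i j dvd coeff (trans_A j) i)"
    by code_simp
  then show "j < 5 \<Longrightarrow> tame 0 j (trans_A j)" by (intro tame_check[of _ 25]) auto
qed

lemma tame_trans_B: "j < 5 \<Longrightarrow> tame 1 j (trans_B j)"
proof -
  have "\<forall>j\<in>set [0..<5]. degree (trans_B j) < 25 \<and> (\<forall>i\<in>set [1..<25]. 5 ^ level 1 i j dvd coeff (trans_B j) i)"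
    by code_simp
  then show "j < 5 \<Longrightarrow> tame 1 j (trans_B j)" by (intro tame_check[of _ 25]) auto
qed

lemma mod_coeff_dvd:
  assumes "k < 5"
  shows "coeff (mod_coeff k) 0 = 0" "i > 5 \<Longrightarrow> coeff (mod_coeff k) i = 0"
    "5 ^ (if k = 0 then i div 2 else (i + 1) div 2) dvd coeff (mod_coeff k) i"
proof -
  have *: "\<forall>k\<in>set [0..<5]. degree (mod_coeff k) < 6 \<and> coeff (mod_coeff k) 0 = 0
      \<and> (\<forall>i\<in>set [0..<6]. 5 ^ (if k = 0 then i div 2 else (i + 1) div 2) dvd coeff (mod_coeff k) i)"
    by code_simp
  then show "coeff (mod_coeff k) 0 = 0" using assms by auto
  have "degree (mod_coeff k) < 6" using * assms by auto
  then show 1: "i > 5 \<Longrightarrow> coeff (mod_coeff k) i = 0" for i by (intro coeff_eq_0) simp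
  show "5 ^ (if k = 0 then i div 2 else (i + 1) div 2) dvd coeff (mod_coeff k) i"
    using * assms 1[of i] by (cases "i > 5") auto
qed

text \<open>
  Five steps of the recurrence in \<open>j\<close> cost at most the weight supplied by the coefficient of \<open>t^m\<close> in
  \<open>mod_coeff k\<close>. The case \<open>i = m\<close> is separate because it involves the constant term of the polynomial
  before, of which nothing is known.
\<close>

lemma level_step:
  assumes "\<epsilon> \<le> 1" "k < 5" "1 \<le> m" "m \<le> 5" "m \<le> i"
  shows "level \<epsilon> i (n + 5) \<le> (if k = 0 then m div 2 else (m + 1) div 2)
    + (if i = m then 0 else level \<epsilon> (i - m) (n + k))"
proof -
  have "\<epsilon> = 0 \<or> \<epsilon> = 1" using assms by auto
  then show ?thesis
    using assms(2-5) unfolding level_def by (cases "k = 0"; cases "i = m") (auto; presburger)+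
qed

lemma tame_mod_coeff_mult:
  assumes "\<epsilon> \<le> 1" "k < 5" "tame \<epsilon> (n + k) p"
  shows "tame \<epsilon> (n + 5) (mod_coeff k * p)"
  unfolding tame_def
proof (intro allI impI)
  fix i :: nat assume "i \<ge> 1"
  show "5 ^ level \<epsilon> i (n + 5) dvd coeff (mod_coeff k * p) i"
    unfolding coeff_mult
  proof (rule dvd_sum)
    fix m assume "m \<in> {..i}"
    show "5 ^ level \<epsilon> i (n + 5) dvd coeff (mod_coeff k) m * coeff p (i - m)"
    proof (cases "1 \<le> m \<and> m \<le> 5")
      case True
      let ?d = "if k = 0 then m div 2 else (m + 1) div 2"
      let ?l = "if i = m then 0 else level \<epsilon> (i - m) (n + k)"
      have "(5 :: int) ^ level \<epsilon> i (n + 5) dvd 5 ^ (?d + ?l)"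
        using True \<open>m \<in> {..i}\<close> assms by (intro le_imp_power_dvd level_step) auto
      also have "(5 :: int) ^ (?d + ?l) dvd coeff (mod_coeff k) m * coeff p (i - m)"
        unfolding power_add
      proof (rule mult_dvd_mono)
        show "(5 :: int) ^ ?d dvd coeff (mod_coeff k) m" by (rule mod_coeff_dvd(3)[OF assms(2)])
        show "(5 :: int) ^ ?l dvd coeff p (i - m)"
          using assms(3) \<open>m \<in> {..i}\<close> by (auto simp: tame_def)
      qed
      finally show ?thesis .
    next
      case False
      then have "m = 0 \<or> m > 5" by auto
      then show ?thesis using mod_coeff_dvd(1,2)[OF assms(2)] by auto
    qed
  qed
qed

lemma tame_add: "tame \<epsilon> j p \<Longrightarrow> tame \<epsilon> j q \<Longrightarrow> tame \<epsilon> j (p + q)"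
  by (simp add: tame_def)

lemma tame_sum: "(\<And>k. k \<in> A \<Longrightarrow> tame \<epsilon> j (p k)) \<Longrightarrow> tame \<epsilon> j (\<Sum>k\<in>A. p k)"
  by (induction A rule: infinite_finite_induct) (auto simp: tame_add, auto simp: tame_def)

definition tame_transfer :: "nat \<Rightarrow> complex fps \<Rightarrow> complex fps \<Rightarrow> bool" where
  "tame_transfer \<epsilon> f g \<longleftrightarrow> (\<forall>j. \<exists>p. dissect 5 2 (f * t_fun ^ j) = g * ev p \<and> tame \<epsilon> j p)"

lemma tame_transferI:
  assumes "\<epsilon> \<le> 1" and base: "\<And>j. j < 5 \<Longrightarrow> \<exists>p. dissect 5 2 (f * t_fun ^ j) = g * ev p \<and> tame \<epsilon> j p"
  shows "tame_transfer \<epsilon> f g"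
  unfolding tame_transfer_def
proof
  fix j show "\<exists>p. dissect 5 2 (f * t_fun ^ j) = g * ev p \<and> tame \<epsilon> j p"
  proof (induction j rule: less_induct)
    case (less j)
    show ?case
    proof (cases "j < 5")
      case False
      define n where "n = j - 5"
      have j: "j = n + 5" using False by (simp add: n_def)
      have "\<forall>k\<in>{..<5}. \<exists>p. dissect 5 2 (f * t_fun ^ (n + k)) = g * ev p \<and> tame \<epsilon> (n + k) p"
        using less.IH j by auto
      then obtain p where p: "\<And>k. k < 5 \<Longrightarrow> dissect 5 2 (f * t_fun ^ (n + k)) = g * ev (p k)"
        "\<And>k. k < 5 \<Longrightarrow> tame \<epsilon> (n + k) (p k)"
        by (metis lessThan_iff)
      have "f * t_fun ^ j = (\<Sum>k<5. (ev (mod_coeff k) oo fps_X ^ 5) * (f * t_fun ^ (n + k)))"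
        unfolding j modular_recursion by (simp add: sum_distrib_left mult_ac)
      then have "dissect 5 2 (f * t_fun ^ j) = (\<Sum>k<5. ev (mod_coeff k) * dissect 5 2 (f * t_fun ^ (n + k)))"
        by (simp only: dissect_sum dissect_t_dilate)
      also have "\<dots> = g * ev (\<Sum>k<5. mod_coeff k * p k)"
        by (simp add: p ev_sum ev_mult sum_distrib_left mult_ac)
      finally have "dissect 5 2 (f * t_fun ^ j) = g * ev (\<Sum>k<5. mod_coeff k * p k)" .
      moreover have "tame \<epsilon> j (\<Sum>k<5. mod_coeff k * p k)"
        unfolding j using assms(1) p by (intro tame_sum tame_mod_coeff_mult) auto
      ultimately show ?thesis by blast
    qed (use base in blast)
  qed
qed

lemma tame_transfer_f0: "tame_transfer 0 f0 g0"
  by (rule tame_transferI) (use trans_A tame_trans_A in blast)+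

lemma tame_transfer_g0: "tame_transfer 1 g0 f0"
  by (rule tame_transferI) (use trans_B tame_trans_B in blast)+

text \<open>
  The weights of \<open>j\<close> subtracted in \<open>level\<close> are compensated by assuming the coefficient of \<open>t^j\<close> divisible
  by the corresponding power of \<open>5\<close>.
\<close>

definition lattice :: "nat \<Rightarrow> int poly \<Rightarrow> bool" where
  "lattice \<epsilon> p \<longleftrightarrow> (\<forall>i. 5 ^ ((i - \<epsilon>) div 2) dvd coeff p i)"

text \<open>
  The weight \<open>(i + 1 + \<epsilon>) div 2\<close> gained at \<open>t^i\<close>, \<open>i \<ge> 1\<close>, exceeds the weight
  \<open>(i - (1 - \<epsilon>)) div 2\<close> required on the other side by one. This is the factor \<open>5\<close> gained in each
  application of \<open>U\<close>, everywhere but in the constant term \<open>c\<close>.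
\<close>

lemma lattice_transfer:
  assumes "tame_transfer \<epsilon> f g" "\<epsilon> \<le> 1" "lattice \<epsilon> q"
  shows "\<exists>c r. dissect 5 2 (f * ev q) = of_int c * g + 5 * (g * ev r) \<and> lattice (1 - \<epsilon>) r"
proof -
  obtain p where p: "\<And>j. dissect 5 2 (f * t_fun ^ j) = g * ev (p j)" "\<And>j. tame \<epsilon> j (p j)"
    using assms(1) unfolding tame_transfer_def by metis
  define Q where "Q = (\<Sum>j\<le>degree q. smult (coeff q j) (p j))"
  have "f * ev q = (\<Sum>j\<le>degree q. fps_const (of_int (coeff q j)) * (f * t_fun ^ j))"
    by (simp add: ev_altdef sum_distrib_left fps_of_int mult_ac)
  then have "dissect 5 2 (f * ev q) = (\<Sum>j\<le>degree q. fps_const (of_int (coeff q j)) * (g * ev (p j)))"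
    by (simp only: dissect_sum dissect_linear p)
  also have "\<dots> = g * ev Q"
    by (simp add: Q_def ev_sum ev_smult sum_distrib_left fps_of_int mult_ac)
  finally have sec: "dissect 5 2 (f * ev q) = g * ev Q" .
  have Q: "5 ^ ((i + 1 + \<epsilon>) div 2) dvd coeff Q i" if "i \<ge> 1" for i
    unfolding Q_def coeff_sum coeff_smult
  proof (rule dvd_sum)
    fix j
    have "(i + 1 + \<epsilon>) div 2 \<le> (j - \<epsilon>) div 2 + level \<epsilon> i j" by (simp add: level_def)
    then have "(5 :: int) ^ ((i + 1 + \<epsilon>) div 2) dvd 5 ^ ((j - \<epsilon>) div 2) * 5 ^ level \<epsilon> i j"
      unfolding power_add[symmetric] by (rule le_imp_power_dvd)
    also have "\<dots> dvd coeff q j * coeff (p j) i"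
      using assms(3) p(2)[of j] that by (intro mult_dvd_mono) (auto simp: lattice_def tame_def)
    finally show "5 ^ ((i + 1 + \<epsilon>) div 2) dvd coeff q j * coeff (p j) i" .
  qed
  define c where "c = coeff Q 0"
  define r where "r = map_poly (\<lambda>x. x div 5) (Q - [:c:])"
  have r: "coeff r i = (if i = 0 then 0 else coeff Q i div 5)" for i
    by (cases i) (simp_all add: r_def coeff_map_poly c_def)
  have "(5 :: int) dvd 5 ^ ((i + 1 + \<epsilon>) div 2)" if "i \<ge> 1" for i
    using that by (intro dvd_power) auto
  then have "5 dvd coeff Q i" if "i \<ge> 1" for i
    using Q[OF that] that dvd_trans by blast
  then have "Q = [:c:] + smult 5 r"
    by (intro poly_eqI) (auto simp: r c_def coeff_pCons split: nat.splits)
  then have "dissect 5 2 (f * ev q) = of_int c * g + 5 * (g * ev r)"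
    unfolding sec by (simp add: ev_add ev_smult ev_pCons ev_0 algebra_simps)
  moreover have "lattice (1 - \<epsilon>) r"
    unfolding lattice_def r
  proof
    fix i
    show "5 ^ ((i - (1 - \<epsilon>)) div 2) dvd (if i = 0 then 0 else coeff Q i div 5)"
    proof (cases "i = 0")
      case False
      have "(i + 1 + \<epsilon>) div 2 = Suc ((i - (1 - \<epsilon>)) div 2)"
      proof -
        have "\<epsilon> = 0 \<or> \<epsilon> = 1" using assms(2) by auto
        then show ?thesis using False by auto
      qed
      then have "5 * 5 ^ ((i - (1 - \<epsilon>)) div 2) dvd coeff Q i" using Q[of i] False by simp
      then show ?thesis using False by (auto elim!: dvdE)
    qed simp
  qed
  ultimately show ?thesis by blast
qed

section \<open>Congruences for iterates of U\<close>

definition base_form :: "nat \<Rightarrow> complex fps" where "base_form l = (if odd l then g0 else f0)"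

definition approximates :: "nat \<Rightarrow> int \<Rightarrow> complex fps \<Rightarrow> bool" where
  "approximates l c f \<longleftrightarrow> (\<exists>q. lattice (l mod 2) q \<and> f = of_int c * base_form l + 5 ^ l * (base_form l * ev q))"

text \<open>
  The term \<open>c h_l\<close> is mapped to \<open>-c h_(l+1)\<close> exactly, and only the remainder, already divisible by \<open>5^l\<close>,
  changes the constant and gains a further factor \<open>5\<close>.
\<close>

lemma approximates_step:
  assumes "approximates l c f"
  shows "\<exists>d. approximates (Suc l) (5 ^ l * d - c) (dissect 5 2 f)"
proof -
  obtain q where q: "lattice (l mod 2) q" "f = of_int c * base_form l + 5 ^ l * (base_form l * ev q)"
    using assms by (auto simp: approximates_def)
  have base: "dissect 5 2 (base_form l) = - base_form (Suc l)"
    by (simp add: base_form_def U_f0 U_g0)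
  have "tame_transfer (l mod 2) (base_form l) (base_form (Suc l))"
    using tame_transfer_f0 tame_transfer_g0 by (cases "odd l") (simp_all add: base_form_def odd_iff_mod_2_eq_one)
  moreover have "l mod 2 \<le> 1" by presburger
  ultimately obtain d r
    where r: "dissect 5 2 (base_form l * ev q) = of_int d * base_form (Suc l) + 5 * (base_form (Suc l) * ev r)"
      "lattice (1 - l mod 2) r" using lattice_transfer q(1) by blast
  have "f = fps_const (of_int c) * base_form l + fps_const (5 ^ l) * (base_form l * ev q)"
    unfolding q(2) by (simp add: fps_of_int numeral_fps_const fps_const_power)
  then have "dissect 5 2 f = fps_const (of_int c) * (- base_form (Suc l))
      + fps_const (5 ^ l) * (of_int d * base_form (Suc l) + 5 * (base_form (Suc l) * ev r))"
    by (simp only: dissect_linear base r(1))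
  also have "\<dots> = of_int (5 ^ l * d - c) * base_form (Suc l) + 5 ^ Suc l * (base_form (Suc l) * ev r)"
    by (simp add: fps_of_int[symmetric] numeral_fps_const fps_const_power algebra_simps
        flip: fps_const_mult fps_const_sub fps_const_power fps_const_neg)
  finally have "dissect 5 2 f = of_int (5 ^ l * d - c) * base_form (Suc l) + 5 ^ Suc l * (base_form (Suc l) * ev r)" .
  moreover have "1 - l mod 2 = Suc l mod 2" by presburger
  ultimately show ?thesis using r(2) unfolding approximates_def by auto
qed

text \<open>
  The congruences need integral coefficients of \<open>h_l r(t)\<close>, although all series have complex coefficients.
\<close>

definition int_fps :: "complex fps \<Rightarrow> bool" where "int_fps f \<longleftrightarrow> (\<forall>n. f $ n \<in> \<int>)"

lemma int_fps_mult: "int_fps f \<Longrightarrow> int_fps g \<Longrightarrow> int_fps (f * g)"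
  by (auto simp: int_fps_def fps_mult_nth intro!: Ints_sum Ints_mult)

lemma int_fps_add: "int_fps f \<Longrightarrow> int_fps g \<Longrightarrow> int_fps (f + g)" "int_fps f \<Longrightarrow> int_fps g \<Longrightarrow> int_fps (f - g)"
  by (simp_all add: int_fps_def)

lemma int_fps_const: "int_fps (of_int c)" "int_fps (numeral k)" "int_fps 1" "int_fps fps_X"
  by (auto simp: int_fps_def fps_of_int[symmetric] fps_numeral_nth fps_X_def)

lemma int_fps_power: "int_fps f \<Longrightarrow> int_fps (f ^ k)"
  by (induction k) (simp_all add: int_fps_mult int_fps_const)

lemma int_fps_inverse:
  assumes "int_fps f" "f $ 0 = 1"
  shows "int_fps (inverse f)"
proof -
  have "inverse f $ n \<in> \<int>" for n
  proof (induction n rule: less_induct)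
    case (less n)
    show ?case
    proof (cases n)
      case 0
      then show ?thesis using assms by simp
    next
      case (Suc m)
      have "(f * inverse f) $ n = 0"
        using inverse_mult_eq_1'[of f] assms Suc by simp
      then have "0 = (\<Sum>i=0..n. f $ i * inverse f $ (n - i))" by (simp only: fps_mult_nth)
      also have "\<dots> = inverse f $ n + (\<Sum>i=1..n. f $ i * inverse f $ (n - i))"
        using assms by (subst sum.atLeast_Suc_atMost) simp_all
      finally have "inverse f $ n = - (\<Sum>i=1..n. f $ i * inverse f $ (n - i))"
        by (simp add: eq_neg_iff_add_eq_0)
      moreover have "(\<Sum>i=1..n. f $ i * inverse f $ (n - i)) \<in> \<int>"
        using assms less.IH by (intro Ints_sum Ints_mult) (auto simp: int_fps_def)
      ultimately show ?thesis by simp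
    qed
  qed
  then show ?thesis by (simp add: int_fps_def)
qed

lemma int_fps_theta: "int_fps (theta (-1) a b)"
  by (auto simp: int_fps_def theta_def formal_sum_def minus_one_powi intro!: Ints_sum)

lemma int_fps_t_fun: "int_fps t_fun"
  unfolding t_fun_def s_fun_def phi_def phi5_def
  by (intro int_fps_mult int_fps_power int_fps_inverse int_fps_theta int_fps_const)
    (simp_all add: fps_nth_power_0 theta_nth_0 del: One_nat_def)

lemma int_fps_sig: "int_fps sig"
  by (simp add: int_fps_def sig_def sigma_odd_series_def)

lemma int_fps_base: "int_fps (base_form l)"
proof -
  have k: "int_fps k_fun" "int_fps e_fun"
    unfolding k_fun_def e_fun_def by (intro int_fps_add int_fps_mult int_fps_const int_fps_t_fun)+
  have "int_fps phi" "int_fps phi5" by (simp_all add: phi_def phi5_def int_fps_theta)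
  then have "int_fps f0" "int_fps g0"
    unfolding f0_def g0_def F1_def G1_def using k
    by (auto intro!: int_fps_mult int_fps_inverse int_fps_sig int_fps_power simp: fps_nth_power_0)
  then show ?thesis by (simp add: base_form_def)
qed

lemma int_fps_ev: "int_fps (ev p)"
  by (induction p) (auto simp: ev_simps int_fps_const int_fps_t_fun intro!: int_fps_add int_fps_mult,
      simp add: int_fps_def)

lemma approximates_dissect:
  assumes "l \<ge> 1"
  shows "\<exists>c. approximates l c ((dissect 5 2 ^^ l) (sig * inverse phi))"
  using assms
proof (induction l rule: dec_induct)
  case base
  define q :: "int poly" where "q = [:0, 144, 1525, 6500, 10000:]"
  have eq: "start_poly = [:18:] + smult 5 q" by (simp add: start_poly_def q_def)
  have "dissect 5 2 (sig * inverse phi) = of_int 18 * base_form 1 + 5 ^ 1 * (base_form 1 * ev q)"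
    unfolding transfer_start eq by (simp add: base_form_def ev_add ev_smult ev_pCons ev_0 algebra_simps)
  moreover have "lattice 1 q"
  proof -
    let ?p = "[:0, 144, 1525, 6500, 10000:] :: int poly"
    have *: "degree ?p < 5 \<and> (\<forall>i\<in>set [0..<5]. 5 ^ ((i - 1) div 2) dvd coeff ?p i)" by code_simp
    show ?thesis unfolding lattice_def q_def
    proof
      fix i show "5 ^ ((i - 1) div 2) dvd coeff ?p i"
        using * by (cases "i < 5") (auto simp del: coeff_pCons_Suc simp: coeff_eq_0)
    qed
  qed
  ultimately show ?case unfolding approximates_def by (intro exI[of _ "18 :: int"] exI[of _ q]) auto
next
  case (step l)
  then show ?case using approximates_step by fastforce
qed

text \<open>
  By two applications of \<open>approximates_step\<close> the constants for \<open>l\<close> and \<open>l + 2\<close> agree modulo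
  \<open>5^l\<close>, and the base forms are the same. For even \<open>l\<close> the base form is \<open>f0\<close>, and \<open>f0_sections\<close>
  leaves only the remainder at \<open>5n + 1\<close> and \<open>5n + 3\<close>.
\<close>

theorem congruences_of_phi_quotient:
  fixes a :: "nat \<Rightarrow> nat"
  assumes a: "Abs_fps (\<lambda>n. of_nat (a (2 * n + 1))) * phi = sig" and l: "l \<ge> 1"
  shows "[a (5 ^ (l + 2) * (2 * n + 1)) = a (5 ^ l * (2 * n + 1))] (mod 5 ^ l)"
    and "r \<in> {1, 3} \<Longrightarrow> even l \<Longrightarrow> 5 ^ l dvd a (5 ^ l * (2 * (5 * n + r) + 1))"
proof -
  define B where "B l = (Abs_fps (\<lambda>n. of_nat (a (5 ^ l * (2 * n + 1)))) :: complex fps)" for l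
  have B0: "B 0 = sig * inverse phi"
  proof -
    have inv: "phi * inverse phi = 1" using phi_inverse(1)[of 1] by (simp only: power_one_right)
    have "B 0 = (B 0 * phi) * inverse phi" by (simp only: mult.assoc inv mult_1_right)
    also have "B 0 * phi = sig" using a by (simp add: B_def)
    finally show ?thesis .
  qed
  have BS: "B (Suc l) = dissect 5 2 (B l)" for l
    by (simp add: B_def fps_eq_iff algebra_simps)
  have B: "B l = (dissect 5 2 ^^ l) (sig * inverse phi)" for l
    by (induction l) (simp_all add: B0 BS)
  obtain c where c: "approximates l c (B l)" using approximates_dissect[OF l] B by metis
  obtain d where d: "approximates (Suc l) (5 ^ l * d - c) (B (Suc l))"
    using approximates_step[OF c] BS by metis
  obtain d' where d': "approximates (Suc (Suc l)) (5 ^ Suc l * d' - (5 ^ l * d - c)) (B (Suc (Suc l)))"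
    using approximates_step[OF d] BS by metis
  obtain q where q: "B l = of_int c * base_form l + 5 ^ l * (base_form l * ev q)"
    using c by (auto simp: approximates_def)
  obtain q' where q': "B (Suc (Suc l)) = of_int (5 ^ Suc l * d' - (5 ^ l * d - c)) * base_form l
      + 5 ^ Suc (Suc l) * (base_form l * ev q')"
    using d' by (auto simp: approximates_def base_form_def)
  define D where "D = of_int (5 * d' - d) * base_form l + 25 * (base_form l * ev q') - base_form l * ev q"
  have "B (Suc (Suc l)) - B l = 5 ^ l * D"
    unfolding q q' D_def by (simp add: algebra_simps)
  then have "B (Suc (Suc l)) $ n - B l $ n = 5 ^ l * D $ n"
    by (metis fps_mult_left_const_nth fps_const_power fps_sub_nth numeral_fps_const)
  moreover have "D $ n \<in> \<int>"
  proof -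
    have "int_fps D" unfolding D_def
      by (intro int_fps_add int_fps_mult int_fps_const int_fps_base int_fps_ev)
    then show ?thesis by (simp add: int_fps_def)
  qed
  then obtain z where "D $ n = of_int z" by (auto elim: Ints_cases)
  ultimately have "complex_of_int (int (a (5 ^ (l + 2) * (2 * n + 1))) - int (a (5 ^ l * (2 * n + 1)))) = of_int (5 ^ l * z)"
    by (simp add: B_def power_add mult_ac)
  then have "int (a (5 ^ (l + 2) * (2 * n + 1))) - int (a (5 ^ l * (2 * n + 1))) = 5 ^ l * z"
    by (simp only: of_int_eq_iff)
  then have "[int (a (5 ^ (l + 2) * (2 * n + 1))) = int (a (5 ^ l * (2 * n + 1)))] (mod int (5 ^ l))"
    by (simp add: cong_iff_dvd_diff)
  then show "[a (5 ^ (l + 2) * (2 * n + 1)) = a (5 ^ l * (2 * n + 1))] (mod 5 ^ l)"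
    by (simp only: cong_int_iff)
  assume r: "r \<in> {1, 3}" and "even l"
  have "base_form l $ (5 * n + r) = 0"
    using arg_cong[OF f0_sections(1), of "\<lambda>f. f $ n"] arg_cong[OF f0_sections(2), of "\<lambda>f. f $ n"] r \<open>even l\<close>
    by (auto simp: base_form_def)
  moreover have const: "(of_int c :: complex fps) = fps_const (of_int c)" "(5 :: complex fps) ^ l = fps_const (5 ^ l)"
    by (simp_all only: fps_of_int numeral_fps_const fps_const_power)
  ultimately have "B l $ (5 * n + r) = 5 ^ l * (base_form l * ev q) $ (5 * n + r)"
    unfolding q const by simp
  moreover have "(base_form l * ev q) $ (5 * n + r) \<in> \<int>"
    using int_fps_mult[OF int_fps_base int_fps_ev] by (simp add: int_fps_def)
  then obtain z where "(base_form l * ev q) $ (5 * n + r) = of_int z" by (auto elim: Ints_cases)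
  ultimately have "complex_of_int (int (a (5 ^ l * (2 * (5 * n + r) + 1)))) = of_int (5 ^ l * z)"
    by (simp add: B_def)
  then have "int (a (5 ^ l * (2 * (5 * n + r) + 1))) = int (5 ^ l) * z"
    by (simp only: of_int_eq_iff) simp
  then have "int (5 ^ l) dvd int (a (5 ^ l * (2 * (5 * n + r) + 1)))" by (metis dvd_triv_left)
  then show "5 ^ l dvd a (5 ^ l * (2 * (5 * n + r) + 1))" by (simp only: int_dvd_int_iff)
qed

section \<open>A telescoping sum\<close>

lemma gbinom_dilate: "gbinom (fps_X ^ 2) n k = (gbinom fps_X n k oo fps_X ^ 2 :: complex fps)"
proof (induction "fps_X :: complex fps" n k rule: gbinom.induct)
  case (3 n k)
  have "fps_X ^ Suc k oo fps_X ^ 2 = ((fps_X ^ 2) ^ Suc k :: complex fps)"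
    by (simp add: dilate_power del: power_Suc)
  then show ?case using 3 by (simp add: fps_compose_add_distrib dilate_mult)
qed simp_all

definition qf :: "nat \<Rightarrow> complex fps" where "qf n = qpoch fps_X n"

lemma qf_0 [simp]: "qf 0 = 1" and qf_Suc: "qf (Suc n) = qf n * (1 - fps_X ^ Suc n)"
  by (simp_all add: qf_def qpoch_Suc)

lemma qf_nth_0 [simp]: "qf n $ 0 = 1"
  using qpoch_nth_0[of 1 n, where 'a = complex] by (simp add: qf_def)

lemma qf_nonzero [simp]: "qf n \<noteq> 0"
  using qf_nth_0 by (metis fps_zero_nth zero_neq_one)

lemma qf_inverse: "qf n * inverse (qf n) = 1"
  by (intro inverse_mult_eq_1') simp

definition gauss_sign :: "int \<Rightarrow> complex" where
  "gauss_sign j = (if even j then (-1) powi (j div 2) else 0)"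

lemma gauss_sign_eq: "2 * gauss_sign j = \<i> powi j + (- \<i>) powi j"
proof (cases "even j")
  case True
  then obtain r where r: "j = 2 * r" by auto
  show ?thesis by (simp add: r gauss_sign_def power_int_mult)
next
  case False
  then obtain r where r: "j = 2 * r + 1" by (auto elim: oddE)
  show ?thesis by (simp add: r gauss_sign_def power_int_add power_int_mult)
qed

text \<open>
  In the finite triple product at \<open>c = \<i>\<close> the factors combine to
  \<open>(1 + \<i> q^k)(1 - \<i> q^k) = 1 + q^(2k)\<close>. Averaging with \<open>c = -\<i>\<close> removes the odd \<open>j\<close>, after which
  everything is a series in \<open>q^2\<close>.
\<close>

lemma gauss_identity:
  "(\<Prod>i=1..n. 1 + fps_X ^ (2 * i - 1) :: complex fps)
     = (\<Sum>j\<in>{- int n..int n}. fps_const (gauss_sign j) * fps_X ^ (nat \<bar>j\<bar> ^ 2 div 2) * gbinom fps_X (2 * n) (nat (int n + j)))"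
    (is "?P = ?S")
proof -
  let ?g = "\<lambda>j. gbinom (fps_X ^ 2) (2 * n) (nat (int n + j)) :: complex fps"
  have prod: "(\<Sum>j\<in>{- int n..int n}. fps_const (c powi j) * fps_X ^ theta_exp 1 1 j * ?g j) = (?P oo fps_X ^ 2)"
    if c: "c = \<i> \<or> c = - \<i>" for c
  proof -
    have c2: "c * inverse c = 1" "c + inverse c = 0" using c by auto
    have "(\<Sum>j\<in>{- int n..int n}. fps_const (c powi j) * fps_X ^ theta_exp 1 1 j * ?g j)
        = (\<Prod>i=1..n. (1 + fps_const c * fps_X ^ (2 * i - 1)) * (1 + fps_const (inverse c) * fps_X ^ (2 * i - 1)))"
      using finite_jacobi_triple[of c 2 1 1 n] c by (auto simp: complex_eq_iff)
    also have "\<dots> = (\<Prod>i=1..n. 1 + (fps_X ^ 2) ^ (2 * i - 1))"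
    proof (intro prod.cong refl)
      fix i
      let ?y = "fps_X ^ (2 * i - 1) :: complex fps"
      define u v where "u = fps_const c" and "v = fps_const (inverse c)"
      have uv: "u + v = 0" "u * v = 1" using c2 by (simp_all add: u_def v_def)
      have "(1 + u * ?y) * (1 + v * ?y) = 1 + (u + v) * ?y + (u * v) * ?y ^ 2"
        by (simp add: algebra_simps power2_eq_square)
      moreover have "?y ^ 2 = (fps_X ^ 2) ^ (2 * i - 1)"
        by (simp only: power_mult[symmetric] mult.commute)
      ultimately have "(1 + u * ?y) * (1 + v * ?y) = 1 + (fps_X ^ 2) ^ (2 * i - 1)"
        by (simp only: uv mult_1 mult_zero_left add_0_right)
      then show "(1 + fps_const c * ?y) * (1 + fps_const (inverse c) * ?y) = 1 + (fps_X ^ 2) ^ (2 * i - 1)"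
        by (simp only: u_def v_def)
    qed
    also have "\<dots> = ?P oo fps_X ^ 2"
      by (simp add: fps_compose_prod_distrib fps_compose_add_distrib dilate_power)
    finally show ?thesis .
  qed
  have "2 * (?P oo fps_X ^ 2) = (\<Sum>j\<in>{- int n..int n}. fps_const (\<i> powi j) * fps_X ^ theta_exp 1 1 j * ?g j)
      + (\<Sum>j\<in>{- int n..int n}. fps_const ((- \<i>) powi j) * fps_X ^ theta_exp 1 1 j * ?g j)"
    using prod[of \<i>] prod[of "- \<i>"] by simp
  also have "\<dots> = (\<Sum>j\<in>{- int n..int n}. fps_const (2 * gauss_sign j) * fps_X ^ theta_exp 1 1 j * ?g j)"
    unfolding gauss_sign_eq by (simp only: fps_const_add[symmetric] distrib_right sum.distrib)
  also have "\<dots> = 2 * (?S oo fps_X ^ 2)"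
    unfolding fps_compose_sum_distrib sum_distrib_left
  proof (intro sum.cong refl)
    fix j
    have "fps_X ^ theta_exp 1 1 j = (fps_X ^ (nat \<bar>j\<bar> ^ 2 div 2) oo fps_X ^ 2 :: complex fps)" if "even j"
    proof -
      obtain r where r: "j = 2 * r" using \<open>even j\<close> by auto
      define k where "k = nat \<bar>r\<bar>"
      have nj: "nat \<bar>j\<bar> = 2 * k" by (simp add: r k_def nat_mult_distrib abs_mult)
      have "int (theta_exp 1 1 j) = int (2 * (nat \<bar>j\<bar> ^ 2 div 2))"
        using int_theta_exp[of 1 1 j] by (simp add: nj) (simp add: r k_def power2_eq_square algebra_simps)
      then have "theta_exp 1 1 j = 2 * (nat \<bar>j\<bar> ^ 2 div 2)" by (simp only: of_nat_eq_iff)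
      then show ?thesis by (simp add: dilate_power power_mult)
    qed
    then show "fps_const (2 * gauss_sign j) * fps_X ^ theta_exp 1 1 j * ?g j
        = 2 * (fps_const (gauss_sign j) * fps_X ^ (nat \<bar>j\<bar> ^ 2 div 2) * gbinom fps_X (2 * n) (nat (int n + j)) oo fps_X ^ 2)"
      by (cases "even j") (simp_all add: dilate_mult gbinom_dilate gauss_sign_def numeral_fps_const mult.assoc
          flip: fps_const_mult)
  qed
  finally have "?P oo fps_X ^ 2 = ?S oo fps_X ^ 2"
    by (rule mult_left_cancel[THEN iffD1, rotated]) simp
  then show ?thesis by (rule dilate_inj[rotated]) simp
qed

text \<open>
  The value \<open>0\<close> for \<open>k > m\<close> is that of \<open>(q)_m^2/((q)_(m-k) (q)_(m+k))\<close> under the usual convention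
  \<open>1/(q)_n = 0\<close> for \<open>n < 0\<close>.
\<close>

definition G_ratio :: "nat \<Rightarrow> nat \<Rightarrow> complex fps" where
  "G_ratio k m = (if k \<le> m then qf m ^ 2 * inverse (qf (m - k) * qf (m + k)) else 0)"

lemma gbinom_qf:
  assumes "\<bar>j\<bar> \<le> int m"
  shows "qf m ^ 2 * inverse (qf (2 * m)) * gbinom fps_X (2 * m) (nat (int m + j)) = G_ratio (nat \<bar>j\<bar>) m"
proof -
  define i where "i = nat (int m + j)"
  have i: "i \<le> 2 * m" using assms by (simp add: i_def)
  have q: "qf i * qf (2 * m - i) = qf (m - nat \<bar>j\<bar>) * qf (m + nat \<bar>j\<bar>)"
  proof (cases "j \<ge> 0")
    case True
    then have "i = m + nat \<bar>j\<bar>" "2 * m - i = m - nat \<bar>j\<bar>" by (auto simp: i_def)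
    then show ?thesis by (simp only: mult.commute)
  next
    case False
    then have "i = m - nat \<bar>j\<bar>" "2 * m - i = m + nat \<bar>j\<bar>" using assms by (auto simp: i_def)
    then show ?thesis by simp
  qed
  let ?q = "qf i * qf (2 * m - i)"
  have inv: "?q * inverse ?q = 1" by (intro inverse_mult_eq_1') simp
  have gb: "?q * gbinom fps_X (2 * m) i = qf (2 * m)"
    using gbinom_qpoch[OF i, of "fps_X :: complex fps"] by (simp add: qf_def)
  have "gbinom fps_X (2 * m) i = (?q * inverse ?q) * gbinom fps_X (2 * m) i" by (simp only: inv mult_1)
  also have "\<dots> = qf (2 * m) * inverse ?q" unfolding gb[symmetric] by (simp only: mult_ac)
  finally have "qf m ^ 2 * inverse (qf (2 * m)) * gbinom fps_X (2 * m) i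
      = qf m ^ 2 * (qf (2 * m) * inverse (qf (2 * m))) * inverse ?q" by (simp only: mult_ac)
  then show ?thesis using assms unfolding i_def[symmetric] q qf_inverse by (simp add: G_ratio_def)
qed

definition geo2 :: "nat \<Rightarrow> complex fps" where "geo2 m = fps_X ^ m * inverse ((1 - fps_X ^ m) ^ 2)"

lemma one_minus_inverse: "m > 0 \<Longrightarrow> (1 - fps_X ^ m) ^ 2 * inverse ((1 - fps_X ^ m) ^ 2) = (1 :: complex fps)"
  by (intro inverse_mult_eq_1') (simp add: fps_nth_power_0 zero_power)

lemma G_ratio_0 [simp]: "G_ratio 0 m = 1"
  unfolding G_ratio_def using inverse_mult_eq_1'[of "qf m ^ 2"]
  by (simp add: power2_eq_square fps_nth_power_0)

text \<open>
  The two ratios differ by the factor \<open>(1 - q^m)^2 - (1 - q^(m-k))(1 - q^(m+k)) = q^(m-k) (1 - q^k)^2\<close>.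
\<close>

lemma geo2_G_ratio_telescope:
  assumes "k > 0" "m > 0"
  shows "geo2 m * G_ratio k m = geo2 k * (G_ratio k m - G_ratio k (m - 1))"
proof (cases "k \<le> m")
  case False
  then show ?thesis by (simp add: G_ratio_def)
next
  case True
  define n where "n = m - 1"
  have m: "m = Suc n" using assms by (simp add: n_def)
  define r where "r = inverse (qf (m - k) * qf (m + k))"
  have rq: "qf (m - k) * qf (m + k) * r = 1"
    unfolding r_def by (intro inverse_mult_eq_1') simp
  have mk: "m + k = Suc (n + k)" using m by simp
  have G: "G_ratio k m = qf n ^ 2 * (1 - fps_X ^ m) ^ 2 * r"
  proof -
    have "qf m = qf n * (1 - fps_X ^ m)" by (simp only: m qf_Suc)
    then show ?thesis using True by (simp only: G_ratio_def r_def if_True power_mult_distrib)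
  qed
  have G': "G_ratio k n = qf n ^ 2 * ((1 - fps_X ^ (m - k)) * (1 - fps_X ^ (m + k))) * r"
  proof (cases "k = m")
    case True
    then show ?thesis using m by (simp add: G_ratio_def)
  next
    case False
    then have kn: "k \<le> n" "m - k = Suc (n - k)" using True m by auto
    let ?q = "qf (n - k) * qf (n + k)"
    have "?q * inverse ?q = 1" by (intro inverse_mult_eq_1') simp
    moreover have "?q * (((1 - fps_X ^ (m - k)) * (1 - fps_X ^ (m + k))) * r) = 1"
      using rq unfolding mk kn(2) qf_Suc by (simp only: mult_ac)
    ultimately have "?q * inverse ?q = ?q * (((1 - fps_X ^ (m - k)) * (1 - fps_X ^ (m + k))) * r)" by simp
    then have "inverse ?q = ((1 - fps_X ^ (m - k)) * (1 - fps_X ^ (m + k))) * r" by simp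
    then show ?thesis using kn by (simp add: G_ratio_def mult.assoc)
  qed
  have diff: "(1 - fps_X ^ m) ^ 2 - (1 - fps_X ^ (m - k)) * (1 - fps_X ^ (m + k)) = fps_X ^ (m - k) * (1 - fps_X ^ k) ^ (2 :: nat)"
    for fps_X :: "complex fps"
  proof -
    obtain j where j: "m = j + k" using True by (metis le_add_diff_inverse2)
    show ?thesis by (simp add: j power_add power2_eq_square algebra_simps)
  qed
  let ?im = "inverse ((1 - fps_X ^ m) ^ 2) :: complex fps" and ?ik = "inverse ((1 - fps_X ^ k) ^ 2) :: complex fps"
  have "geo2 k * (G_ratio k m - G_ratio k (m - 1))
      = fps_X ^ k * ?ik * (qf n ^ 2 * r * ((1 - fps_X ^ m) ^ 2 - (1 - fps_X ^ (m - k)) * (1 - fps_X ^ (m + k))))"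
    unfolding n_def[symmetric] G G' geo2_def by (simp add: algebra_simps)
  also have "\<dots> = (fps_X ^ k * fps_X ^ (m - k)) * ((1 - fps_X ^ k) ^ 2 * ?ik) * (qf n ^ 2 * r)"
    unfolding diff by (simp only: mult_ac)
  also have "\<dots> = fps_X ^ m * ((1 - fps_X ^ m) ^ 2 * ?im) * (qf n ^ 2 * r)"
    using True assms by (simp add: one_minus_inverse flip: power_add)
  also have "\<dots> = geo2 m * G_ratio k m" unfolding G geo2_def by (simp only: mult_ac)
  finally show ?thesis ..
qed

lemma telescope_sum:
  assumes "k > 0"
  shows "(\<Sum>m=1..K. geo2 m * G_ratio k m) = geo2 k * G_ratio k K"
proof (induction K)
  case 0
  then show ?case using assms by (simp add: G_ratio_def)
next
  case (Suc K)
  then show ?case using geo2_G_ratio_telescope[OF assms, of "Suc K"] by (simp add: algebra_simps)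
qed

text \<open>
  The first \<open>K\<close> terms of the generating function of \<open>spt_omega_bar\<close> times \<open>\<phi>(-q^2)\<close>.
\<close>

definition smallest_series :: "nat \<Rightarrow> complex fps" where
  "smallest_series K = (\<Sum>m=1..K. geo2 m * ((\<Prod>i=1..m. 1 + fps_X ^ (2 * i - 1)) * (qf m ^ 2 * inverse (qf (2 * m)))))"

lemma smallest_series_eq:
  "smallest_series K = (\<Sum>m=1..K. geo2 m)
     + (\<Sum>j\<in>{- int K..int K} - {0}. fps_const (gauss_sign j) * fps_X ^ (nat \<bar>j\<bar> ^ 2 div 2) * (geo2 (nat \<bar>j\<bar>) * G_ratio (nat \<bar>j\<bar>) K))"
proof -
  let ?s = "\<lambda>j. fps_const (gauss_sign j) * fps_X ^ (nat \<bar>j\<bar> ^ 2 div 2) :: complex fps"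
  have "smallest_series K = (\<Sum>m=1..K. \<Sum>j\<in>{- int K..int K}. ?s j * (geo2 m * G_ratio (nat \<bar>j\<bar>) m))"
    unfolding smallest_series_def
  proof (intro sum.cong refl)
    fix m assume m: "m \<in> {1..K}"
    have "geo2 m * ((\<Prod>i=1..m. 1 + fps_X ^ (2 * i - 1)) * (qf m ^ 2 * inverse (qf (2 * m))))
        = (\<Sum>j\<in>{- int m..int m}. ?s j * (geo2 m * (qf m ^ 2 * inverse (qf (2 * m)) * gbinom fps_X (2 * m) (nat (int m + j)))))"
      unfolding gauss_identity by (simp add: sum_distrib_left sum_distrib_right mult_ac)
    also have "\<dots> = (\<Sum>j\<in>{- int m..int m}. ?s j * (geo2 m * G_ratio (nat \<bar>j\<bar>) m))"
      by (intro sum.cong refl) (simp add: gbinom_qf abs_le_iff)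
    also have "\<dots> = (\<Sum>j\<in>{- int K..int K}. ?s j * (geo2 m * G_ratio (nat \<bar>j\<bar>) m))"
      using m by (intro sum.mono_neutral_left) (auto simp: G_ratio_def)
    finally show "geo2 m * ((\<Prod>i=1..m. 1 + fps_X ^ (2 * i - 1)) * (qf m ^ 2 * inverse (qf (2 * m))))
        = (\<Sum>j\<in>{- int K..int K}. ?s j * (geo2 m * G_ratio (nat \<bar>j\<bar>) m))" .
  qed
  also have "\<dots> = (\<Sum>j\<in>{- int K..int K}. \<Sum>m=1..K. ?s j * (geo2 m * G_ratio (nat \<bar>j\<bar>) m))"
    by (rule sum.swap)
  also have "\<dots> = (\<Sum>j\<in>{- int K..int K}. ?s j * (\<Sum>m=1..K. geo2 m * G_ratio (nat \<bar>j\<bar>) m))"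
    by (simp add: sum_distrib_left)
  also have "\<dots> = (\<Sum>m=1..K. geo2 m) + (\<Sum>j\<in>{- int K..int K} - {0}. ?s j * (\<Sum>m=1..K. geo2 m * G_ratio (nat \<bar>j\<bar>) m))"
    by (subst sum.remove[of _ 0]) (auto simp: gauss_sign_def)
  also have "(\<Sum>j\<in>{- int K..int K} - {0}. ?s j * (\<Sum>m=1..K. geo2 m * G_ratio (nat \<bar>j\<bar>) m))
      = (\<Sum>j\<in>{- int K..int K} - {0}. ?s j * (geo2 (nat \<bar>j\<bar>) * G_ratio (nat \<bar>j\<bar>) K))"
  proof (intro sum.cong refl)
    fix j assume "j \<in> {- int K..int K} - {0}"
    then have "nat \<bar>j\<bar> > 0" by auto
    then show "?s j * (\<Sum>m=1..K. geo2 m * G_ratio (nat \<bar>j\<bar>) m) = ?s j * (geo2 (nat \<bar>j\<bar>) * G_ratio (nat \<bar>j\<bar>) K)"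
      by (simp only: telescope_sum)
  qed
  finally show ?thesis .
qed

lemma geo2_nth: 
  assumes "m > 0"
  shows "geo2 m $ n = (if m dvd n then of_nat (n div m) else 0)"
proof -
  define g where "g = Abs_fps (\<lambda>n. if m dvd n then of_nat (n div m) else (0 :: complex))"
  have "fps_X * inverse ((1 - fps_X) ^ 2) = (Abs_fps of_nat :: complex fps)"
  proof -
    have "(Abs_fps of_nat :: complex fps) * (1 - fps_X) ^ 2 = fps_X"
    proof (rule fps_ext)
      fix n
      have *: "(h * (1 - fps_X)) $ n = h $ n - (if n = 0 then 0 else h $ (n - 1))" for h :: "complex fps" and n
        by (simp add: algebra_simps)
      show "((Abs_fps of_nat :: complex fps) * (1 - fps_X) ^ 2) $ n = fps_X $ n"
        unfolding power2_eq_square mult.assoc[symmetric] *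
        by (cases n; cases "n - 1") (auto simp: fps_X_def)
    qed
    moreover have "(1 - fps_X) ^ 2 * inverse ((1 - fps_X) ^ 2) = (1 :: complex fps)"
      using one_minus_inverse[of 1] by simp
    ultimately show ?thesis by (metis mult.assoc mult.right_neutral)
  qed
  then have "(fps_X * inverse ((1 - fps_X) ^ 2)) oo fps_X ^ m = (Abs_fps of_nat oo fps_X ^ m :: complex fps)" by simp
  then have "geo2 m = (Abs_fps of_nat oo fps_X ^ m :: complex fps)"
    using assms unfolding geo2_def
    by (simp add: dilate_mult fps_inverse_compose fps_nth_power_0 dilate_power fps_compose_sub_distrib)
  then show ?thesis using assms by (simp add: fps_nth_compose_X_power)
qed

text \<open>
  The summand \<open>j = \<plusminus>2r\<close> is \<open>q^(2r^2) q^k/(1 - q^k)^2\<close> with \<open>k = 2r\<close>, up to sign and terms of degree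
  above \<open>K\<close>, and contains only even powers. What remains are the divisor sums.
\<close>

lemma smallest_series_odd:
  assumes "odd n" "n \<le> K"
  shows "smallest_series K $ n = of_nat (sigma n)"
proof -
  have n0: "n > 0" using assms(1) by (cases n) auto
  have "(\<Sum>m=1..K. geo2 m) $ n = (\<Sum>m=1..K. if m dvd n then of_nat (n div m) else 0)"
    by (simp add: fps_sum_nth geo2_nth)
  also have "\<dots> = (\<Sum>m | m dvd n. of_nat (n div m))"
  proof (rule sum.mono_neutral_cong_right)
    show "{m. m dvd n} \<subseteq> {1..K}"
    proof
      fix d assume "d \<in> {m. m dvd n}"
      then have "d dvd n" by simp
      then have "d \<le> n" "d \<noteq> 0" using n0 by (auto dest: dvd_imp_le)
      then show "d \<in> {1..K}" using assms(2) by simp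
    qed
  qed auto
  also have "\<dots> = (\<Sum>d | d dvd n. of_nat d)"
    using n0 by (intro sum.reindex_bij_witness[of _ "\<lambda>d. n div d" "\<lambda>d. n div d"]) (auto elim!: dvdE)
  finally have main: "(\<Sum>m=1..K. geo2 m) $ n = of_nat (sigma n)" by (simp add: sigma_def)
  have zero: "(fps_const (gauss_sign j) * fps_X ^ (nat \<bar>j\<bar> ^ 2 div 2) * (geo2 (nat \<bar>j\<bar>) * G_ratio (nat \<bar>j\<bar>) K)) $ n = 0"
    if j: "j \<in> {- int K..int K} - {0}" for j
  proof (cases "even j")
    case False
    then show ?thesis by (simp add: gauss_sign_def)
  next
    case True
    define k where "k = nat \<bar>j\<bar>"
    have k: "0 < k" "k \<le> K" "even k" using j True by (auto simp: k_def even_nat_iff)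
    have G: "agree (Suc (K - k)) (G_ratio k K) 1"
    proof -
      define p where "p = qf (K - k)"
      have q: "agree (Suc (K - k)) (qf i) (qf (K - k))" if "K - k \<le> i" for i
        using qpoch_agree[OF that, of 1, where 'a = complex] by (simp add: qf_def agree_sym)
      have inv: "qf (K - k) * qf (K + k) * inverse (qf (K - k) * qf (K + k)) = 1"
        by (intro inverse_mult_eq_1') simp
      have "agree (Suc (K - k)) (qf K * qf K) (qf (K - k) * qf (K + k))"
        by (intro agree_mult agree_trans[OF q agree_sym[OF q]] q) auto
      then have "agree (Suc (K - k)) (qf K * qf K * inverse (qf (K - k) * qf (K + k)))
          (qf (K - k) * qf (K + k) * inverse (qf (K - k) * qf (K + k)))"
        by (rule agree_mult[OF _ agree_refl])
      then show ?thesis using k unfolding inv by (simp add: G_ratio_def power2_eq_square)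
    qed
    have "agree (Suc K) (fps_X ^ (k ^ 2 div 2 + k) * (inverse ((1 - fps_X ^ k) ^ 2) * G_ratio k K))
        (fps_X ^ (k ^ 2 div 2 + k) * (inverse ((1 - fps_X ^ k) ^ 2) * 1))"
      by (intro agree_X_power_mult[of _ _ "Suc (K - k)"] agree_mult agree_refl G) (use k in auto)
    then have "(fps_X ^ (k ^ 2 div 2) * (geo2 k * G_ratio k K)) $ n = (fps_X ^ (k ^ 2 div 2) * geo2 k) $ n"
      using assms(2) by (simp add: agree_def geo2_def power_add mult_ac)
    also have "\<dots> = 0"
    proof -
      obtain r where r: "k = 2 * r" using k(3) by auto
      have "k ^ 2 div 2 = 2 * r ^ 2" by (simp add: r power2_eq_square)
      moreover have "\<not> k dvd n - 2 * r ^ 2" if "2 * r ^ 2 \<le> n"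
      proof
        assume "k dvd n - 2 * r ^ 2"
        then have "even (n - 2 * r ^ 2)" using r by (metis dvd_mult_left)
        then show False using assms(1) that by simp
      qed
      ultimately show ?thesis using k(1) by (simp add: fps_X_power_mult_nth geo2_nth)
    qed
    finally show ?thesis unfolding k_def[symmetric] by (simp add: mult.assoc)
  qed
  have "smallest_series K $ n = (\<Sum>m=1..K. geo2 m) $ n
      + (\<Sum>j\<in>{- int K..int K} - {0}. (fps_const (gauss_sign j) * fps_X ^ (nat \<bar>j\<bar> ^ 2 div 2) * (geo2 (nat \<bar>j\<bar>) * G_ratio (nat \<bar>j\<bar>) K)) $ n)"
    unfolding smallest_series_eq by (simp only: fps_add_nth fps_sum_nth)
  then show ?thesis unfolding main using zero by simp
qed

section \<open>Overpartitions with prescribed parts\<close>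

text \<open>
  The occurrences of one part in an overpartition: only the first of them may be overlined.
\<close>

definition block :: "nat \<Rightarrow> nat \<Rightarrow> bool \<Rightarrow> (nat \<times> bool) list" where
  "block m c b = (if c = 0 then [] else (m, b) # replicate (c - 1) (m, False))"

lemma block_0 [simp]: "block m 0 b = []"
  by (simp add: block_def)

lemma block_1: "block m (Suc 0) b = [(m, b)]"
  by (simp add: block_def)

lemma block_Suc: "c > 0 \<Longrightarrow> block m (Suc c) b = block m c b @ [(m, False)]"
  by (cases c) (simp_all add: block_def replicate_append_same)

lemma set_block: "c > 0 \<Longrightarrow> set (block m c b) \<subseteq> {(m, b), (m, False)} \<and> (m, b) \<in> set (block m c b)"
  by (auto simp: block_def)

lemma block_simps: "map fst (block m c b) = replicate c m" "length (block m c b) = c"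
  by (cases c; simp add: block_def)+

lemma fst_set_block: "x \<in> set (block m c b) \<Longrightarrow> fst x = m"
  by (auto simp: block_def split: if_splits)

definition first_overlined :: "(nat \<times> bool) list \<Rightarrow> bool" where
  "first_overlined xs \<longleftrightarrow> (\<forall>j < length xs. snd (xs ! j) \<longrightarrow> (\<forall>i < j. fst (xs ! i) \<noteq> fst (xs ! j)))"

lemma first_overlined_snoc:
  "first_overlined (xs @ [x]) \<longleftrightarrow> first_overlined xs \<and> (snd x \<longrightarrow> fst x \<notin> fst ` set xs)"
proof -
  have "(\<forall>j < length xs. snd ((xs @ [x]) ! j) \<longrightarrow> (\<forall>i < j. fst ((xs @ [x]) ! i) \<noteq> fst ((xs @ [x]) ! j))) \<longleftrightarrow> first_overlined xs"
    unfolding first_overlined_def by (auto simp: nth_append)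
  moreover have "(\<forall>i < length xs. fst ((xs @ [x]) ! i) \<noteq> fst x) \<longleftrightarrow> (\<forall>y\<in>set xs. fst y \<noteq> fst x)"
    by (simp add: nth_append all_set_conv_all_nth)
  moreover have "first_overlined (xs @ [x]) \<longleftrightarrow>
      (snd x \<longrightarrow> (\<forall>i < length xs. fst ((xs @ [x]) ! i) \<noteq> fst x)) \<and>
      (\<forall>j < length xs. snd ((xs @ [x]) ! j) \<longrightarrow> (\<forall>i < j. fst ((xs @ [x]) ! i) \<noteq> fst ((xs @ [x]) ! j)))"
    by (simp add: first_overlined_def All_less_Suc)
  ultimately show ?thesis by (auto simp: image_iff)
qed

lemma is_overpartition_iff:
  "is_overpartition n xs \<longleftrightarrow> sorted_wrt (\<ge>) (map fst xs) \<and> (\<forall>x \<in> set xs. fst x > 0)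
     \<and> sum_list (map fst xs) = n \<and> first_overlined xs"
  by (auto simp: is_overpartition_def first_overlined_def)

lemma first_overlined_block:
  assumes "\<forall>y\<in>set ys. fst y > m"
  shows "first_overlined (ys @ block m c b) \<longleftrightarrow> first_overlined ys"
proof (induction c)
  case (Suc c)
  show ?case
  proof (cases "c = 0")
    case True
    then show ?thesis using assms by (auto simp: block_1 first_overlined_snoc)
  next
    case False
    then show ?thesis using Suc by (simp add: block_Suc first_overlined_snoc flip: append_assoc)
  qed
qed simp

lemma is_overpartition_append_block:
  assumes "\<forall>y\<in>set ys. fst y > m" "m > 0"
  shows "is_overpartition n (ys @ block m c b) \<longleftrightarrow> c * m \<le> n \<and> is_overpartition (n - c * m) ys"
proof -
  have "sorted_wrt (\<ge>) (replicate c m)" by (induction c) auto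
  then show ?thesis
    using assms first_overlined_block[OF assms(1)]
    by (auto simp: is_overpartition_iff sorted_wrt_append block_simps sum_list_replicate dest: fst_set_block
      intro: less_imp_le)
qed

lemma filter_block:
  assumes "\<forall>y\<in>set ys. fst y > m"
  shows "filter (\<lambda>x. fst x \<noteq> m) (ys @ block m c b) = ys"
    "filter (\<lambda>x. fst x = m) (ys @ block m c b) = block m c b"
proof -
  have "\<forall>x\<in>set ys. fst x \<noteq> m" "\<forall>x\<in>set (block m c b). fst x = m"
    using assms by (auto dest: fst_set_block)
  then show "filter (\<lambda>x. fst x \<noteq> m) (ys @ block m c b) = ys"
    "filter (\<lambda>x. fst x = m) (ys @ block m c b) = block m c b" by simp_all
qed

lemma block_decomposition:
  assumes "sorted_wrt (\<ge>) (map fst xs)" "first_overlined xs" "\<forall>x\<in>set xs. fst x \<ge> m"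
  shows "\<exists>ys c b. xs = ys @ block m c b \<and> (\<forall>y\<in>set ys. fst y > m) \<and> (c = 0 \<longrightarrow> \<not> b)"
  using assms
proof (induction xs rule: rev_induct)
  case Nil
  then show ?case by (intro exI[of _ "[]"] exI[of _ 0] exI[of _ False]) simp
next
  case (snoc x xs)
  have "sorted_wrt (\<ge>) (map fst xs)" "first_overlined xs" "\<forall>x\<in>set xs. fst x \<ge> m"
    using snoc.prems by (auto simp: sorted_wrt_append first_overlined_snoc)
  then obtain ys c b where ys: "xs = ys @ block m c b" "\<forall>y\<in>set ys. fst y > m" "c = 0 \<longrightarrow> \<not> b"
    using snoc.IH by blast
  show ?case
  proof (cases "fst x = m")
    case True
    show ?thesis
    proof (cases "c = 0")
      case True
      then show ?thesis using ys \<open>fst x = m\<close>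
        by (intro exI[of _ ys] exI[of _ 1] exI[of _ "snd x"]) (auto simp: block_1)
    next
      case False
      then have "m \<in> fst ` set xs" using ys(1) set_block[of c m b] by force
      then have "\<not> snd x" using snoc.prems(2) True by (auto simp: first_overlined_snoc)
      then have "x = (m, False)" using True by (metis prod.collapse)
      then show ?thesis using ys False
        by (intro exI[of _ ys] exI[of _ "Suc c"] exI[of _ b]) (auto simp: block_Suc)
    qed
  next
    case False
    then have "fst x > m" using snoc.prems(3) by auto
    then have "\<forall>y\<in>set (xs @ [x]). fst y > m"
      using snoc.prems(1) by (auto simp: sorted_wrt_append)
    then show ?thesis by (intro exI[of _ "xs @ [x]"] exI[of _ 0] exI[of _ False]) simp
  qed
qed

lemma append_block_inj:
  assumes "ys @ block m c b = ys' @ block m c' b'" "\<forall>y\<in>set ys. fst y > m" "\<forall>y\<in>set ys'. fst y > m"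
    "c = 0 \<longrightarrow> \<not> b" "c' = 0 \<longrightarrow> \<not> b'"
  shows "ys = ys' \<and> c = c' \<and> b = b'"
proof -
  have "ys = ys'" "block m c b = block m c' b'"
    using filter_block[OF assms(2), of c b] filter_block[OF assms(3), of c' b'] assms(1) by auto
  moreover from this(2) have "c = c'" using block_simps(2) by metis
  moreover have "b = b'"
    using \<open>block m c b = block m c' b'\<close> \<open>c = c'\<close> assms(4,5) by (cases "c = 0") (auto simp: block_def)
  ultimately show ?thesis by simp
qed

definition overpartitions_in :: "nat set \<Rightarrow> nat \<Rightarrow> (nat \<times> bool) list set" where
  "overpartitions_in P n = {xs. is_overpartition n xs \<and> fst ` set xs \<subseteq> P}"

lemma finite_overpartitions_in: "finite (overpartitions_in P n)"
proof (rule finite_subset)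
  show "overpartitions_in P n \<subseteq> {xs. set xs \<subseteq> {..n} \<times> UNIV \<and> length xs \<le> n}"
  proof
    fix xs assume "xs \<in> overpartitions_in P n"
    then have pos: "\<forall>x \<in> set xs. fst x > 0" and s: "sum_list (map fst xs) = n"
      by (auto simp: overpartitions_in_def is_overpartition_iff)
    have "length ys \<le> sum_list (map fst ys)" if "\<forall>x \<in> set ys. fst x > 0" for ys :: "(nat \<times> bool) list"
      using that by (induction ys) auto
    moreover have "fst x \<le> n" if "x \<in> set xs" for x
      using member_le_sum_list[of "fst x" "map fst xs"] that s by simp
    ultimately show "xs \<in> {xs. set xs \<subseteq> {..n} \<times> UNIV \<and> length xs \<le> n}"
      using pos s by (force simp: mem_Times_iff)
  qed
  show "finite {xs :: (nat \<times> bool) list. set xs \<subseteq> {..n} \<times> UNIV \<and> length xs \<le> n}"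
    by (rule finite_lists_length_le) simp
qed

lemma finite_multiples:
  fixes m n :: nat
  assumes "m > 0"
  shows "finite {c. c * m \<le> n}" "finite {c. 1 \<le> c \<and> c * m \<le> n}"
proof -
  have "c \<le> n" if "c * m \<le> n" for c
  proof -
    have "c \<le> c * m" using assms by (cases m) simp_all
    then show ?thesis using that by linarith
  qed
  then show "finite {c. c * m \<le> n}" "finite {c. 1 \<le> c \<and> c * m \<le> n}"
    by (auto intro: finite_subset[of _ "{..n}"])
qed

text \<open>
  An overpartition is an overpartition into larger parts followed by a block of the smallest part, and a
  non-empty block admits two choices of the overline.
\<close>

lemma card_overpartitions_in_insert:
  assumes "m > 0" "\<forall>p\<in>A. m < p"
  shows "card (overpartitions_in (insert m A) n)
     = (\<Sum>c | c * m \<le> n. (if c = 0 then 1 else 2) * card (overpartitions_in A (n - c * m)))"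
proof -
  define I where "I = (SIGMA c:{c. c * m \<le> n}. (if c = 0 then {False} else UNIV) \<times> overpartitions_in A (n - c * m))"
  define h where "h = (\<lambda>(c, b, ys). ys @ block m c b)"
  have A: "\<forall>y\<in>set ys. fst y > m" if "ys \<in> overpartitions_in A k" for ys k
    using that assms(2) by (auto simp: overpartitions_in_def)
  have "bij_betw h I (overpartitions_in (insert m A) n)"
    unfolding bij_betw_def
  proof
    show "inj_on h I"
    proof (rule inj_onI)
      fix p q assume pq: "p \<in> I" "q \<in> I" "h p = h q"
      obtain c b ys c' b' ys' where eq: "p = (c, b, ys)" "q = (c', b', ys')" by (cases p, cases q) auto
      have "ys \<in> overpartitions_in A (n - c * m)" "ys' \<in> overpartitions_in A (n - c' * m)"
        "c = 0 \<longrightarrow> \<not> b" "c' = 0 \<longrightarrow> \<not> b'"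
        using pq(1,2) by (auto simp: eq I_def split: if_splits)
      moreover have "ys @ block m c b = ys' @ block m c' b'" using pq(3) by (simp add: eq h_def)
      ultimately show "p = q" using append_block_inj[of ys m c b ys' c' b'] A by (simp add: eq)
    qed
    show "h ` I = overpartitions_in (insert m A) n"
    proof (intro equalityI subsetI)
      fix xs assume "xs \<in> h ` I"
      then obtain c b ys where c: "xs = ys @ block m c b" "c * m \<le> n" "ys \<in> overpartitions_in A (n - c * m)"
        by (auto simp: h_def I_def)
      then show "xs \<in> overpartitions_in (insert m A) n"
        using is_overpartition_append_block[OF A[OF c(3)] assms(1), of n c b]
        by (auto simp: overpartitions_in_def dest: fst_set_block)
    next
      fix xs assume xs: "xs \<in> overpartitions_in (insert m A) n"
      then have "\<forall>x\<in>set xs. fst x \<ge> m" using assms(2) by (auto simp: overpartitions_in_def) (metis fst_conv image_subset_iff insert_iff less_imp_le order_refl)+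
      then obtain ys c b where ys: "xs = ys @ block m c b" "\<forall>y\<in>set ys. fst y > m" "c = 0 \<longrightarrow> \<not> b"
        using block_decomposition xs by (auto simp: overpartitions_in_def is_overpartition_iff) metis
      have "c * m \<le> n \<and> is_overpartition (n - c * m) ys"
        using is_overpartition_append_block[OF ys(2) assms(1)] xs ys(1) by (simp add: overpartitions_in_def)
      moreover have "fst ` set ys \<subseteq> A" using xs ys(1,2) by (auto simp: overpartitions_in_def)
      ultimately have "(c, b, ys) \<in> I" using ys(3) by (auto simp: I_def overpartitions_in_def)
      then show "xs \<in> h ` I" using ys(1) by (force simp: h_def)
    qed
  qed
  then have "card (overpartitions_in (insert m A) n) = card I" by (simp add: bij_betw_same_card)
  also have fin: "finite {c. c * m \<le> n}"
    by (rule finite_multiples[OF assms(1)])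
  then have "card I = (\<Sum>c | c * m \<le> n. card ((if c = 0 then {False} else UNIV) \<times> overpartitions_in A (n - c * m)))"
    unfolding I_def using finite_overpartitions_in by (intro card_SigmaI) auto
  also have "\<dots> = (\<Sum>c | c * m \<le> n. (if c = 0 then 1 else 2) * card (overpartitions_in A (n - c * m)))"
    by (intro sum.cong refl) (auto simp: card_cartesian_product)
  finally show ?thesis .
qed

definition part_factor :: "nat \<Rightarrow> complex fps" where
  "part_factor p = (1 + fps_X ^ p) * inverse (1 - fps_X ^ p)"

lemma one_minus_inverse1: "m > 0 \<Longrightarrow> (1 - fps_X ^ m) * inverse (1 - fps_X ^ m) = (1 :: complex fps)"
  by (intro inverse_mult_eq_1') (simp add: zero_power)

lemma part_factor_nth:
  assumes "m > 0"
  shows "part_factor m $ n = (if m dvd n then if n = 0 then 1 else 2 else 0)"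
proof -
  define g where "g = Abs_fps (\<lambda>n. if m dvd n then if n = 0 then 1 else 2 else (0 :: complex))"
  have "g * (1 - fps_X ^ m) = 1 + fps_X ^ m"
  proof (rule fps_ext)
    fix n
    have "(g * (1 - fps_X ^ m)) $ n = g $ n - (if n < m then 0 else g $ (n - m))"
      by (simp add: right_diff_distrib fps_X_power_mult_right_nth)
    then show "(g * (1 - fps_X ^ m)) $ n = (1 + fps_X ^ m) $ n"
      using assms by (auto simp: g_def dvd_minus_self dest: dvd_imp_le)
  qed
  then have "part_factor m = g * ((1 - fps_X ^ m) * inverse (1 - fps_X ^ m))"
    unfolding part_factor_def by (simp only: mult.assoc[symmetric])
  then have "part_factor m = g" by (simp only: one_minus_inverse1[OF assms] mult_1_right)
  then show ?thesis by (simp add: g_def)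
qed

lemma sum_multiples:
  fixes f :: "nat \<Rightarrow> complex"
  assumes "m > 0"
  shows "(\<Sum>i=0..n. if m dvd i then f i else 0) = (\<Sum>c | c * m \<le> n. f (c * m))"
proof -
  have "(\<Sum>i=0..n. if m dvd i then f i else 0) = (\<Sum>i\<in>{i\<in>{0..n}. m dvd i}. f i)"
    by (rule sum.inter_filter[symmetric]) simp
  also have "\<dots> = (\<Sum>c | c * m \<le> n. f (c * m))"
    using assms by (intro sum.reindex_bij_witness[of _ "\<lambda>c. c * m" "\<lambda>i. i div m"]) auto
  finally show ?thesis .
qed

lemma overpartitions_in_empty: "overpartitions_in {} n = (if n = 0 then {[]} else {})"
  by (auto simp: overpartitions_in_def is_overpartition_iff first_overlined_def)

text \<open>
  The parts are added in descending order, the smallest one last, as \<open>card_overpartitions_in_insert\<close> requires.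
\<close>

lemma overpartition_series:
  assumes "finite P" "\<forall>p\<in>P. p > 0"
  shows "Abs_fps (\<lambda>n. of_nat (card (overpartitions_in P n))) = (\<Prod>p\<in>P. part_factor p)"
  using assms
proof (induction P rule: finite_linorder_min_induct)
  case empty
  then show ?case by (auto simp: overpartitions_in_empty fps_eq_iff)
next
  case (insert m A)
  have "Abs_fps (\<lambda>n. of_nat (card (overpartitions_in (insert m A) n)))
      = part_factor m * Abs_fps (\<lambda>n. of_nat (card (overpartitions_in A n)))"
  proof (rule fps_ext)
    fix n
    have "(part_factor m * Abs_fps (\<lambda>n. of_nat (card (overpartitions_in A n)))) $ n
        = (\<Sum>i=0..n. if m dvd i then (if i = 0 then 1 else 2) * of_nat (card (overpartitions_in A (n - i))) else 0)"
      using insert.prems by (auto simp: fps_mult_nth part_factor_nth intro!: sum.cong)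
    also have "\<dots> = (\<Sum>c | c * m \<le> n. (if c * m = 0 then 1 else 2) * of_nat (card (overpartitions_in A (n - c * m))))"
      using insert.prems by (intro sum_multiples) auto
    also have "\<dots> = of_nat (card (overpartitions_in (insert m A) n))"
      using insert.prems insert.hyps(2) by (subst card_overpartitions_in_insert) (auto intro!: sum.cong)
    finally show "Abs_fps (\<lambda>n. of_nat (card (overpartitions_in (insert m A) n))) $ n
        = (part_factor m * Abs_fps (\<lambda>n. of_nat (card (overpartitions_in A n)))) $ n" by simp
  qed
  then show ?case using insert by (subst prod.insert) auto
qed

section \<open>The generating function\<close>

definition larger_parts :: "nat \<Rightarrow> nat set" where
  "larger_parts m = {p. m < p \<and> (odd p \<longrightarrow> p < 2 * m)}"

lemma count_list_block: "count_list (map fst (ys @ block m c b)) m = c" if "\<forall>y\<in>set ys. fst y > m"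
proof -
  have "m \<notin> set (map fst ys)" using that by auto
  moreover have "count_list (replicate c m) m = c" by (induction c) auto
  ultimately show ?thesis by (simp add: block_simps count_list_0_iff)
qed

lemma smallest_part_block:
  assumes "\<forall>y\<in>set ys. fst y > m" "c > 0"
  shows "smallest_part (ys @ block m c b) = m"
  unfolding smallest_part_def
proof (rule Min_eqI)
  show "m \<in> fst ` set (ys @ block m c b)" using set_block[OF assms(2), of m b] by force
qed (use assms in \<open>auto dest: fst_set_block\<close>)

text \<open>
  The overpartitions counted are split into the block of their smallest part \<open>m\<close>, whose first occurrence is
  overlined and whose multiplicity \<open>c\<close> is the weight, and an overpartition into larger parts.
\<close>

lemma spt_omega_bar_eq:
  "spt_omega_bar n = (\<Sum>m=1..n. \<Sum>c | 1 \<le> c \<and> c * m \<le> n. c * card (overpartitions_in (larger_parts m) (n - c * m)))"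
proof -
  define I where "I = (SIGMA m:{1..n}. SIGMA c:{c. 1 \<le> c \<and> c * m \<le> n}. overpartitions_in (larger_parts m) (n - c * m))"
  have larger: "\<forall>y\<in>set ys. fst y > m" if "ys \<in> overpartitions_in (larger_parts m) k" for ys m k
    using that by (auto simp: overpartitions_in_def larger_parts_def)
  have "spt_omega_bar n = (\<Sum>(m, c, ys)\<in>I. c)"
    unfolding spt_omega_bar_def
  proof (rule sum.reindex_bij_witness[of _ "\<lambda>(m, c, ys). ys @ block m c True"
        "\<lambda>xs. (smallest_part xs, count_list (map fst xs) (smallest_part xs), filter (\<lambda>x. fst x \<noteq> smallest_part xs) xs)"])
    fix xs assume xs: "xs \<in> spt_overpartitions n"
    define m where "m = smallest_part xs"
    have op: "is_overpartition n xs" and mem: "(m, True) \<in> set xs"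
      and odd: "\<And>x. x \<in> set xs \<Longrightarrow> odd (fst x) \<Longrightarrow> fst x < 2 * m"
      using xs by (auto simp: spt_overpartitions_def m_def)
    have m0: "m > 0" using op mem by (auto simp: is_overpartition_iff)
    have ge: "\<forall>x\<in>set xs. fst x \<ge> m" by (simp add: m_def smallest_part_def)
    then obtain ys c b where ys: "xs = ys @ block m c b" "\<forall>y\<in>set ys. fst y > m" "c = 0 \<longrightarrow> \<not> b"
      using block_decomposition op unfolding is_overpartition_iff by blast
    have "(m, True) \<in> set (block m c b)" using mem ys(1,2) by auto
    then have cb: "c > 0" "b" using set_block[of c m b] by (auto simp: block_def split: if_splits)
    have count: "count_list (map fst xs) m = c" unfolding ys(1) by (rule count_list_block[OF ys(2)])
    have filter: "filter (\<lambda>x. fst x \<noteq> m) xs = ys"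
      unfolding ys(1) by (rule filter_block(1)[OF ys(2)])
    show "(\<lambda>(m, c, ys). ys @ block m c True) (smallest_part xs, count_list (map fst xs) (smallest_part xs),
        filter (\<lambda>x. fst x \<noteq> smallest_part xs) xs) = xs"
      using cb unfolding m_def[symmetric] count filter by (simp add: ys(1))
    have op': "c * m \<le> n" "is_overpartition (n - c * m) ys"
      using is_overpartition_append_block[OF ys(2) m0, of n c b] op ys(1) by simp_all
    have "m \<le> c * m" using cb by simp
    then have "m \<le> n" using op'(1) by (rule order_trans)
    moreover have "ys \<in> overpartitions_in (larger_parts m) (n - c * m)"
      using op' ys(2) odd unfolding overpartitions_in_def larger_parts_def ys(1) by auto
    ultimately show "(smallest_part xs, count_list (map fst xs) (smallest_part xs),
        filter (\<lambda>x. fst x \<noteq> smallest_part xs) xs) \<in> I"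
      using cb m0 op' unfolding m_def[symmetric] count filter I_def by auto
    show "(case (smallest_part xs, count_list (map fst xs) (smallest_part xs),
        filter (\<lambda>x. fst x \<noteq> smallest_part xs) xs) of (m, c, ys) \<Rightarrow> c) = count_list (map fst xs) (smallest_part xs)"
      by simp
  next
    fix p assume "p \<in> I"
    then obtain m c ys where p: "p = (m, c, ys)" and m: "1 \<le> m" "m \<le> n" "1 \<le> c" "c * m \<le> n"
      and ys: "ys \<in> overpartitions_in (larger_parts m) (n - c * m)" by (auto simp: I_def)
    note gt = larger[OF ys]
    have small: "smallest_part (ys @ block m c True) = m" using smallest_part_block[OF gt] m by simp
    have filter: "filter (\<lambda>x. fst x \<noteq> m) (ys @ block m c True) = ys"
      by (rule filter_block(1)[OF gt])
    show "(\<lambda>xs. (smallest_part xs, count_list (map fst xs) (smallest_part xs), filter (\<lambda>x. fst x \<noteq> smallest_part xs) xs))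
        ((\<lambda>(m, c, ys). ys @ block m c True) p) = p"
      unfolding p using small count_list_block[OF gt, of c True] filter by simp
    have "is_overpartition n (ys @ block m c True)"
      using is_overpartition_append_block[OF gt, of n c True] m ys by (simp add: overpartitions_in_def)
    moreover have "(m, True) \<in> set (ys @ block m c True)" using set_block[of c m True] m by auto
    moreover have "fst x < 2 * m" if "x \<in> set (ys @ block m c True)" "odd (fst x)" for x
      using that ys m by (auto simp: overpartitions_in_def larger_parts_def dest: fst_set_block)
    ultimately show "(\<lambda>(m, c, ys). ys @ block m c True) p \<in> spt_overpartitions n"
      unfolding p spt_overpartitions_def by (simp add: small)
  qed
  also have "\<dots> = (\<Sum>m=1..n. \<Sum>(c, ys)\<in>(SIGMA c:{c. 1 \<le> c \<and> c * m \<le> n}. overpartitions_in (larger_parts m) (n - c * m)). c)"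
    unfolding I_def
  proof (subst sum.Sigma)
    show "\<forall>m\<in>{1..n}. finite (SIGMA c:{c. 1 \<le> c \<and> c * m \<le> n}. overpartitions_in (larger_parts m) (n - c * m))"
    proof
      fix m assume "m \<in> {1..n}"
      then have "finite {c. 1 \<le> c \<and> c * m \<le> n}"
        by (intro finite_multiples) simp
      then show "finite (SIGMA c:{c. 1 \<le> c \<and> c * m \<le> n}. overpartitions_in (larger_parts m) (n - c * m))"
        using finite_overpartitions_in by (intro finite_SigmaI) auto
    qed
  qed (auto simp: case_prod_unfold)
  also have "\<dots> = (\<Sum>m=1..n. \<Sum>c | 1 \<le> c \<and> c * m \<le> n. c * card (overpartitions_in (larger_parts m) (n - c * m)))"
  proof (intro sum.cong refl)
    fix m assume "m \<in> {1..n}"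
    then have "finite {c. 1 \<le> c \<and> c * m \<le> n}"
      by (intro finite_multiples) simp
    then show "(\<Sum>(c, ys)\<in>(SIGMA c:{c. 1 \<le> c \<and> c * m \<le> n}. overpartitions_in (larger_parts m) (n - c * m)). c)
        = (\<Sum>c | 1 \<le> c \<and> c * m \<le> n. c * card (overpartitions_in (larger_parts m) (n - c * m)))"
      using finite_overpartitions_in by (subst sum.Sigma[symmetric]) (auto simp: mult.commute)
  qed
  finally show ?thesis .
qed

definition spt_series :: "complex fps" where "spt_series = Abs_fps (\<lambda>n. of_nat (spt_omega_bar n))"

text \<open>
  A finite substitute for \<open>larger_parts m\<close>: the parts up to \<open>2m\<close> may have any parity, and beyond that there are
  even parts, of which those up to \<open>2K\<close> matter. The even part \<open>2m\<close> is in the first set.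
\<close>

definition finite_parts :: "nat \<Rightarrow> nat \<Rightarrow> nat set" where
  "finite_parts K m = {m + 1..2 * m} \<union> (*) 2 ` {m + 1..K}"

lemma overpartitions_in_finite_parts:
  assumes "k \<le> 2 * K" "m > 0"
  shows "overpartitions_in (larger_parts m) k = overpartitions_in (finite_parts K m) k"
proof -
  have "fst x \<in> larger_parts m \<longleftrightarrow> fst x \<in> finite_parts K m" if "is_overpartition k xs" "x \<in> set xs" for x xs
  proof -
    have "fst x \<le> k"
      using member_le_sum_list[of "fst x" "map fst xs"] that by (simp add: is_overpartition_iff)
    then have le: "fst x \<le> 2 * K" using assms by simp
    show ?thesis
    proof (cases "even (fst x)")
      case True
      then obtain r where r: "fst x = 2 * r" by auto
      then show ?thesis using le by (auto simp: larger_parts_def finite_parts_def)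
    next
      case False
      then have "fst x \<noteq> 2 * m" "fst x \<notin> (*) 2 ` {m + 1..K}" by auto
      then show ?thesis using False by (auto simp: larger_parts_def finite_parts_def)
    qed
  qed
  then show ?thesis unfolding overpartitions_in_def by blast
qed

lemma spt_series_agree:
  "agree (Suc K) spt_series (\<Sum>m=1..K. geo2 m * (\<Prod>p\<in>finite_parts K m. part_factor p))"
  unfolding agree_def
proof (intro allI impI)
  fix n assume n: "n < Suc K"
  have summand: "(geo2 m * (\<Prod>p\<in>finite_parts K m. part_factor p)) $ n
      = of_nat (\<Sum>c | 1 \<le> c \<and> c * m \<le> n. c * card (overpartitions_in (larger_parts m) (n - c * m)))"
    if m: "m \<in> {1..K}" for m
  proof -
    have fin: "finite (finite_parts K m)" "\<forall>p\<in>finite_parts K m. p > 0" using m by (auto simp: finite_parts_def)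
    have m0: "m > 0" using m by simp
    have finc: "finite {c. c * m \<le> n}"
      by (rule finite_multiples[OF m0])
    have "(geo2 m * (\<Prod>p\<in>finite_parts K m. part_factor p)) $ n
        = (\<Sum>i=0..n. if m dvd i then of_nat (i div m) * of_nat (card (overpartitions_in (finite_parts K m) (n - i))) else 0)"
      unfolding overpartition_series[OF fin, symmetric] using m0
      by (auto simp: fps_mult_nth geo2_nth intro!: sum.cong)
    also have "\<dots> = (\<Sum>c | c * m \<le> n. of_nat (c * m div m) * of_nat (card (overpartitions_in (finite_parts K m) (n - c * m))))"
      by (rule sum_multiples[OF m0])
    also have "\<dots> = (\<Sum>c | c * m \<le> n. of_nat (c * card (overpartitions_in (larger_parts m) (n - c * m))))"
      using n m0 by (intro sum.cong refl) (auto simp: overpartitions_in_finite_parts[where K = K])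
    also have "\<dots> = (\<Sum>c | 1 \<le> c \<and> c * m \<le> n. of_nat (c * card (overpartitions_in (larger_parts m) (n - c * m))))"
      using finc by (intro sum.mono_neutral_right) auto
    finally show ?thesis by simp
  qed
  have "(\<Sum>m=1..K. geo2 m * (\<Prod>p\<in>finite_parts K m. part_factor p)) $ n
      = (\<Sum>m=1..K. of_nat (\<Sum>c | 1 \<le> c \<and> c * m \<le> n. c * card (overpartitions_in (larger_parts m) (n - c * m))))"
    using summand by (simp add: fps_sum_nth)
  also have "\<dots> = (\<Sum>m=1..n. of_nat (\<Sum>c | 1 \<le> c \<and> c * m \<le> n. c * card (overpartitions_in (larger_parts m) (n - c * m))))"
  proof (rule sum.mono_neutral_right)
    show "\<forall>m\<in>{1..K} - {1..n}. complex_of_nat (\<Sum>c | 1 \<le> c \<and> c * m \<le> n. c * card (overpartitions_in (larger_parts m) (n - c * m))) = 0"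
    proof
      fix m assume m: "m \<in> {1..K} - {1..n}"
      have "{c. 1 \<le> c \<and> c * m \<le> n} = {}"
      proof -
        have "\<not> c * m \<le> n" if "1 \<le> c" for c
        proof -
          have "n < m" using m by auto
          also have "m \<le> c * m" using that by simp
          finally show ?thesis by simp
        qed
        then show ?thesis by blast
      qed
      then show "complex_of_nat (\<Sum>c | 1 \<le> c \<and> c * m \<le> n. c * card (overpartitions_in (larger_parts m) (n - c * m))) = 0"
        by (simp only: sum.empty of_nat_0)
    qed
  qed (use n in auto)
  finally show "spt_series $ n = (\<Sum>m=1..K. geo2 m * (\<Prod>p\<in>finite_parts K m. part_factor p)) $ n"
    by (simp add: spt_series_def spt_omega_bar_eq)
qed

definition even_factor :: "nat \<Rightarrow> complex fps" where "even_factor K = (\<Prod>j=1..K. part_factor (2 * j))"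

lemma part_factor_eq: "p > 0 \<Longrightarrow> part_factor p * (1 - fps_X ^ p) = 1 + fps_X ^ p"
  unfolding part_factor_def using one_minus_inverse1[of p] by (simp add: mult.assoc mult.commute)

text \<open>
  By induction, as both sides change by the same factors from \<open>m\<close> to \<open>m + 1\<close>.
\<close>

lemma part_factor_interval:
  "(\<Prod>p=m+1..2*m. part_factor p)
     = (\<Prod>i=1..m. 1 + fps_X ^ (2 * i - 1)) * (qf m ^ 2 * inverse (qf (2 * m))) * even_factor m"
proof (induction m)
  case 0
  then show ?case by (simp add: even_factor_def)
next
  case (Suc m)
  define X where "X = (fps_X :: complex fps)"
  define L where "L = (\<Prod>p=m+1..2*m. part_factor p)"
  define L' where "L' = (\<Prod>p=Suc m+1..2*Suc m. part_factor p)"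
  define Od where "Od = (\<Prod>i=1..m. 1 + X ^ (2 * i - 1))"
  define r where "r = inverse (qf (2 * m))"
  define r' where "r' = inverse (qf (2 * Suc m))"
  have LL': "L' * part_factor (m + 1) = L * part_factor (2 * m + 1) * part_factor (2 * m + 2)"
  proof -
    have "L' * part_factor (m + 1) = (\<Prod>p=m+1..2*m+2. part_factor p)"
      unfolding L'_def by (subst (2) prod.atLeast_Suc_atMost) (simp_all add: mult.commute)
    also have "\<dots> = L * part_factor (2 * m + 1) * part_factor (2 * m + 2)"
      unfolding L_def by (simp add: numeral_2_eq_2)
    finally show ?thesis .
  qed
  have q2: "qf (2 * Suc m) = qf (2 * m) * (1 - X ^ (2 * m + 1)) * (1 - X ^ (2 * m + 2))"
    by (simp add: qf_Suc X_def flip: power_Suc)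
  have rr: "r' * (1 - X ^ (2 * m + 1)) * (1 - X ^ (2 * m + 2)) = r"
  proof -
    have "qf (2 * m) * (r' * (1 - X ^ (2 * m + 1)) * (1 - X ^ (2 * m + 2))) = qf (2 * Suc m) * r'"
      unfolding q2 by (simp only: mult_ac)
    also have "\<dots> = qf (2 * m) * r" unfolding r_def r'_def by (simp only: qf_inverse)
    finally show ?thesis by simp
  qed
  have IH: "L = Od * (qf m ^ 2 * r) * even_factor m" using Suc by (simp add: L_def Od_def r_def X_def)
  have pf: "part_factor (m + 1) * (1 - X ^ (m + 1)) = 1 + X ^ (m + 1)"
    "part_factor (2 * m + 1) * (1 - X ^ (2 * m + 1)) = 1 + X ^ (2 * m + 1)"
    unfolding X_def by (rule part_factor_eq; simp)+
  have fac: "1 - X ^ (2 * m + 2) = (1 - X ^ (m + 1)) * (1 + X ^ (m + 1))"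
    by (simp add: algebra_simps flip: power_add) (simp add: mult_2_right)
  have even: "even_factor (Suc m) = even_factor m * part_factor (2 * m + 2)"
    by (simp add: even_factor_def)
  let ?u = "(1 - X ^ (m + 1)) * (1 - X ^ (2 * m + 1))"
  have "?u * (part_factor (m + 1) * L') = (1 - X ^ (m + 1)) * L * (part_factor (2 * m + 1) * (1 - X ^ (2 * m + 1))) * part_factor (2 * m + 2)"
    using LL' by (simp add: mult_ac)
  also have "\<dots> = (1 - X ^ (m + 1)) * (1 + X ^ (2 * m + 1)) * Od * qf m ^ 2 * r * even_factor m * part_factor (2 * m + 2)"
    unfolding pf(2) IH by (simp only: mult_ac)
  also have "\<dots> = (1 - X ^ (m + 1)) * (1 + X ^ (2 * m + 1)) * Od * qf m ^ 2
      * (r' * (1 - X ^ (2 * m + 1)) * ((1 - X ^ (m + 1)) * (1 + X ^ (m + 1)))) * even_factor (Suc m)"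
    unfolding rr[symmetric] fac[symmetric] even by (simp only: mult_ac)
  also have "\<dots> = ?u * (part_factor (m + 1) * ((Od * (1 + X ^ (2 * m + 1))) * ((qf m * (1 - X ^ (m + 1))) ^ 2 * r') * even_factor (Suc m)))"
    unfolding pf(1)[symmetric] power2_eq_square by (simp only: mult_ac)
  finally have "part_factor (m + 1) * L' = part_factor (m + 1) * ((Od * (1 + X ^ (2 * m + 1))) * ((qf m * (1 - X ^ (m + 1))) ^ 2 * r') * even_factor (Suc m))"
  proof (rule mult_left_cancel[THEN iffD1, rotated])
    have "?u $ 0 = 1" by (simp add: X_def)
    then show "?u \<noteq> 0" by (metis fps_zero_nth zero_neq_one)
  qed
  moreover have "part_factor (m + 1) \<noteq> 0"
    using part_factor_nth[of "m + 1" 0] by auto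
  ultimately have "L' = (Od * (1 + X ^ (2 * m + 1))) * ((qf m * (1 - X ^ (m + 1))) ^ 2 * r') * even_factor (Suc m)"
    by simp
  then show ?case unfolding L'_def Od_def r'_def X_def by (simp add: qf_Suc)
qed

lemma finite_parts_factor:
  assumes "m \<in> {1..K}"
  shows "(\<Prod>p\<in>finite_parts K m. part_factor p)
    = (\<Prod>i=1..m. 1 + fps_X ^ (2 * i - 1)) * (qf m ^ 2 * inverse (qf (2 * m))) * even_factor K"
proof -
  have "(\<Prod>p\<in>finite_parts K m. part_factor p) = (\<Prod>p=m+1..2*m. part_factor p) * (\<Prod>p\<in>(*) 2 ` {m + 1..K}. part_factor p)"
    unfolding finite_parts_def by (rule prod.union_disjoint) auto
  also have "(\<Prod>p\<in>(*) 2 ` {m + 1..K}. part_factor p) = (\<Prod>j\<in>{m + 1..K}. part_factor (2 * j))"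
    by (subst prod.reindex) (auto simp: inj_on_def)
  also have "(\<Prod>p=m+1..2*m. part_factor p) * (\<Prod>j\<in>{m + 1..K}. part_factor (2 * j))
      = (\<Prod>i=1..m. 1 + fps_X ^ (2 * i - 1)) * (qf m ^ 2 * inverse (qf (2 * m)))
          * (even_factor m * (\<Prod>j\<in>{m + 1..K}. part_factor (2 * j)))"
    unfolding part_factor_interval by (simp only: mult_ac)
  also have "even_factor m * (\<Prod>j\<in>{m + 1..K}. part_factor (2 * j)) = even_factor K"
  proof -
    have "{1..K} = {1..m} \<union> {m + 1..K}" using assms by auto
    then show ?thesis unfolding even_factor_def by (subst prod.union_disjoint[symmetric]) auto
  qed
  finally show ?thesis .
qed

text \<open>
  The infinite product of \<open>(1 + q^(2j))/(1 - q^(2j))\<close> is \<open>1/\<phi>(-q^2)\<close>.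
\<close>

lemma even_factor_theta: "agree (Suc K) (even_factor K * theta (-1) 2 2) 1"
proof -
  let ?e = "\<lambda>d. \<Sum>j=1..Suc K. ((if d = 2 * (2 * j) then 1 else 0) - (if d = 2 * j then 1 else 0)) + - (if d = 2 * j then 1 else (0 :: complex))"
  have "euler_product (even_factor (Suc K)) ?e"
    unfolding even_factor_def part_factor_def
    by (intro euler_product_prod euler_product_mult euler_product_one_plus euler_product_inverse euler_product_one_minus) auto
  from euler_product_mult[OF this euler_product_theta_minus[of 2 2]]
  have "euler_product (even_factor (Suc K) * theta (-1) 2 2) (\<lambda>d. ?e d + of_int (triple_minus 2 2 d))" by simp
  moreover have "?e d + of_int (triple_minus 2 2 d) = 0" if d: "0 < d" "d < Suc K" for d
  proof -
    have s4: "(\<Sum>j=1..Suc K. if d = 2 * (2 * j) then 1 else 0) = (of_bool (4 dvd d) :: complex)"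
      using count_progression[of 4 0 d "Suc K", where 'a = complex] d by simp
    have s2: "(\<Sum>j=1..Suc K. if d = 2 * j then 1 else 0) = (of_bool (2 dvd d) :: complex)"
      using count_progression[of 2 0 d "Suc K", where 'a = complex] d by simp
    have "?e d = of_bool (4 dvd d) - 2 * (of_bool (2 dvd d) :: complex)"
      unfolding sum.distrib sum_subtractf sum_negf s4 s2 by simp
    moreover have "triple_minus 2 2 d = 2 * of_bool (2 dvd d) - of_bool (4 dvd d)"
    proof -
      have "\<forall>r\<in>set [0..<4]. triple_minus 2 2 r = 2 * of_bool (2 dvd r) - of_bool (4 dvd r)" by code_simp
      from bspec[OF this, of "d mod 4"] show ?thesis
        by (simp add: triple_minus_mod dvd_mod_iff)
    qed
    ultimately show ?thesis by simp
  qed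
  ultimately have "agree (Suc K) (even_factor (Suc K) * theta (-1) 2 2) 1"
    using euler_product_agree[OF _ euler_product_1] by blast
  moreover have "agree (Suc K) (even_factor K) (even_factor (Suc K))"
  proof -
    have "agree (Suc K) 1 (part_factor (2 * Suc K))"
      by (auto simp: agree_def part_factor_nth dest: dvd_imp_le)
    from agree_mult[OF agree_refl this, of "even_factor K"] show ?thesis by (simp add: even_factor_def)
  qed
  ultimately show ?thesis using agree_mult[OF _ agree_refl] agree_trans by blast
qed

text \<open>
  Since \<open>\<phi>(-q^2)\<close> is a series in \<open>q^2\<close>, it becomes \<open>phi\<close> when the odd part is taken.
\<close>

theorem spt_series_odd_part: "Abs_fps (\<lambda>n. of_nat (spt_omega_bar (2 * n + 1))) * phi = sig"
proof -
  have coeff: "(theta (-1) 2 2 * spt_series) $ n = of_nat (sigma n)" if "odd n" for n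
  proof -
    let ?S = "\<Sum>m=1..n. geo2 m * (\<Prod>p\<in>finite_parts n m. part_factor p)"
    have "?S = smallest_series n * even_factor n"
      unfolding smallest_series_def sum_distrib_right by (intro sum.cong refl) (simp add: finite_parts_factor mult_ac)
    then have "agree (Suc n) (theta (-1) 2 2 * spt_series) (theta (-1) 2 2 * (smallest_series n * even_factor n))"
      using agree_mult[OF agree_refl spt_series_agree[of n], of "theta (-1) 2 2"] by simp
    also have "theta (-1) 2 2 * (smallest_series n * even_factor n) = smallest_series n * (even_factor n * theta (-1) 2 2)"
      by (simp only: mult_ac)
    also have "agree (Suc n) \<dots> (smallest_series n * 1)"
      by (rule agree_mult[OF agree_refl even_factor_theta])
    finally show ?thesis using smallest_series_odd[OF that, of n] by (simp add: agree_def)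
  qed
  have "theta (-1) 2 2 = phi oo fps_X ^ 2" by (simp add: phi_def theta_dilate)
  then have "phi * dissect 2 1 spt_series = dissect 2 1 (theta (-1) 2 2 * spt_series)"
    by (simp add: dissect_dilate_mult)
  also have "\<dots> = sig" by (simp add: fps_eq_iff coeff sig_def sigma_odd_series_def)
  finally show ?thesis by (simp add: dissect_def spt_series_def mult.commute)
qed

section \<open>The congruences\<close>

theorem corollary1p3:
  fixes l k n :: nat
  assumes "l \<ge> 1"
  shows "[spt_omega_bar (5 ^ (2 * k + l - 1) * (10 * n + 5))
            = spt_omega_bar (5 ^ (l - 1) * (10 * n + 5))] (mod 5 ^ l)
       \<and> [spt_omega_bar (5 ^ (2 * l) * (10 * n + 3))
            = spt_omega_bar (5 ^ (2 * l) * (10 * n + 7))] (mod 5 ^ (2 * l))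
       \<and> [spt_omega_bar (5 ^ (2 * l) * (10 * n + 7)) = 0] (mod 5 ^ (2 * l))"
proof -
  note cong = congruences_of_phi_quotient[of spt_omega_bar, OF spt_series_odd_part]
  have shift: "5 ^ (i - 1) * (10 * n + 5) = 5 ^ i * (2 * n + 1)" if "i \<ge> 1" for i
    using that by (cases i) (simp_all add: algebra_simps)
  have "[spt_omega_bar (5 ^ (2 * k + l) * (2 * n + 1)) = spt_omega_bar (5 ^ l * (2 * n + 1))] (mod 5 ^ l)"
  proof (induction k)
    case (Suc k)
    have "[spt_omega_bar (5 ^ (2 * k + l + 2) * (2 * n + 1)) = spt_omega_bar (5 ^ (2 * k + l) * (2 * n + 1))] (mod 5 ^ l)"
      by (rule cong_dvd_modulus_nat[OF cong(1)]) (use assms in \<open>auto intro: le_imp_power_dvd\<close>)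
    with Suc show ?case by (simp add: cong_trans)
  qed simp
  moreover have "2 * k + l - 1 = (2 * k + l) - 1" by simp
  ultimately have 1: "[spt_omega_bar (5 ^ (2 * k + l - 1) * (10 * n + 5))
      = spt_omega_bar (5 ^ (l - 1) * (10 * n + 5))] (mod 5 ^ l)"
    using assms by (simp only: shift)
  have "5 ^ (2 * l) dvd spt_omega_bar (5 ^ (2 * l) * (2 * (5 * n + r) + 1))" if "r \<in> {1, 3}" for r
    using cong(2)[of "2 * l" r n] that assms by simp
  from this[of 1] this[of 3]
  have "5 ^ (2 * l) dvd spt_omega_bar (5 ^ (2 * l) * (10 * n + 3))"
    "5 ^ (2 * l) dvd spt_omega_bar (5 ^ (2 * l) * (10 * n + 7))"
    by (simp_all add: algebra_simps)
  then show ?thesis using 1 by (simp add: cong_def)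
qed

end
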